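(* For every integer $m\ge3$ there is a Poincaré–Einstein metric on a disk bundle in the total space of $\mathcal{O}(-m)\to\mathbb{CP}^1$ which is not Kähler, but is conformal to a scalar-flat Kähler metric.
   Context: A disk bundle in $\mathcal{O}(-m)$ is a tubular neighbourhood of the zero section whose fibres over $\mathbb{CP}^1$ are disks. Let $N$ be the interior of a compact manifold with boundary $\overline N$. A smooth function $v$ on $\overline N$ defines $\partial\overline N$ if $v>0$ on $N$, and $v=0$, $dv\ne0$ on $\partial\overline N$. A metric $k$ on $N$ is conformally compact if there is a defining function $v$ such that $v^2k$ extends to a smooth metric on $\overline N$. A conformally compact Einstein metric is called Poincaré–Einstein. *)

theory Defs
  imports "HOL-Analysis.Analysis"
begin

section \<open>Smooth functions of several real variables\<close>

definition partial :: "'n::finite \<Rightarrow> (real^'n \<Rightarrow> real) \<Rightarrow> real^'n \<Rightarrow> real" where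
  "partial i f x = frechet_derivative f (at x) (axis i 1)"

primrec Ck_on :: "nat \<Rightarrow> (real^'n::finite) set \<Rightarrow> (real^'n \<Rightarrow> real) \<Rightarrow> bool" where
  "Ck_on 0 W f \<longleftrightarrow> continuous_on W f"
| "Ck_on (Suc k) W f \<longleftrightarrow> f differentiable_on W \<and> (\<forall>i. Ck_on k W (partial i f))"

text \<open>On an arbitrary subset, smoothness means that locally there is a smooth extension to an
  open set. For open sets this is the usual notion; for closures of domains with
  smooth boundary it is smoothness up to the boundary.\<close>

definition smooth_on :: "(real^'n::finite) set \<Rightarrow> (real^'n \<Rightarrow> real) \<Rightarrow> bool" where
  "smooth_on S f \<longleftrightarrow>
     (\<forall>x\<in>S. \<exists>W F. open W \<and> x \<in> W \<and> (\<forall>k. Ck_on k W F) \<and> (\<forall>y\<in>S \<inter> W. F y = f y))"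

section \<open>Manifolds given by an indexed family of charts\<close>

type_synonym ('i, 'p, 'n) atlas = "'i \<Rightarrow> 'p set \<times> ('p \<Rightarrow> (real, 'n) vec)"

definition chart_dom :: "('i, 'p, 'n::finite) atlas \<Rightarrow> 'i \<Rightarrow> 'p set" where
  "chart_dom A i = fst (A i)"

definition coord :: "('i, 'p, 'n::finite) atlas \<Rightarrow> 'i \<Rightarrow> 'p \<Rightarrow> real^'n" where
  "coord A i = snd (A i)"

definition carrier :: "('i, 'p, 'n::finite) atlas \<Rightarrow> 'p set" where
  "carrier A = (\<Union>i. chart_dom A i)"

definition chart_image :: "('i, 'p, 'n::finite) atlas \<Rightarrow> 'i \<Rightarrow> 'p set \<Rightarrow> (real^'n) set" where
  "chart_image A i S = coord A i ` (S \<inter> chart_dom A i)"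

definition chart_inv :: "('i, 'p, 'n::finite) atlas \<Rightarrow> 'i \<Rightarrow> real^'n \<Rightarrow> 'p" where
  "chart_inv A i = inv_into (chart_dom A i) (coord A i)"

definition transition :: "('i, 'p, 'n::finite) atlas \<Rightarrow> 'i \<Rightarrow> 'i \<Rightarrow> real^'n \<Rightarrow> real^'n" where
  "transition A i j = coord A j \<circ> chart_inv A i"

definition manifold_topology :: "('i, 'p, 'n::finite) atlas \<Rightarrow> 'p topology" where
  "manifold_topology A = topology (\<lambda>U. U \<subseteq> carrier A \<and> (\<forall>i. open (chart_image A i U)))"

definition smooth_fun :: "('i, 'p, 'n::finite) atlas \<Rightarrow> 'p set \<Rightarrow> ('p \<Rightarrow> real) \<Rightarrow> bool" where
  "smooth_fun A S f \<longleftrightarrow> (\<forall>i. smooth_on (chart_image A i S) (f \<circ> chart_inv A i))"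

text \<open>The derivative is taken within \<open>S\<close>, so that this applies to boundary points of closures of
  domains with smooth boundary, where it is still unique.\<close>

definition nonzero_differential ::
  "('i, 'p, 'n::finite) atlas \<Rightarrow> 'p set \<Rightarrow> ('p \<Rightarrow> real) \<Rightarrow> 'p \<Rightarrow> bool" where
  "nonzero_differential A S f p \<longleftrightarrow>
     (\<forall>i. p \<in> chart_dom A i \<longrightarrow>
        (\<exists>D. ((f \<circ> chart_inv A i) has_derivative D) (at (coord A i p) within chart_image A i S)
           \<and> D \<noteq> (\<lambda>_. 0)))"

text \<open>The closure of \<open>N\<close> is a compact manifold with boundary embedded in the ambient manifold,
  and \<open>N\<close> is its interior.\<close>

definition compact_domain_with_boundary :: "('i, 'p, 'n::finite) atlas \<Rightarrow> 'p set \<Rightarrow> bool" where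
  "compact_domain_with_boundary A N \<longleftrightarrow>
     openin (manifold_topology A) N \<and>
     compactin (manifold_topology A) (manifold_topology A closure_of N) \<and>
     (\<forall>p \<in> manifold_topology A frontier_of N.
        \<exists>W \<rho>. openin (manifold_topology A) W \<and> p \<in> W \<and> smooth_fun A W \<rho> \<and>
          nonzero_differential A W \<rho> p \<and> W \<inter> N = {q \<in> W. \<rho> q < 0})"

section \<open>Tensor fields\<close>

text \<open>A tensor field with two indices is given by its matrix of components in each chart
  (\<open>T i x $ a $ b\<close> at the point with coordinates \<open>x\<close> in chart \<open>i\<close>), subject to the
  transformation law. Only values over the subset \<open>S\<close> on which the field lives matter.\<close>

type_synonym ('i, 'n) field2 = "'i \<Rightarrow> (real, 'n) vec \<Rightarrow> ((real, 'n) vec, 'n) vec"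

definition smooth_components ::
  "('i, 'p, 'n::finite) atlas \<Rightarrow> 'p set \<Rightarrow> ('i, 'n) field2 \<Rightarrow> bool" where
  "smooth_components A S T \<longleftrightarrow> (\<forall>i a b. smooth_on (chart_image A i S) (\<lambda>x. T i x $ a $ b))"

definition covariant_tensor ::
  "('i, 'p, 'n::finite) atlas \<Rightarrow> 'p set \<Rightarrow> ('i, 'n) field2 \<Rightarrow> bool" where
  "covariant_tensor A S T \<longleftrightarrow> smooth_components A S T \<and>
     (\<forall>i j. \<forall>p \<in> S \<inter> chart_dom A i \<inter> chart_dom A j.
        let D = jacobian (transition A i j) (at (coord A i p)) in
          T i (coord A i p) = transpose D ** T j (coord A j p) ** D)"

definition endomorphism_field ::
  "('i, 'p, 'n::finite) atlas \<Rightarrow> 'p set \<Rightarrow> ('i, 'n) field2 \<Rightarrow> bool" where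
  "endomorphism_field A S T \<longleftrightarrow> smooth_components A S T \<and>
     (\<forall>i j. \<forall>p \<in> S \<inter> chart_dom A i \<inter> chart_dom A j.
        let D = jacobian (transition A i j) (at (coord A i p)) in
          D ** T i (coord A i p) = T j (coord A j p) ** D)"

definition riemannian_metric ::
  "('i, 'p, 'n::finite) atlas \<Rightarrow> 'p set \<Rightarrow> ('i, 'n) field2 \<Rightarrow> bool" where
  "riemannian_metric A S g \<longleftrightarrow> covariant_tensor A S g \<and>
     (\<forall>i. \<forall>x \<in> chart_image A i S.
        transpose (g i x) = g i x \<and> (\<forall>u. u \<noteq> 0 \<longrightarrow> u \<bullet> (g i x *v u) > 0))"

section \<open>Curvature, in local coordinates\<close>

text \<open>\<open>christoffel g k i j x\<close> is \<open>\<Gamma>\<^sup>k\<^sub>i\<^sub>j\<close> of the Levi-Civita connection, and \<open>ricci g\<close> is the trace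
  \<open>R\<^sup>i\<^sub>j\<^sub>i\<^sub>k\<close> of its curvature (positive on round spheres).\<close>

definition christoffel ::
  "(real^'n::finite \<Rightarrow> real^'n^'n) \<Rightarrow> 'n \<Rightarrow> 'n \<Rightarrow> 'n \<Rightarrow> real^'n \<Rightarrow> real" where
  "christoffel g k i j x =
     (\<Sum>l\<in>UNIV. matrix_inv (g x) $ k $ l *
        (partial i (\<lambda>y. g y $ j $ l) x + partial j (\<lambda>y. g y $ i $ l) x
         - partial l (\<lambda>y. g y $ i $ j) x)) / 2"

definition ricci :: "(real^'n::finite \<Rightarrow> real^'n^'n) \<Rightarrow> real^'n \<Rightarrow> real^'n^'n" where
  "ricci g x = (\<chi> j k.
     (\<Sum>i\<in>UNIV. partial i (christoffel g i j k) x - partial j (christoffel g i i k) x)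
     + (\<Sum>i\<in>UNIV. \<Sum>l\<in>UNIV. christoffel g i i l x * christoffel g l j k x
                       - christoffel g i j l x * christoffel g l i k x))"

definition scalar_curvature :: "(real^'n::finite \<Rightarrow> real^'n^'n) \<Rightarrow> real^'n \<Rightarrow> real" where
  "scalar_curvature g x = (\<Sum>j\<in>UNIV. \<Sum>k\<in>UNIV. matrix_inv (g x) $ j $ k * ricci g x $ j $ k)"

definition einstein ::
  "('i, 'p, 'n::finite) atlas \<Rightarrow> 'p set \<Rightarrow> ('i, 'n) field2 \<Rightarrow> bool" where
  "einstein A N g \<longleftrightarrow> riemannian_metric A N g \<and>
     (\<exists>c::real. \<forall>i. \<forall>x \<in> chart_image A i N. ricci (g i) x = c *\<^sub>R g i x)"

definition scalar_flat ::
  "('i, 'p, 'n::finite) atlas \<Rightarrow> 'p set \<Rightarrow> ('i, 'n) field2 \<Rightarrow> bool" where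
  "scalar_flat A N g \<longleftrightarrow> (\<forall>i. \<forall>x \<in> chart_image A i N. scalar_curvature (g i) x = 0)"

definition conformal ::
  "('i, 'p, 'n::finite) atlas \<Rightarrow> 'p set \<Rightarrow> ('i, 'n) field2 \<Rightarrow> ('i, 'n) field2 \<Rightarrow> bool" where
  "conformal A N g g' \<longleftrightarrow>
     (\<exists>f. smooth_fun A N f \<and> (\<forall>p\<in>N. f p > 0) \<and>
        (\<forall>i. \<forall>p \<in> N \<inter> chart_dom A i. g' i (coord A i p) = f p *\<^sub>R g i (coord A i p)))"

section \<open>Kaehler metrics\<close>

text \<open>Components are \<open>J\<^sup>k\<^sub>i = J x $ k $ i\<close>, so that \<open>J x *v u\<close> is the action on tangent vectors.
  Integrability is the vanishing of the Nijenhuis tensor.\<close>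

definition nijenhuis ::
  "(real^'n::finite \<Rightarrow> real^'n^'n) \<Rightarrow> 'n \<Rightarrow> 'n \<Rightarrow> 'n \<Rightarrow> real^'n \<Rightarrow> real" where
  "nijenhuis J k i j x = (\<Sum>l\<in>UNIV.
       J x $ l $ i * partial l (\<lambda>y. J y $ k $ j) x
     - J x $ l $ j * partial l (\<lambda>y. J y $ k $ i) x
     - J x $ k $ l * (partial i (\<lambda>y. J y $ l $ j) x - partial j (\<lambda>y. J y $ l $ i) x))"

definition complex_structure ::
  "('i, 'p, 'n::finite) atlas \<Rightarrow> 'p set \<Rightarrow> ('i, 'n) field2 \<Rightarrow> bool" where
  "complex_structure A N J \<longleftrightarrow> endomorphism_field A N J \<and>
     (\<forall>i. \<forall>x \<in> chart_image A i N.
        J i x ** J i x = - mat 1 \<and> (\<forall>k a b. nijenhuis (J i) k a b x = 0))"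

definition closed_2form :: "(real^'n::finite \<Rightarrow> real^'n^'n) \<Rightarrow> real^'n \<Rightarrow> bool" where
  "closed_2form \<omega> x \<longleftrightarrow> (\<forall>a b c.
     partial a (\<lambda>y. \<omega> y $ b $ c) x + partial b (\<lambda>y. \<omega> y $ c $ a) x
     + partial c (\<lambda>y. \<omega> y $ a $ b) x = 0)"

text \<open>The matrix \<open>transpose J ** g\<close> is that of the fundamental form \<open>\<omega>(u, v) = g(J u, v)\<close>.\<close>

definition kaehler ::
  "('i, 'p, 'n::finite) atlas \<Rightarrow> 'p set \<Rightarrow> ('i, 'n) field2 \<Rightarrow> bool" where
  "kaehler A N g \<longleftrightarrow> riemannian_metric A N g \<and>
     (\<exists>J. complex_structure A N J \<and>
        (\<forall>i. \<forall>x \<in> chart_image A i N.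
           transpose (J i x) ** g i x ** J i x = g i x \<and>
           closed_2form (\<lambda>y. transpose (J i y) ** g i y) x))"

section \<open>Poincare--Einstein metrics\<close>

definition defining_function ::
  "('i, 'p, 'n::finite) atlas \<Rightarrow> 'p set \<Rightarrow> ('p \<Rightarrow> real) \<Rightarrow> bool" where
  "defining_function A N v \<longleftrightarrow>
     smooth_fun A (manifold_topology A closure_of N) v \<and>
     (\<forall>p\<in>N. v p > 0) \<and>
     (\<forall>p \<in> manifold_topology A frontier_of N.
        v p = 0 \<and> nonzero_differential A (manifold_topology A closure_of N) v p)"

definition conformally_compact ::
  "('i, 'p, 'n::finite) atlas \<Rightarrow> 'p set \<Rightarrow> ('i, 'n) field2 \<Rightarrow> bool" where
  "conformally_compact A N k \<longleftrightarrow>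
     compact_domain_with_boundary A N \<and> riemannian_metric A N k \<and>
     (\<exists>v h. defining_function A N v \<and>
        riemannian_metric A (manifold_topology A closure_of N) h \<and>
        (\<forall>i. \<forall>p \<in> N \<inter> chart_dom A i. h i (coord A i p) = (v p)\<^sup>2 *\<^sub>R k i (coord A i p)))"

definition poincare_einstein ::
  "('i, 'p, 'n::finite) atlas \<Rightarrow> 'p set \<Rightarrow> ('i, 'n) field2 \<Rightarrow> bool" where
  "poincare_einstein A N k \<longleftrightarrow> conformally_compact A N k \<and> einstein A N k"

section \<open>The total space of the line bundle of degree \<open>d\<close> over the projective line\<close>

text \<open>Two copies of \<open>\<complex> \<times> \<complex>\<close>, with base coordinate \<open>z\<close> and linear fibre coordinate \<open>w\<close>, are glued by
  \<open>(z, w) \<mapsto> (1 / z, z\<^bsup>-d\<^esup> w)\<close>. For \<open>d = -1\<close> this is the tautological bundle: the vector \<open>(v\<^sub>0, v\<^sub>1)\<close>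
  on the line \<open>[v\<^sub>0 : v\<^sub>1]\<close> has \<open>z = v\<^sub>1 / v\<^sub>0\<close>, \<open>w = v\<^sub>0\<close> in the first copy and \<open>z = v\<^sub>0 / v\<^sub>1\<close>, \<open>w = v\<^sub>1\<close>
  in the second. The copies, and hence the two charts, are indexed by \<open>bool\<close>; points of the
  total space are equivalence classes.\<close>

type_synonym bundle_point = "(bool \<times> complex \<times> complex) set"

definition glue :: "int \<Rightarrow> ((bool \<times> complex \<times> complex) \<times> (bool \<times> complex \<times> complex)) set" where
  "glue d = {((i, z, w), (j, z', w')).
     (i = j \<and> z = z' \<and> w = w') \<or> (i \<noteq> j \<and> z \<noteq> 0 \<and> z' = 1 / z \<and> w' = z powi (- d) * w)}"

definition bpoint :: "int \<Rightarrow> bool \<Rightarrow> complex \<Rightarrow> complex \<Rightarrow> bundle_point" where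
  "bpoint d i z w = glue d `` {(i, z, w)}"

definition total_space :: "int \<Rightarrow> bundle_point set" where
  "total_space d = UNIV // glue d"

definition complex2_to_real4 :: "complex \<times> complex \<Rightarrow> real^4" where
  "complex2_to_real4 = (\<lambda>(z, w). vector [Re z, Im z, Re w, Im w])"

definition line_bundle :: "int \<Rightarrow> (bool, bundle_point, 4) atlas" where
  "line_bundle d i =
     ({p \<in> total_space d. \<exists>q. (i, q) \<in> p}, \<lambda>p. complex2_to_real4 (THE q. (i, q) \<in> p))"

text \<open>The squared fibre norm of a smooth Hermitian metric on the line bundle.\<close>

definition hermitian_norm_sq :: "int \<Rightarrow> (bundle_point \<Rightarrow> real) \<Rightarrow> bool" where
  "hermitian_norm_sq d H \<longleftrightarrow>
     smooth_fun (line_bundle d) (total_space d) H \<and>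
     (\<forall>i z w. H (bpoint d i z w) = (cmod w)\<^sup>2 * H (bpoint d i z 1) \<and> H (bpoint d i z 1) > 0)"

definition disk_bundle :: "int \<Rightarrow> bundle_point set \<Rightarrow> bool" where
  "disk_bundle d N \<longleftrightarrow> (\<exists>H. hermitian_norm_sq d H \<and> N = {p \<in> total_space d. H p < 1})"

section \<open>Basic facts\<close>

lemma openin_manifold_topology:
  assumes inj: "\<And>i. inj_on (coord A i) (chart_dom A i)"
  shows "openin (manifold_topology A) U \<longleftrightarrow> U \<subseteq> carrier A \<and> (\<forall>i. open (chart_image A i U))"
proof -
  have int: "chart_image A i (S \<inter> T) = chart_image A i S \<inter> chart_image A i T" for i S T
    using inj[of i] unfolding chart_image_def inj_on_def by blast
  have un: "chart_image A i (\<Union>K) = (\<Union>S\<in>K. chart_image A i S)" for i K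
    unfolding chart_image_def by blast
  have "istopology (\<lambda>U. U \<subseteq> carrier A \<and> (\<forall>i. open (chart_image A i U)))"
    unfolding istopology_def by (auto simp: int un intro!: open_Int open_UN)
  then show ?thesis
    unfolding manifold_topology_def by (simp add: topology_inverse')
qed

lemma equiv_glue: "equiv UNIV (glue d)"
proof (rule equivI)
  show "refl (glue d)" by (auto simp: refl_on_def glue_def)
  show "sym (glue d)"
    by (auto simp: sym_def glue_def power_int_minus power_int_divide_distrib field_simps)
  show "trans (glue d)"
    by (auto simp: trans_def glue_def power_int_minus power_int_divide_distrib field_simps)
qed auto

lemma total_space_eq: "total_space d = {bpoint d i z w |i z w. True}"
  by (auto simp: total_space_def quotient_def bpoint_def)

lemma the_coords_bpoint: "(THE q. (i, q) \<in> bpoint d i z w) = (z, w)"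
  by (rule the_equality) (auto simp: bpoint_def glue_def)

lemma bpoint_glue:
  "z \<noteq> 0 \<Longrightarrow> bpoint d (\<not> i) (1 / z) (z powi (- d) * w) = bpoint d i z w"
  unfolding bpoint_def
  by (rule equiv_class_eq[OF equiv_glue, symmetric]) (auto simp: glue_def)

lemma chart_dom_line_bundle: "chart_dom (line_bundle d) i = {bpoint d i z w |z w. True}"
proof -
  have "p = bpoint d i z w" if "p \<in> total_space d" "(i, z, w) \<in> p" for p z w
  proof -
    obtain a where a: "p = glue d `` {a}"
      using \<open>p \<in> total_space d\<close> unfolding total_space_def by (auto elim: quotientE)
    then have "(a, (i, z, w)) \<in> glue d" using that(2) by simp
    then show ?thesis unfolding a bpoint_def by (rule equiv_class_eq[OF equiv_glue])
  qed
  moreover have "(i, z, w) \<in> bpoint d i z w" for z w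
    by (auto simp: bpoint_def glue_def)
  ultimately show ?thesis
    unfolding chart_dom_def line_bundle_def by (fastforce simp: total_space_eq)
qed

lemma coord_line_bundle:
  "coord (line_bundle d) i (bpoint d i z w) = vector [Re z, Im z, Re w, Im w]"
  by (simp add: coord_def line_bundle_def the_coords_bpoint complex2_to_real4_def)

lemma carrier_line_bundle: "carrier (line_bundle d) = total_space d"
  unfolding carrier_def chart_dom_line_bundle total_space_eq by blast

lemma vector_4:
  "(vector [a, b, c, e] :: real^4) $ 1 = a" "(vector [a, b, c, e] :: real^4) $ 2 = b"
  "(vector [a, b, c, e] :: real^4) $ 3 = c" "(vector [a, b, c, e] :: real^4) $ 4 = e"
  by (simp_all add: vector_def)

lemma bij_betw_coord_line_bundle: "bij_betw (coord (line_bundle d) i) (chart_dom (line_bundle d) i) UNIV"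
proof -
  have "x \<in> coord (line_bundle d) i ` chart_dom (line_bundle d) i" for x
  proof -
    have "x = coord (line_bundle d) i (bpoint d i (Complex (x$1) (x$2)) (Complex (x$3) (x$4)))"
      unfolding coord_line_bundle by (simp add: vec_eq_iff forall_4 vector_4)
    then show ?thesis unfolding chart_dom_line_bundle by blast
  qed
  moreover have "inj_on (coord (line_bundle d) i) (chart_dom (line_bundle d) i)"
    unfolding chart_dom_line_bundle inj_on_def
    by (auto simp: coord_line_bundle vec_eq_iff[of "vector _"] forall_4 vector_4 complex_eq_iff
        intro!: arg_cong2[where f = "bpoint d i"])
  ultimately show ?thesis unfolding bij_betw_def by blast
qed

end

theory Submission
  imports Defs
begin

text \<open>Put \<open>x = (1 + |z|\<^sup>2)\<^sup>m |w|\<^sup>2\<close>, and let \<open>s = s(x)\<close> be the solution of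
  \<open>(s - 1) ((s + m - 1) / m)\<^bsup>m-1\<^esup> = x\<close>. LeBrun's metric
  \<open>g = m s |dz|\<^sup>2 / (1 + |z|\<^sup>2)\<^sup>2 + s'(x) (1 + |z|\<^sup>2)\<^sup>m |dw + m w z\<^sup>* dz / (1 + |z|\<^sup>2)|\<^sup>2\<close> is a scalar-flat Kaehler
  metric on all of \<open>O(-m)\<close>, and \<open>k = g / (c - s)\<^sup>2\<close> with \<open>c = 2 (m - 1) / (m - 2)\<close> is Einstein on the disk
  bundle \<open>s < c\<close>, where \<open>c - s\<close> is a defining function. Both metrics are invariant under U(2), which acts by
  Moebius transformations and moves every point to \<open>z = 0, w \<ge> 0\<close>. Hence, curvature being natural under
  isometries, the Ricci tensor is only needed at such points, where it follows from the second-order jet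
  of the metric. The transition function of the bundle is one of these Moebius transformations.

  If \<open>k\<close> were Kaehler for some \<open>J\<close>, then \<open>J\<close> would be parallel, so it would commute with the curvature
  endomorphisms. At a point of the zero section these admit no common commuting \<open>J\<close> with \<open>J\<^sup>2 = -1\<close>.\<close>

section \<open>Calculus of smooth functions\<close>

text \<open>The profile comes from one ordinary differential equation. Put
  \<open>phi(s) = x s'(x)\<close>. For the Kaehler metric with \<open>A = m s\<close> and
  \<open>b = s'\<close>, scalar-flatness reads \<open>(s phi)'' = 2 / m\<close>; closing up smoothly
  at the zero section \<open>s = 1\<close> means \<open>phi(1) = 0\<close> and
  \<open>phi'(1) = 1\<close>. Hence \<open>phi = (s - 1) (s + m - 1) / (m s)\<close>, and
  integrating \<open>ds / phi = dx / x\<close> yields the implicit equation for \<open>s\<close>.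
  For \<open>k = g / u^2\<close> in dimension four, the trace-free Ricci tensor of \<open>k\<close>
  is that of \<open>g\<close> plus \<open>2 / u\<close> times the trace-free Hessian of
  \<open>u\<close>. For \<open>u\<close> affine in \<open>s\<close> both terms are multiples of one
  tensor: the Ricci tensor of \<open>g\<close> contributes a constant over \<open>s^2\<close>, the
  Hessian of \<open>s\<close> a constant times \<open>(s - c) / s^2\<close>. They cancel for
  \<open>u = c - s\<close>, which is the origin of \<open>c\<close>. For \<open>m = 2\<close> the
  first constant vanishes, \<open>g\<close> is the Ricci-flat Eguchi-Hanson metric, and
  \<open>c\<close> goes to infinity. \<open>k\<close> must fail to be Kaehler for every
  \<open>J\<close>, not only for the standard one; this is why the obstruction is taken from the
  curvature, which \<open>k\<close> alone determines.\<close>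

lemma partial_eq: "(f has_derivative D) (at x) \<Longrightarrow> partial i f x = D (axis i 1)"
  using frechet_derivative_at[of f D x] by (simp add: partial_def)

lemma partial_cong:
  assumes "open U" "x \<in> U" "\<And>y. y \<in> U \<Longrightarrow> f y = g y"
  shows "partial i f x = partial i g x"
proof -
  have "(f has_derivative D) (at x) \<longleftrightarrow> (g has_derivative D) (at x)" for D
    using assms has_derivative_transform_within_open[of f D x UNIV U g]
      has_derivative_transform_within_open[of g D x UNIV U f] by auto
  then show ?thesis by (simp add: partial_def frechet_derivative_def)
qed

lemma has_derivative_partials:
  assumes "(f has_derivative D) (at x)"
  shows "D h = (\<Sum>i\<in>UNIV. partial i f x * h $ i)"
proof -
  have lin: "linear D" using assms has_derivative_linear by blast
  have "D h = D (\<Sum>i\<in>UNIV. h $ i *\<^sub>R axis i 1)"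
    using basis_expansion[of h] by (simp add: scalar_mult_eq_scaleR)
  also have "\<dots> = (\<Sum>i\<in>UNIV. h $ i * D (axis i 1))"
    by (simp add: linear_sum[OF lin] linear_scale[OF lin])
  finally show ?thesis by (simp add: partial_eq[OF assms] mult.commute)
qed

lemma differentiable_partials:
  "f differentiable at x \<Longrightarrow> (f has_derivative (\<lambda>h. \<Sum>i\<in>UNIV. partial i f x * h $ i)) (at x)"
  unfolding differentiable_def using has_derivative_partials
  by (metis (no_types, lifting) ext)

lemma partial_const [simp]: "partial i (\<lambda>_. c) x = 0"
  by (subst partial_eq[of _ "\<lambda>_. 0"]) auto

lemma partial_coordinate: "partial i (\<lambda>x. x $ j) x = (if i = j then 1 else 0)"
  by (subst partial_eq[of _ "\<lambda>h. h $ j"])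
     (auto intro!: bounded_linear_imp_has_derivative bounded_linear_vec_nth simp: axis_def)

lemma partial_add:
  assumes "f differentiable at x" "g differentiable at x"
  shows "partial i (\<lambda>y. f y + g y) x = partial i f x + partial i g x"
  using assms unfolding differentiable_def by (auto simp: partial_eq[OF has_derivative_add] partial_eq)

lemma partial_mult:
  assumes "f differentiable at x" "g differentiable at x"
  shows "partial i (\<lambda>y. f y * g y) x = partial i f x * g x + f x * partial i g x"
  using assms unfolding differentiable_def by (auto simp: partial_eq[OF has_derivative_mult] partial_eq)

lemma partial_minus:
  assumes "f differentiable at x"
  shows "partial i (\<lambda>y. - f y) x = - partial i f x"
  using assms unfolding differentiable_def by (auto simp: partial_eq[OF has_derivative_minus] partial_eq)

lemma partial_diff:
  assumes "f differentiable at x" "g differentiable at x"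
  shows "partial i (\<lambda>y. f y - g y) x = partial i f x - partial i g x"
  using assms unfolding differentiable_def by (auto simp: partial_eq[OF has_derivative_diff] partial_eq)

lemma partial_sum:
  assumes "\<And>a. a \<in> S \<Longrightarrow> f a differentiable at x"
  shows "partial i (\<lambda>y. \<Sum>a\<in>S. f a y) x = (\<Sum>a\<in>S. partial i (f a) x)"
proof -
  obtain D where D: "\<And>a. a \<in> S \<Longrightarrow> (f a has_derivative D a) (at x)"
    using assms unfolding differentiable_def by metis
  have "((\<lambda>y. \<Sum>a\<in>S. f a y) has_derivative (\<lambda>h. \<Sum>a\<in>S. D a h)) (at x)"
    by (intro has_derivative_sum D)
  from partial_eq[OF this] show ?thesis using partial_eq[OF D] by simp
qed

lemma partial_chain1:
  assumes "f differentiable at x" "(h has_real_derivative h') (at (f x))"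
  shows "partial i (\<lambda>y. h (f y)) x = h' * partial i f x"
proof -
  obtain D where D: "(f has_derivative D) (at x)"
    using assms unfolding differentiable_def by metis
  have "((\<lambda>y. h (f y)) has_derivative (\<lambda>t. h' * D t)) (at x)"
    using has_derivative_compose[OF D, of h "\<lambda>t. h' * t"] assms(2)
    by (simp add: has_field_derivative_def)
  then show ?thesis using D by (simp add: partial_eq)
qed

lemma has_derivative_vecI:
  fixes \<phi> :: "real^'n::finite \<Rightarrow> real^'k::finite"
  assumes "\<And>a. ((\<lambda>y. \<phi> y $ a) has_derivative D a) (at x within S)"
  shows "(\<phi> has_derivative (\<lambda>h. \<chi> a. D a h)) (at x within S)"
  using assms
  by (subst has_derivative_componentwise_within)
     (auto simp: Basis_vec_def inner_axis)

lemma partial_chain: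
  fixes \<phi> :: "real^'n::finite \<Rightarrow> real^'k::finite"
  assumes f: "f differentiable at (\<phi> x)" and \<phi>: "\<And>a. (\<lambda>y. \<phi> y $ a) differentiable at x"
  shows "partial i (\<lambda>y. f (\<phi> y)) x = (\<Sum>a\<in>UNIV. partial a f (\<phi> x) * partial i (\<lambda>y. \<phi> y $ a) x)"
    and "(\<lambda>y. f (\<phi> y)) differentiable at x"
proof -
  obtain D where D: "\<And>a. ((\<lambda>y. \<phi> y $ a) has_derivative D a) (at x)"
    using \<phi> unfolding differentiable_def by metis
  have "(\<phi> has_derivative (\<lambda>h. \<chi> a. D a h)) (at x)"
    using D by (rule has_derivative_vecI)
  from has_derivative_compose[OF this differentiable_partials[OF f]]
  have *: "((\<lambda>y. f (\<phi> y)) has_derivative (\<lambda>h. \<Sum>a\<in>UNIV. partial a f (\<phi> x) * D a h)) (at x)" by simp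
  show "partial i (\<lambda>y. f (\<phi> y)) x = (\<Sum>a\<in>UNIV. partial a f (\<phi> x) * partial i (\<lambda>y. \<phi> y $ a) x)"
    using partial_eq[OF *] partial_eq[OF D] by simp
  show "(\<lambda>y. f (\<phi> y)) differentiable at x" using * differentiable_def by blast
qed

lemma Ck_on_cong:
  assumes "open U" "\<And>y. y \<in> U \<Longrightarrow> f y = g y"
  shows "Ck_on k U f \<longleftrightarrow> Ck_on k U g"
  using assms(2)
proof (induction k arbitrary: f g)
  case 0 then show ?case by (simp cong: continuous_on_cong)
next
  case (Suc k)
  have "Ck_on k U (partial i f) \<longleftrightarrow> Ck_on k U (partial i g)" for i
    by (intro Suc.IH partial_cong[OF assms(1)] Suc.prems)
  moreover have "f differentiable_on U \<longleftrightarrow> g differentiable_on U"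
    unfolding differentiable_on_def differentiable_def
    using Suc.prems by (metis has_derivative_transform)
  ultimately show ?case by simp
qed

lemma Ck_on_subset: "Ck_on k U f \<Longrightarrow> V \<subseteq> U \<Longrightarrow> Ck_on k V f"
  by (induction k arbitrary: f) (auto intro: continuous_on_subset differentiable_on_subset)

lemma Ck_on_Suc_imp: "Ck_on (Suc k) U f \<Longrightarrow> Ck_on k U f"
  by (induction k arbitrary: f) (auto intro: differentiable_imp_continuous_on)

lemma Ck_on_differentiable: "Ck_on (Suc k) U f \<Longrightarrow> open U \<Longrightarrow> x \<in> U \<Longrightarrow> f differentiable at x"
  by (simp add: differentiable_on_eq_differentiable_at)

lemma Ck_on_const: "Ck_on k U (\<lambda>_. c)"
proof (induction k arbitrary: c)
  case (Suc k)
  have "partial i (\<lambda>_. c) = (\<lambda>_. 0)" for i :: 'a and c by (rule ext) simp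
  then show ?case using Suc by simp
qed auto

lemma Ck_on_add:
  assumes "open U"
  shows "Ck_on k U f \<Longrightarrow> Ck_on k U g \<Longrightarrow> Ck_on k U (\<lambda>y. f y + g y)"
proof (induction k arbitrary: f g)
  case 0 then show ?case by (auto intro: continuous_intros)
next
  case (Suc k)
  have "Ck_on k U (partial i (\<lambda>y. f y + g y))" for i
    by (subst Ck_on_cong[OF assms(1) partial_add])
       (use Suc Ck_on_differentiable[OF _ assms(1)] in auto)
  then show ?case using Suc.prems by (auto intro: differentiable_on_add)
qed

lemma Ck_on_mult:
  assumes "open U"
  shows "Ck_on k U f \<Longrightarrow> Ck_on k U g \<Longrightarrow> Ck_on k U (\<lambda>y. f y * g y)"
proof (induction k arbitrary: f g)
  case 0 then show ?case by (auto intro: continuous_intros)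
next
  case (Suc k)
  have "Ck_on k U (partial i (\<lambda>y. f y * g y))" for i
    by (subst Ck_on_cong[OF assms(1) partial_mult])
       (use Suc Ck_on_differentiable[OF _ assms(1)] in
         \<open>auto intro!: Ck_on_add[OF assms(1)] Suc.IH intro: Ck_on_Suc_imp simp del: Ck_on.simps(2)\<close>,
        use Suc in auto)
  then show ?case using Suc.prems by (auto intro: differentiable_on_mult)
qed

text \<open>Openness is part of the notion because \<open>partial\<close> differentiates in the
  whole space: on a set that is not open its values would depend on how the function continues
  outside.\<close>

definition Cinf_on :: "(real^'n::finite) set \<Rightarrow> (real^'n \<Rightarrow> real) \<Rightarrow> bool" where
  "Cinf_on U f \<longleftrightarrow> open U \<and> (\<forall>k. Ck_on k U f)"

lemma Cinf_on_open: "Cinf_on U f \<Longrightarrow> open U" by (simp add: Cinf_on_def)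

lemma Cinf_on_cong: "(\<And>y. y \<in> U \<Longrightarrow> f y = g y) \<Longrightarrow> Cinf_on U f \<longleftrightarrow> Cinf_on U g"
  unfolding Cinf_on_def using Ck_on_cong by blast

lemma Cinf_on_subset: "Cinf_on U f \<Longrightarrow> V \<subseteq> U \<Longrightarrow> open V \<Longrightarrow> Cinf_on V f"
  unfolding Cinf_on_def using Ck_on_subset by blast

lemma Cinf_on_differentiable: "Cinf_on U f \<Longrightarrow> x \<in> U \<Longrightarrow> f differentiable at x"
  unfolding Cinf_on_def using Ck_on_differentiable by blast

lemma Cinf_on_continuous: "Cinf_on U f \<Longrightarrow> continuous_on U f"
  unfolding Cinf_on_def by (metis Ck_on.simps(1))

lemma Cinf_on_partial: "Cinf_on U f \<Longrightarrow> Cinf_on U (partial i f)"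
  unfolding Cinf_on_def by (metis Ck_on.simps(2))

text \<open>Bootstrapping: if the partials inherit the regularity of \<open>f\<close>, each order
  gives the next. This serves functions governed by a differential equation, such as
  \<open>momentum\<close>, which is only defined implicitly.\<close>

lemma Cinf_onI_partial:
  assumes "open U" "\<And>x. x \<in> U \<Longrightarrow> f differentiable at x" "\<And>i k. Ck_on k U f \<Longrightarrow> Ck_on k U (partial i f)"
  shows "Cinf_on U f"
proof -
  have "f differentiable_on U" using assms by (simp add: differentiable_on_eq_differentiable_at)
  then have "Ck_on k U f" for k
    by (induction k) (auto intro: differentiable_imp_continuous_on assms(3))
  then show ?thesis using assms(1) by (simp add: Cinf_on_def)
qed

lemma Cinf_on_const: "open U \<Longrightarrow> Cinf_on U (\<lambda>_. c)"
  by (simp add: Cinf_on_def Ck_on_const)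

lemma Cinf_on_add: "Cinf_on U f \<Longrightarrow> Cinf_on U g \<Longrightarrow> Cinf_on U (\<lambda>y. f y + g y)"
  by (simp add: Cinf_on_def Ck_on_add)

lemma Cinf_on_mult: "Cinf_on U f \<Longrightarrow> Cinf_on U g \<Longrightarrow> Cinf_on U (\<lambda>y. f y * g y)"
  by (simp add: Cinf_on_def Ck_on_mult)

lemma Cinf_on_minus: "Cinf_on U f \<Longrightarrow> Cinf_on U (\<lambda>y. - f y)"
  using Cinf_on_mult[OF Cinf_on_const[of U "-1"]] Cinf_on_open by fastforce

lemma Cinf_on_diff: "Cinf_on U f \<Longrightarrow> Cinf_on U g \<Longrightarrow> Cinf_on U (\<lambda>y. f y - g y)"
  using Cinf_on_add[OF _ Cinf_on_minus, of U f g] by simp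

lemma Cinf_on_power: "Cinf_on U f \<Longrightarrow> Cinf_on U (\<lambda>y. f y ^ k)"
  by (induction k) (auto intro: Cinf_on_mult Cinf_on_const Cinf_on_open)

lemma Cinf_on_sum:
  "open U \<Longrightarrow> (\<And>a. a \<in> S \<Longrightarrow> Cinf_on U (f a)) \<Longrightarrow> Cinf_on U (\<lambda>y. \<Sum>a\<in>S. f a y)"
  by (induction S rule: infinite_finite_induct) (auto intro: Cinf_on_add Cinf_on_const)

lemma Cinf_on_prod:
  "open U \<Longrightarrow> (\<And>a. a \<in> S \<Longrightarrow> Cinf_on U (f a)) \<Longrightarrow> Cinf_on U (\<lambda>y. \<Prod>a\<in>S. f a y)"
  by (induction S rule: infinite_finite_induct) (auto intro: Cinf_on_mult Cinf_on_const)

lemma Cinf_on_coordinate: "open U \<Longrightarrow> Cinf_on U (\<lambda>x. x $ j)"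
  by (rule Cinf_onI_partial)
     (auto simp: Ck_on_cong[OF _ partial_coordinate] Ck_on_const
        intro!: bounded_linear_imp_differentiable bounded_linear_vec_nth)

text \<open>Stated at each finite order because the bootstrap for \<open>momentum\<close> has only a
  \<open>Ck_on\<close> hypothesis to work with.\<close>

lemma Ck_on_inverse:
  assumes U: "open U" and nz: "\<And>x. x \<in> U \<Longrightarrow> f x \<noteq> 0"
  shows "Ck_on k U f \<Longrightarrow> Ck_on k U (\<lambda>y. inverse (f y))"
proof (induction k)
  case 0 then show ?case using nz by (auto intro: continuous_intros)
next
  case (Suc k)
  have f: "f differentiable at x" if "x \<in> U" for x using Suc.prems U that by (rule Ck_on_differentiable)
  have inv: "Ck_on k U (\<lambda>y. inverse (f y))" by (rule Suc.IH[OF Ck_on_Suc_imp[OF Suc.prems]])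
  have d: "((inverse :: real \<Rightarrow> real) has_real_derivative - (inverse (f x))\<^sup>2) (at (f x))" if "x \<in> U" for x
    using DERIV_inverse[OF nz[OF that]] by (simp add: power2_eq_square numeral_2_eq_2)
  have "Ck_on k U (partial i (\<lambda>y. inverse (f y)))" for i
  proof -
    have eq: "partial i (\<lambda>y. inverse (f y)) x = (\<lambda>_. -1) x * (inverse (f x) * inverse (f x)) * partial i f x" if "x \<in> U" for x
      using partial_chain1[OF f[OF that] d[OF that]] by (simp add: power2_eq_square)
    have "Ck_on k U (\<lambda>x. (\<lambda>_. -1) x * (inverse (f x) * inverse (f x)) * partial i f x)"
      using inv Suc.prems U by (intro Ck_on_mult Ck_on_const) auto
    then show ?thesis unfolding Ck_on_cong[OF U eq, of "\<lambda>y. y", simplified] by simp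
  qed
  moreover have "(\<lambda>y. inverse (f y)) differentiable_on U"
    unfolding differentiable_on_eq_differentiable_at[OF U] using f nz by (blast intro: differentiable_inverse)
  ultimately show ?case by simp
qed

lemma Ck_on_power:
  assumes "open U"
  shows "Ck_on k U f \<Longrightarrow> Ck_on k U (\<lambda>y. f y ^ j)"
  by (induction j) (auto intro: Ck_on_mult[OF assms] simp: Ck_on_const)

lemma Cinf_on_inverse:
  "Cinf_on U f \<Longrightarrow> (\<And>x. x \<in> U \<Longrightarrow> f x \<noteq> 0) \<Longrightarrow> Cinf_on U (\<lambda>y. inverse (f y))"
  unfolding Cinf_on_def using Ck_on_inverse by blast

lemma Cinf_on_divide:
  "Cinf_on U f \<Longrightarrow> Cinf_on U g \<Longrightarrow> (\<And>x. x \<in> U \<Longrightarrow> g x \<noteq> 0) \<Longrightarrow> Cinf_on U (\<lambda>y. f y / g y)"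
  unfolding divide_inverse by (intro Cinf_on_mult Cinf_on_inverse)

lemmas Cinf_on_intros = Cinf_on_const Cinf_on_coordinate Cinf_on_add Cinf_on_mult Cinf_on_minus
  Cinf_on_diff Cinf_on_power Cinf_on_sum Cinf_on_prod Cinf_on_partial

lemma Cinf_on_compose:
  fixes \<phi> :: "real^'n::finite \<Rightarrow> real^'k::finite"
  assumes f: "Cinf_on V f" and \<phi>: "\<And>a. Cinf_on U (\<lambda>y. \<phi> y $ a)" and sub: "\<phi> ` U \<subseteq> V"
  shows "Cinf_on U (\<lambda>y. f (\<phi> y))"
proof -
  have U: "open U" using \<phi> Cinf_on_open by blast
  \<comment> \<open>Induction with \<open>f\<close> varying and \<open>\<phi>\<close> fixed: by the
    chain rule the partials are built from \<open>partial a f\<close> composed with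
    \<open>\<phi>\<close>, to which the induction hypothesis applies, and from the smooth partials
    of \<open>\<phi>\<close>.\<close>
  have "Ck_on k U (\<lambda>y. f (\<phi> y))" for k
    using f
  proof (induction k arbitrary: f)
    case 0
    have "continuous_on U (\<lambda>y. \<chi> a. \<phi> y $ a)"
      by (intro continuous_on_vec_lambda Cinf_on_continuous \<phi>)
    then show ?case using continuous_on_compose2[OF Cinf_on_continuous[OF 0] _ sub] by simp
  next
    case (Suc k)
    have d: "f differentiable at (\<phi> x)" if "x \<in> U" for x
      using Cinf_on_differentiable[OF Suc.prems] sub that by blast
    have "Ck_on k U (partial i (\<lambda>y. f (\<phi> y)))" for i
    proof (subst Ck_on_cong[OF U partial_chain(1)])
      have "Ck_on k U (\<lambda>y. (\<Sum>a\<in>S. partial a f (\<phi> y) * partial i (\<lambda>y. \<phi> y $ a) y))" for S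
        using Cinf_on_partial[OF \<phi>] Suc.IH[OF Cinf_on_partial[OF Suc.prems]] U
        by (induction S rule: infinite_finite_induct)
           (auto intro!: Ck_on_add Ck_on_mult simp: Ck_on_const Cinf_on_def)
      then show "Ck_on k U (\<lambda>y. (\<Sum>a\<in>UNIV. partial a f (\<phi> y) * partial i (\<lambda>y. \<phi> y $ a) y))" .
    qed (auto intro: d Cinf_on_differentiable[OF \<phi>])
    then show ?case using partial_chain(2)[of f \<phi>, OF d Cinf_on_differentiable[OF \<phi>]] U
      by (simp add: differentiable_on_eq_differentiable_at)
  qed
  then show ?thesis using U by (simp add: Cinf_on_def)
qed

lemma smooth_on_Cinf_on: "Cinf_on W f \<Longrightarrow> S \<subseteq> W \<Longrightarrow> smooth_on S f"
  unfolding smooth_on_def Cinf_on_def by blast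

text \<open>A partial derivative only sees a neighbourhood, so local extensions add nothing on an
  open set. This is for an arbitrary complex structure, whose components are only given as
  \<open>smooth_on\<close>.\<close>

lemma smooth_on_open_imp_Cinf_on:
  assumes "open S" "smooth_on S f"
  shows "Cinf_on S f"
proof -
  have loc: "Ck_on k S f" if "\<forall>x\<in>S. \<exists>W. open W \<and> x \<in> W \<and> W \<subseteq> S \<and> Ck_on k W f" for k f
    using that
  proof (induction k arbitrary: f)
    case 0
    have "isCont f x" if "x \<in> S" for x
      using 0 that continuous_on_eq_continuous_at[of _ f] by (metis Ck_on.simps(1))
    then show ?case using continuous_at_imp_continuous_on by auto
  next
    case (Suc k)
    have "\<forall>x\<in>S. f differentiable at x" using Suc.prems by (meson Ck_on_differentiable)
    moreover have "Ck_on k S (partial i f)" for i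
      using Suc.prems by (intro Suc.IH) (metis Ck_on.simps(2))
    ultimately show ?case using assms(1) by (simp add: differentiable_on_eq_differentiable_at)
  qed
  have "Ck_on k S f" for k
  proof (rule loc, intro ballI)
    fix x assume "x \<in> S"
    then obtain W F where W: "open W" "x \<in> W" "\<forall>k. Ck_on k W F" "\<forall>y\<in>S \<inter> W. F y = f y"
      using assms(2) unfolding smooth_on_def by blast
    have "Ck_on k (S \<inter> W) F" using Ck_on_subset W(3) by blast
    then have "Ck_on k (S \<inter> W) f"
      using Ck_on_cong[of "S \<inter> W" F f k] W assms(1) by auto
    then show "\<exists>W. open W \<and> x \<in> W \<and> W \<subseteq> S \<and> Ck_on k W f"
      using W \<open>x \<in> S\<close> assms(1) by (intro exI[of _ "S \<inter> W"]) auto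
  qed
  then show ?thesis using assms(1) by (simp add: Cinf_on_def)
qed

section \<open>Symmetry of second derivatives\<close>

lemma second_difference_mean_value:
  assumes f: "Cinf_on U f" and ball: "ball x \<delta> \<subseteq> U" and h: "0 < h" "2 * h < \<delta>"
  shows "\<exists>y. dist x y < \<delta> \<and> dist x y < 2 * h \<and>
    f (x + h *\<^sub>R axis i 1 + h *\<^sub>R axis j 1) - f (x + h *\<^sub>R axis i 1) - f (x + h *\<^sub>R axis j 1) + f x
      = h\<^sup>2 * partial j (partial i f) y"
proof -
  define P where "P s t = x + s *\<^sub>R axis i 1 + t *\<^sub>R axis j 1" for s t :: real
  have P: "dist x (P s t) \<le> s + t" if "0 \<le> s" "0 \<le> t" for s t
  proof -
    have "dist x (P s t) = norm (s *\<^sub>R axis i 1 + t *\<^sub>R axis j (1::real))"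
      by (simp add: P_def dist_norm norm_minus_commute algebra_simps)
    also have "\<dots> \<le> s + t" using norm_triangle_ineq[of "s *\<^sub>R axis i (1::real)" "t *\<^sub>R axis j 1"] that
      by simp
    finally show ?thesis .
  qed
  have PU: "P s t \<in> U" if "0 \<le> s" "0 \<le> t" "s \<le> h" "t \<le> h" for s t
    using P[OF that(1,2)] that ball h by (intro subsetD[OF ball]) auto
  have d1: "((\<lambda>s. F (P s t)) has_real_derivative partial i F (P s t)) (at s)"
    and d2: "((\<lambda>t. F (P s t)) has_real_derivative partial j F (P s t)) (at t)"
    if F: "Cinf_on U F" and Pst: "P s t \<in> U" for s t F
  proof -
    obtain D where D: "(F has_derivative D) (at (P s t))"
      using Cinf_on_differentiable[OF F Pst] differentiable_def by blast
    have lin: "D (c *\<^sub>R v) = c * D v" for c v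
      using has_derivative_linear[OF D] by (simp add: linear_cmul)
    have "((\<lambda>s. P s t) has_derivative (\<lambda>c. c *\<^sub>R axis i 1)) (at s)"
      unfolding P_def by (auto intro!: derivative_eq_intros)
    from has_derivative_compose[OF this D] show "((\<lambda>s. F (P s t)) has_real_derivative partial i F (P s t)) (at s)"
      by (simp add: has_field_derivative_def lin partial_eq[OF D] mult_commute_abs)
    have "((\<lambda>t. P s t) has_derivative (\<lambda>c. c *\<^sub>R axis j 1)) (at t)"
      unfolding P_def by (auto intro!: derivative_eq_intros)
    from has_derivative_compose[OF this D] show "((\<lambda>t. F (P s t)) has_real_derivative partial j F (P s t)) (at t)"
      by (simp add: has_field_derivative_def lin partial_eq[OF D] mult_commute_abs)
  qed
  \<comment> \<open>The mean value theorem is applied to the difference of \<open>f\<close> at the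
    two heights \<open>t = h\<close> and \<open>t = 0\<close>, first along \<open>i\<close>, then
    along \<open>j\<close>.\<close>
  have "\<exists>\<xi>>0. \<xi> < h \<and> (f (P h h) - f (P h 0)) - (f (P 0 h) - f (P 0 0))
      = (h - 0) * (partial i f (P \<xi> h) - partial i f (P \<xi> 0))"
    using h by (intro MVT2 DERIV_diff d1[OF f] PU) auto
  then obtain \<xi> where \<xi>: "0 < \<xi>" "\<xi> < h" "(f (P h h) - f (P h 0)) - (f (P 0 h) - f (P 0 0))
      = h * (partial i f (P \<xi> h) - partial i f (P \<xi> 0))" by auto
  have "\<exists>\<eta>>0. \<eta> < h \<and> partial i f (P \<xi> h) - partial i f (P \<xi> 0) = (h - 0) * partial j (partial i f) (P \<xi> \<eta>)"
    using h \<xi> by (intro MVT2 d2[OF Cinf_on_partial[OF f]] PU) auto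
  then obtain \<eta> where \<eta>: "0 < \<eta>" "\<eta> < h"
    "partial i f (P \<xi> h) - partial i f (P \<xi> 0) = h * partial j (partial i f) (P \<xi> \<eta>)" by auto
  have "f (P h h) - f (P h 0) - f (P 0 h) + f (P 0 0) = h\<^sup>2 * partial j (partial i f) (P \<xi> \<eta>)"
    using \<xi>(3) \<eta>(3) by (simp add: power2_eq_square)
  moreover have "dist x (P \<xi> \<eta>) < 2 * h" using P[of \<xi> \<eta>] \<xi> \<eta> by simp
  ultimately show ?thesis using h by (intro exI[of _ "P \<xi> \<eta>"]) (auto simp: P_def)
qed

text \<open>The second difference is the same for both orders of \<open>i\<close> and
  \<open>j\<close>, so one mixed partial at some point near \<open>x\<close> equals the other at
  another such point. Continuity then rules out a gap at \<open>x\<close>.\<close>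

lemma partial_commute:
  assumes f: "Cinf_on U f" and x: "x \<in> U"
  shows "partial i (partial j f) x = partial j (partial i f) x"
proof (rule ccontr)
  let ?F = "partial i (partial j f)" and ?G = "partial j (partial i f)"
  assume ne: "?F x \<noteq> ?G x"
  \<comment> \<open>Half of the gap: two errors below it cannot bridge it.\<close>
  define \<epsilon> where "\<epsilon> = \<bar>?F x - ?G x\<bar> / 2"
  have U: "open U" using f Cinf_on_open by blast
  have lim: "\<exists>d>0. \<forall>y. dist x y < d \<longrightarrow> \<bar>partial a (partial b f) y - partial a (partial b f) x\<bar> < \<epsilon>" for a b
  proof -
    have "isCont (partial a (partial b f)) x"
      using Cinf_on_continuous[of U] Cinf_on_partial f x U continuous_on_eq_continuous_at by blast
    moreover have "\<epsilon> > 0" using ne by (simp add: \<epsilon>_def)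
    ultimately show ?thesis unfolding continuous_at_eps_delta
      by (simp add: dist_norm norm_minus_commute)
  qed
  obtain d1 where d1: "d1 > 0" "\<And>y. dist x y < d1 \<Longrightarrow> \<bar>?F y - ?F x\<bar> < \<epsilon>" using lim by blast
  obtain d2 where d2: "d2 > 0" "\<And>y. dist x y < d2 \<Longrightarrow> \<bar>?G y - ?G x\<bar> < \<epsilon>" using lim by blast
  obtain \<delta> where \<delta>: "\<delta> > 0" "ball x \<delta> \<subseteq> U" using U x open_contains_ball by blast
  define h where "h = min \<delta> (min d1 d2) / 3"
  have h: "0 < h" "2 * h < \<delta>" "2 * h < d1" "2 * h < d2" using \<delta> d1(1) d2(1) by (auto simp: h_def min_def)
  from second_difference_mean_value[OF f \<delta>(2) h(1,2), of i j] obtain y where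
    y: "dist x y < 2 * h" "f (x + h *\<^sub>R axis i 1 + h *\<^sub>R axis j 1) - f (x + h *\<^sub>R axis i 1) - f (x + h *\<^sub>R axis j 1) + f x
      = h\<^sup>2 * ?G y" by blast
  from second_difference_mean_value[OF f \<delta>(2) h(1,2), of j i] obtain z where
    z: "dist x z < 2 * h" "f (x + h *\<^sub>R axis j 1 + h *\<^sub>R axis i 1) - f (x + h *\<^sub>R axis j 1) - f (x + h *\<^sub>R axis i 1) + f x
      = h\<^sup>2 * ?F z" by blast
  have swap: "x + h *\<^sub>R axis j 1 + h *\<^sub>R axis i 1 = x + h *\<^sub>R axis i 1 + h *\<^sub>R axis j (1::real)" by simp
  have "h\<^sup>2 * ?F z = h\<^sup>2 * ?G y" using y(2) z(2) unfolding swap by linarith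
  then have "?F z = ?G y" using h by simp
  moreover have "\<bar>?F z - ?F x\<bar> < \<epsilon>" "\<bar>?G y - ?G x\<bar> < \<epsilon>" using y(1) z(1) h d1 d2 by auto
  moreover have "\<bar>?F x - ?G x\<bar> \<le> \<bar>?F z - ?F x\<bar> + \<bar>?G y - ?G x\<bar>" using calculation(1) by simp
  ultimately have "\<bar>?F x - ?G x\<bar> < \<epsilon> + \<epsilon>"
    by (meson add_strict_mono le_less_trans)
  then show False unfolding \<epsilon>_def by simp
qed

section \<open>Curvature and its naturality\<close>

definition metric_on :: "(real^'n::finite) set \<Rightarrow> (real^'n \<Rightarrow> real^'n^'n) \<Rightarrow> bool" where
  "metric_on U g \<longleftrightarrow> open U \<and> (\<forall>a b. Cinf_on U (\<lambda>x. g x $ a $ b)) \<and>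
     (\<forall>x\<in>U. transpose (g x) = g x \<and> (\<forall>u. u \<noteq> 0 \<longrightarrow> u \<bullet> (g x *v u) > 0))"

lemma metric_on_open: "metric_on U g \<Longrightarrow> open U"
  and metric_on_Cinf_on: "metric_on U g \<Longrightarrow> Cinf_on U (\<lambda>x. g x $ a $ b)"
  and metric_on_pos: "metric_on U g \<Longrightarrow> x \<in> U \<Longrightarrow> u \<noteq> 0 \<Longrightarrow> u \<bullet> (g x *v u) > 0"
  by (simp_all add: metric_on_def)

lemma metric_on_sym: "metric_on U g \<Longrightarrow> x \<in> U \<Longrightarrow> g x $ a $ b = g x $ b $ a"
  unfolding metric_on_def by (simp add: transpose_def vec_eq_iff)

lemma metric_on_subset: "metric_on U g \<Longrightarrow> V \<subseteq> U \<Longrightarrow> open V \<Longrightarrow> metric_on V g"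
  unfolding metric_on_def by (blast intro: Cinf_on_subset)

section \<open>Matrix inverses\<close>

lemma positive_definite_invertible:
  fixes A :: "real^'n::finite^'n"
  assumes "\<And>u. u \<noteq> 0 \<Longrightarrow> u \<bullet> (A *v u) > 0"
  shows "invertible A"
proof -
  have "inj ((*v) A)"
    by (rule linear_injective_0[THEN iffD2]) (use assms in \<open>force+\<close>)
  then show ?thesis by (metis invertible_left_inverse matrix_left_invertible_injective)
qed

lemma metric_on_invertible: "metric_on U g \<Longrightarrow> x \<in> U \<Longrightarrow> invertible (g x)"
  by (rule positive_definite_invertible) (rule metric_on_pos)

lemma matrix_inv_right: "invertible A \<Longrightarrow> A ** matrix_inv A = mat 1"
  and matrix_inv_left: "invertible A \<Longrightarrow> matrix_inv A ** A = mat 1"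
  unfolding invertible_def matrix_inv_def by (rule someI2_ex; blast)+

lemma matrix_left_cancel:
  fixes A :: "real^'n::finite^'n"
  assumes "invertible A" "A ** B = A ** C"
  shows "B = C"
  using assms by (metis matrix_inv_left matrix_mul_assoc matrix_mul_lid)

lemma matrix_inv_unique:
  fixes A :: "real^'n::finite^'n"
  assumes "A ** B = mat 1"
  shows "matrix_inv A = B"
proof -
  have "B ** A = mat 1" using assms matrix_left_right_inverse by blast
  then have "invertible A" using assms invertible_def by blast
  then have "matrix_inv A ** (A ** B) = B" by (simp add: matrix_mul_assoc matrix_inv_left)
  then show ?thesis using assms by simp
qed

text \<open>Cramer's rule. It presents the entries of the inverse as rational functions of the
  entries of \<open>A\<close>, from which \<open>Cinf_on_matrix_inv\<close> follows.\<close>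

lemma matrix_inv_entry:
  fixes A :: "real^'n::finite^'n"
  assumes "invertible A"
  shows "matrix_inv A $ k $ l = det (\<chi> i j. if j = k then (if i = l then 1 else 0) else A $ i $ j) / det A"
proof -
  have "A *v column l (matrix_inv A) = axis l 1"
    using matrix_inv_right[OF assms]
    by (metis matrix_vector_mul_assoc matrix_vector_mul_lid matrix_vector_mult_basis)
  then have "column l (matrix_inv A) $ k = det (\<chi> i j. if j = k then axis l 1 $ i else A $ i $ j) / det A"
    using cramer[of A "column l (matrix_inv A)" "axis l 1"] assms
    by (simp add: invertible_det_nz)
  moreover have "(\<chi> i j. if j = k then axis l 1 $ i else A $ i $ j)
      = (\<chi> i j. if j = k then (if i = l then 1 else 0) else A $ i $ j)"
    by (simp add: axis_def vec_eq_iff)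
  ultimately show ?thesis by (simp add: column_def)
qed

lemma Cinf_on_det:
  fixes A :: "real^'m::finite \<Rightarrow> real^'n::finite^'n"
  assumes "open U" "\<And>i j. Cinf_on U (\<lambda>x. A x $ i $ j)"
  shows "Cinf_on U (\<lambda>x. det (A x))"
  unfolding det_def by (intro Cinf_on_intros assms)

lemma Cinf_on_matrix_inv:
  fixes A :: "real^'m::finite \<Rightarrow> real^'n::finite^'n"
  assumes "open U" "\<And>i j. Cinf_on U (\<lambda>x. A x $ i $ j)" "\<And>x. x \<in> U \<Longrightarrow> invertible (A x)"
  shows "Cinf_on U (\<lambda>x. matrix_inv (A x) $ k $ l)"
proof -
  have "Cinf_on U (\<lambda>x. det (\<chi> i j. if j = k then (if i = l then 1 else 0) else A x $ i $ j) / det (A x))"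
  proof (intro Cinf_on_divide Cinf_on_det assms(1))
    show "Cinf_on U (\<lambda>x. (\<chi> i j. if j = k then if i = l then 1 else 0 else A x $ i $ j) $ i $ j)" for i j
      using assms(1,2) by (cases "j = k") (auto intro: Cinf_on_const)
  qed (use assms in \<open>auto simp: invertible_det_nz\<close>)
  then show ?thesis by (subst Cinf_on_cong[OF matrix_inv_entry]) (use assms(3) in auto)
qed

section \<open>The Levi-Civita connection\<close>

lemma Cinf_on_christoffel:
  assumes "metric_on U g"
  shows "Cinf_on U (christoffel g k i j)"
proof -
  have "Cinf_on U (\<lambda>x. (\<Sum>l\<in>UNIV. matrix_inv (g x) $ k $ l *
        (partial i (\<lambda>y. g y $ j $ l) x + partial j (\<lambda>y. g y $ i $ l) x
         - partial l (\<lambda>y. g y $ i $ j) x)) * (1 / 2))"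
    using assms by (intro Cinf_on_intros Cinf_on_matrix_inv metric_on_open metric_on_Cinf_on metric_on_invertible)
  then show ?thesis by (simp add: christoffel_def[abs_def])
qed

lemma partial_metric_sym:
  assumes "metric_on U g" "x \<in> U"
  shows "partial c (\<lambda>y. g y $ a $ b) x = partial c (\<lambda>y. g y $ b $ a) x"
  by (rule partial_cong[OF metric_on_open[OF assms(1)] assms(2)]) (rule metric_on_sym[OF assms(1)])

lemma christoffel_sym:
  assumes "metric_on U g" "x \<in> U"
  shows "christoffel g k i j x = christoffel g k j i x"
  unfolding christoffel_def by (subst partial_metric_sym[OF assms, of _ i j]) (simp add: algebra_simps)

text \<open>Lowering the upper index removes the inverse matrix. Later arguments compare or
  differentiate Christoffel symbols in this form and only then divide by the metric.\<close>

lemma christoffel_lower: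
  assumes "metric_on U g" "x \<in> U"
  shows "(\<Sum>k\<in>UNIV. g x $ l $ k * christoffel g k i j x) =
     (partial i (\<lambda>y. g y $ j $ l) x + partial j (\<lambda>y. g y $ i $ l) x - partial l (\<lambda>y. g y $ i $ j) x) / 2"
proof -
  define c where "c = (\<chi> l. (partial i (\<lambda>y. g y $ j $ l) x + partial j (\<lambda>y. g y $ i $ l) x
         - partial l (\<lambda>y. g y $ i $ j) x) / 2)"
  have "christoffel g k i j x = (matrix_inv (g x) *v c) $ k" for k
    by (simp add: christoffel_def matrix_vector_mult_def c_def sum_divide_distrib)
  then have "(\<Sum>k\<in>UNIV. g x $ l $ k * christoffel g k i j x) = (g x *v (matrix_inv (g x) *v c)) $ l"
    by (simp add: matrix_vector_mult_def)
  also have "\<dots> = c $ l"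
    using matrix_inv_right[OF metric_on_invertible[OF assms]] by (simp add: matrix_vector_mul_assoc)
  finally show ?thesis by (simp add: c_def)
qed

lemma metric_compatible:
  assumes "metric_on U g" "x \<in> U"
  shows "partial a (\<lambda>y. g y $ b $ c) x =
    (\<Sum>d\<in>UNIV. g x $ c $ d * christoffel g d a b x) + (\<Sum>d\<in>UNIV. g x $ b $ d * christoffel g d a c x)"
  unfolding christoffel_lower[OF assms]
  using partial_metric_sym[OF assms, of a c b] partial_metric_sym[OF assms, of c a b]
    partial_metric_sym[OF assms, of b c a] by (simp add: field_simps)

definition connection_matrix :: "(real^'n::finite \<Rightarrow> real^'n^'n) \<Rightarrow> 'n \<Rightarrow> real^'n \<Rightarrow> real^'n^'n" where
  "connection_matrix g i x = (\<chi> k l. christoffel g k i l x)"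

definition matrix_partial :: "'n::finite \<Rightarrow> (real^'n \<Rightarrow> real^'b::finite^'a::finite) \<Rightarrow> real^'n \<Rightarrow> real^'b^'a" where
  "matrix_partial i F x = (\<chi> a b. partial i (\<lambda>y. F y $ a $ b) x)"

text \<open>The curvature endomorphism of a pair of coordinate directions, as the curvature of a
  matrix-valued connection. In this form a coordinate change or a parallel \<open>J\<close> acts as
  a gauge transformation.\<close>

definition curvature :: "(real^'n::finite \<Rightarrow> real^'n^'n) \<Rightarrow> 'n \<Rightarrow> 'n \<Rightarrow> real^'n \<Rightarrow> real^'n^'n" where
  "curvature g i j x = matrix_partial i (connection_matrix g j) x - matrix_partial j (connection_matrix g i) x
     + connection_matrix g i x ** connection_matrix g j x - connection_matrix g j x ** connection_matrix g i x"

lemma ricci_eq_curvature: "ricci g x $ j $ k = (\<Sum>i\<in>UNIV. curvature g i j x $ i $ k)"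
  by (simp add: ricci_def curvature_def matrix_partial_def connection_matrix_def matrix_matrix_mult_def
      sum.distrib sum_subtractf algebra_simps)

definition matrix_Cinf_on :: "(real^'n::finite) set \<Rightarrow> (real^'n \<Rightarrow> real^'b::finite^'a::finite) \<Rightarrow> bool" where
  "matrix_Cinf_on U F \<longleftrightarrow> (\<forall>a b. Cinf_on U (\<lambda>x. F x $ a $ b))"

lemma matrix_Cinf_on_connection: "metric_on U g \<Longrightarrow> matrix_Cinf_on U (connection_matrix g i)"
  by (simp add: matrix_Cinf_on_def connection_matrix_def Cinf_on_christoffel)

lemma matrix_Cinf_on_partial: "matrix_Cinf_on U F \<Longrightarrow> matrix_Cinf_on U (matrix_partial i F)"
  by (simp add: matrix_Cinf_on_def matrix_partial_def Cinf_on_partial)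

lemma matrix_Cinf_on_mult:
  assumes "matrix_Cinf_on U F" "matrix_Cinf_on U G"
  shows "matrix_Cinf_on U (\<lambda>y. F y ** G y)"
  using assms unfolding matrix_Cinf_on_def matrix_matrix_mult_def
  by (auto intro!: Cinf_on_sum Cinf_on_mult intro: Cinf_on_open[of U "\<lambda>x. F x $ a $ b" for a b])

lemma matrix_partial_add:
  assumes "matrix_Cinf_on U F" "matrix_Cinf_on U G" "x \<in> U"
  shows "matrix_partial i (\<lambda>y. F y + G y) x = matrix_partial i F x + matrix_partial i G x"
  using assms unfolding matrix_Cinf_on_def matrix_partial_def
  by (auto simp: vec_eq_iff intro!: partial_add Cinf_on_differentiable)

lemma matrix_partial_mult:
  assumes "matrix_Cinf_on U F" "matrix_Cinf_on U G" "x \<in> U"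
  shows "matrix_partial i (\<lambda>y. F y ** G y) x = matrix_partial i F x ** G x + F x ** matrix_partial i G x"
proof -
  have d: "(\<lambda>y. F y $ a $ k) differentiable at x" "(\<lambda>y. G y $ k $ b) differentiable at x" for a b k
    using assms Cinf_on_differentiable unfolding matrix_Cinf_on_def by blast+
  have "partial i (\<lambda>y. \<Sum>k\<in>UNIV. F y $ a $ k * G y $ k $ b) x =
     (\<Sum>k\<in>UNIV. partial i (\<lambda>y. F y $ a $ k) x * G x $ k $ b + F x $ a $ k * partial i (\<lambda>y. G y $ k $ b) x)" for a b
    by (subst partial_sum) (auto simp: partial_mult d intro!: differentiable_mult d)
  then show ?thesis
    by (simp add: matrix_partial_def matrix_matrix_mult_def vec_eq_iff sum.distrib)
qed

lemma matrix_partial_commute: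
  "matrix_Cinf_on U F \<Longrightarrow> x \<in> U \<Longrightarrow> matrix_partial i (matrix_partial j F) x = matrix_partial j (matrix_partial i F) x"
  unfolding matrix_Cinf_on_def matrix_partial_def using partial_commute by (simp add: vec_eq_iff) blast

lemma matrix_partial_cong:
  "open U \<Longrightarrow> x \<in> U \<Longrightarrow> (\<And>y. y \<in> U \<Longrightarrow> F y = G y) \<Longrightarrow> matrix_partial i F x = matrix_partial i G x"
  unfolding matrix_partial_def by (auto simp: vec_eq_iff intro!: partial_cong[of U])

lemma matrix_add_rdistrib: "(A + B) ** C = A ** C + B ** (C :: real^'p::finite^'n::finite)"
  and matrix_sub_ldistrib: "C ** (D - E) = C ** D - C ** (E :: real^'q::finite^'p)"
  and matrix_sub_rdistrib: "(A - B) ** C = A ** C - B ** C"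
  and matrix_minus_left: "(- A) ** C = - (A ** C)"
  and matrix_minus_right: "C ** (- D) = - (C ** D)"
  for A B :: "real^'n^'m::finite"
  by (simp_all add: matrix_matrix_mult_def vec_eq_iff sum.distrib sum_subtractf sum_negf algebra_simps)

lemmas matrix_ring_simps = matrix_add_ldistrib matrix_add_rdistrib matrix_sub_ldistrib matrix_sub_rdistrib
  matrix_mul_assoc

text \<open>The curvature of the pulled-back connection, with no metric involved: \<open>J\<close> is a gauge
  transformation from \<open>\<Gamma>\<close> to \<open>M\<close>.\<close>

lemma curvature_gauge:
  assumes J: "matrix_Cinf_on U J" and G: "\<And>i. matrix_Cinf_on U (\<Gamma> i)" and M: "\<And>i. matrix_Cinf_on U (M i)"
    and U: "open U" and x: "x \<in> U"
    and gauge: "\<And>i y. y \<in> U \<Longrightarrow> J y ** \<Gamma> i y = matrix_partial i J y + M i y ** J y"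
  shows "J x ** (matrix_partial i (\<Gamma> j) x - matrix_partial j (\<Gamma> i) x + \<Gamma> i x ** \<Gamma> j x - \<Gamma> j x ** \<Gamma> i x) =
    (matrix_partial i (M j) x - matrix_partial j (M i) x + M i x ** M j x - M j x ** M i x) ** J x"
proof -
  \<comment> \<open>The gauge identity is differentiated once more; the second derivatives of
    \<open>J\<close> are symmetric in \<open>i\<close> and \<open>j\<close> and cancel on
    antisymmetrising.\<close>
  have d: "matrix_partial i J x ** \<Gamma> j x + J x ** matrix_partial i (\<Gamma> j) x =
    matrix_partial i (matrix_partial j J) x + (matrix_partial i (M j) x ** J x + M j x ** matrix_partial i J x)" for i j
  proof -
    have "matrix_partial i (\<lambda>y. J y ** \<Gamma> j y) x = matrix_partial i (\<lambda>y. matrix_partial j J y + M j y ** J y) x"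
      by (rule matrix_partial_cong[OF U x gauge])
    then show ?thesis using x by (simp add: matrix_partial_mult[OF J G] matrix_partial_mult[OF M J]
        matrix_partial_add[OF matrix_Cinf_on_partial[OF J] matrix_Cinf_on_mult[OF M J]])
  qed
  have e: "matrix_partial i J x = J x ** \<Gamma> i x - M i x ** J x" for i using gauge[OF x, of i] by simp
  have "J x ** matrix_partial i (\<Gamma> j) x - J x ** matrix_partial j (\<Gamma> i) x =
      (matrix_partial i (M j) x ** J x + M j x ** matrix_partial i J x - matrix_partial i J x ** \<Gamma> j x) -
      (matrix_partial j (M i) x ** J x + M i x ** matrix_partial j J x - matrix_partial j J x ** \<Gamma> i x)"
  proof -
    have d': "J x ** matrix_partial i (\<Gamma> j) x = matrix_partial i (matrix_partial j J) x
        + (matrix_partial i (M j) x ** J x + M j x ** matrix_partial i J x) - matrix_partial i J x ** \<Gamma> j x" for i j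
      using d[of i j] by (metis add_diff_cancel_left')
    show ?thesis unfolding d' matrix_partial_commute[OF J x, of i j] by (simp add: algebra_simps)
  qed
  then show ?thesis unfolding e by (simp add: matrix_ring_simps algebra_simps)
qed

section \<open>Local isometries\<close>

definition jacobian_matrix :: "(real^'n::finite \<Rightarrow> real^'m::finite) \<Rightarrow> real^'n \<Rightarrow> real^'n^'m" where
  "jacobian_matrix \<phi> x = (\<chi> a i. partial i (\<lambda>y. \<phi> y $ a) x)"

lemma jacobian_eq_jacobian_matrix:
  assumes "\<And>a. (\<lambda>y. \<phi> y $ a) differentiable at x"
  shows "jacobian \<phi> (at x) = jacobian_matrix \<phi> x"
proof -
  obtain D where D: "\<And>a. ((\<lambda>y. \<phi> y $ a) has_derivative D a) (at x)"
    using assms unfolding differentiable_def by metis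
  have "frechet_derivative \<phi> (at x) = (\<lambda>h. \<chi> a. D a h)"
    using frechet_derivative_at[OF has_derivative_vecI[OF D]] by simp
  then show ?thesis
    by (simp add: jacobian_def jacobian_matrix_def matrix_def partial_eq[OF D])
qed

locale local_isometry =
  fixes U V :: "(real^'n::finite) set" and g h :: "real^'n \<Rightarrow> real^'n^'n" and \<phi> :: "real^'n \<Rightarrow> real^'n"
  assumes g: "metric_on U g" and h: "metric_on V h"
    and \<phi>: "\<And>a. Cinf_on U (\<lambda>y. \<phi> y $ a)" and sub: "\<phi> ` U \<subseteq> V"
    and pullback: "\<And>x. x \<in> U \<Longrightarrow> g x = transpose (jacobian_matrix \<phi> x) ** h (\<phi> x) ** jacobian_matrix \<phi> x"
begin

abbreviation "J \<equiv> jacobian_matrix \<phi>"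

lemma open_U: "open U" using g by (rule metric_on_open)

lemma J_entry: "J x $ a $ i = partial i (\<lambda>y. \<phi> y $ a) x"
  by (simp add: jacobian_matrix_def)

lemma J_smooth: "matrix_Cinf_on U J"
  by (simp add: matrix_Cinf_on_def J_entry[abs_def] Cinf_on_partial \<phi>)

lemma J_sym: "x \<in> U \<Longrightarrow> partial i (\<lambda>y. J y $ a $ j) x = partial j (\<lambda>y. J y $ a $ i) x"
  unfolding J_entry[abs_def] by (rule partial_commute[OF \<phi>])

lemma invertible_J:
  assumes "x \<in> U"
  shows "invertible (J x)"
proof -
  have "J x *v u \<noteq> 0" if "u \<noteq> 0" for u
  proof
    assume "J x *v u = 0"
    then have "g x *v u = 0"
      by (simp add: pullback[OF assms] flip: matrix_vector_mul_assoc)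
    then show False using metric_on_pos[OF g assms that] by simp
  qed
  then have "inj ((*v) (J x))" by (auto intro!: linear_injective_0[THEN iffD2])
  then show ?thesis by (metis invertible_left_inverse matrix_left_invertible_injective)
qed

lemma \<phi>_in: "x \<in> U \<Longrightarrow> \<phi> x \<in> V" using sub by blast

lemma partial_pullback:
  assumes x: "x \<in> U"
  shows "partial i (\<lambda>y. g y $ j $ l) x =
    (\<Sum>a\<in>UNIV. \<Sum>b\<in>UNIV. partial i (\<lambda>y. J y $ a $ j) x * h (\<phi> x) $ a $ b * J x $ b $ l
      + J x $ a $ j * h (\<phi> x) $ a $ b * partial i (\<lambda>y. J y $ b $ l) x
      + J x $ a $ j * (\<Sum>c\<in>UNIV. partial c (\<lambda>y. h y $ a $ b) (\<phi> x) * J x $ c $ i) * J x $ b $ l)"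
proof -
  have d: "(\<lambda>y. J y $ a $ k) differentiable at x" "(\<lambda>y. h (\<phi> y) $ a $ b) differentiable at x" for a b k
    using Cinf_on_differentiable[OF _ x] J_smooth Cinf_on_compose[OF metric_on_Cinf_on[OF h] \<phi> sub]
    unfolding matrix_Cinf_on_def by blast+
  have "partial i (\<lambda>y. g y $ j $ l) x = partial i (\<lambda>y. \<Sum>a\<in>UNIV. \<Sum>b\<in>UNIV. J y $ a $ j * h (\<phi> y) $ a $ b * J y $ b $ l) x"
  proof (rule partial_cong[OF open_U x])
    fix y assume "y \<in> U"
    then show "g y $ j $ l = (\<Sum>a\<in>UNIV. \<Sum>b\<in>UNIV. J y $ a $ j * h (\<phi> y) $ a $ b * J y $ b $ l)"
      unfolding pullback[OF \<open>y \<in> U\<close>] matrix_matrix_mult_def transpose_def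
      by (simp add: sum_distrib_right) (rule sum.swap)
  qed
  also have "\<dots> = (\<Sum>a\<in>UNIV. \<Sum>b\<in>UNIV. (partial i (\<lambda>y. J y $ a $ j) x * h (\<phi> x) $ a $ b
       + J x $ a $ j * partial i (\<lambda>y. h (\<phi> y) $ a $ b) x) * J x $ b $ l
      + J x $ a $ j * h (\<phi> x) $ a $ b * partial i (\<lambda>y. J y $ b $ l) x)"
    by (simp add: partial_sum partial_mult d differentiable_mult differentiable_sum)
  finally have *: "partial i (\<lambda>y. g y $ j $ l) x = \<dots>" .
  have "partial i (\<lambda>y. h (\<phi> y) $ a $ b) x = (\<Sum>c\<in>UNIV. partial c (\<lambda>y. h y $ a $ b) (\<phi> x) * J x $ c $ i)" for a b
    using partial_chain(1)[of "\<lambda>y. h y $ a $ b" \<phi> x i] Cinf_on_differentiable[OF metric_on_Cinf_on[OF h] \<phi>_in[OF x]]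
      Cinf_on_differentiable[OF \<phi> x] by (simp add: J_entry)
  then show ?thesis unfolding * by (simp add: algebra_simps)
qed

text \<open>The Levi-Civita connection of \<open>h\<close> pulled back along \<open>\<phi>\<close>,
  still in the coordinate frame of the target. Staying in that frame keeps the inverse Jacobian out
  of the gauge identity.\<close>

definition pulled_connection :: "'n \<Rightarrow> real^'n \<Rightarrow> real^'n^'n" where
  "pulled_connection i x = (\<Sum>a\<in>UNIV. J x $ a $ i *\<^sub>R connection_matrix h a (\<phi> x))"

text \<open>The transformation law of Christoffel symbols, multiplied through by \<open>J\<close>.
  Both sides are compared after lowering the upper index by the invertible matrix
  \<open>transpose (J x) ** h (\<phi> x)\<close>, where the Koszul formula applies.\<close>

lemma gauge:
  assumes x: "x \<in> U"
  shows "J x ** connection_matrix g i x = matrix_partial i J x + pulled_connection i x ** J x"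
proof -
  let ?G = "\<lambda>c a b. christoffel h c a b (\<phi> x)" and ?h = "h (\<phi> x)"
  define T where "T = matrix_partial i J x + pulled_connection i x ** J x"
  have T: "T $ c $ j = partial i (\<lambda>y. J y $ c $ j) x + (\<Sum>a\<in>UNIV. \<Sum>b\<in>UNIV. ?G c a b * J x $ a $ i * J x $ b $ j)" for c j
    unfolding T_def pulled_connection_def matrix_partial_def connection_matrix_def
    by (simp add: matrix_matrix_mult_def sum_distrib_left sum_distrib_right mult_ac)
       (subst sum.swap, simp add: mult_ac)
  define D where "D p q r = (\<Sum>a\<in>UNIV. \<Sum>b\<in>UNIV. \<Sum>c\<in>UNIV.
     partial c (\<lambda>y. h y $ a $ b) (\<phi> x) * J x $ c $ p * J x $ a $ q * J x $ b $ r)" for p q r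
  define S where "S p q r = (\<Sum>a\<in>UNIV. \<Sum>b\<in>UNIV. partial p (\<lambda>y. J y $ a $ q) x * ?h $ a $ b * J x $ b $ r)" for p q r
  have hsym: "?h $ a $ b = ?h $ b $ a" for a b by (rule metric_on_sym[OF h \<phi>_in[OF x]])
  have Ssym: "S p q r = S q p r" for p q r unfolding S_def using J_sym[OF x] by simp
  \<comment> \<open>Derivative of the pulled-back metric: \<open>S\<close> collects the second
    derivatives of \<open>\<phi>\<close>, \<open>D\<close> the first derivatives of
    \<open>h\<close>.\<close>
  have dg: "partial p (\<lambda>y. g y $ q $ r) x = S p q r + S p r q + D p q r" for p q r
  proof -
    have "S p r q = (\<Sum>a\<in>UNIV. \<Sum>b\<in>UNIV. J x $ a $ q * ?h $ a $ b * partial p (\<lambda>y. J y $ b $ r) x)"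
      unfolding S_def by (subst sum.swap) (simp add: hsym mult_ac)
    then show ?thesis unfolding partial_pullback[OF x] D_def S_def
      by (simp add: sum.distrib sum_distrib_left sum_distrib_right mult_ac)
  qed
  have "(transpose (J x) ** ?h ** (J x ** connection_matrix g i x)) $ l $ j = (transpose (J x) ** ?h ** T) $ l $ j" for l j
  proof -
    have "(transpose (J x) ** ?h ** (J x ** connection_matrix g i x)) $ l $ j = (g x ** connection_matrix g i x) $ l $ j"
      by (simp add: pullback[OF x] matrix_mul_assoc)
    also have "\<dots> = (partial i (\<lambda>y. g y $ j $ l) x + partial j (\<lambda>y. g y $ i $ l) x - partial l (\<lambda>y. g y $ i $ j) x) / 2"
      using christoffel_lower[OF g x] by (simp add: matrix_matrix_mult_def connection_matrix_def)
    \<comment> \<open>Of the six \<open>S\<close> terms four cancel, since \<open>S\<close> is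
      symmetric in its first two arguments; twice \<open>S i j l\<close> remains.\<close>
    also have "\<dots> = S i j l + (D i j l + D j i l - D l i j) / 2"
      unfolding dg using Ssym[of i j l] Ssym[of l i j] Ssym[of l j i] by (simp add: field_simps)
    also have "(D i j l + D j i l - D l i j) / 2 =
       (\<Sum>e\<in>UNIV. \<Sum>a\<in>UNIV. \<Sum>b\<in>UNIV. J x $ e $ l * J x $ a $ i * J x $ b $ j * (\<Sum>c\<in>UNIV. ?h $ e $ c * ?G c a b))"
    proof -
      let ?p = "\<lambda>c a b. partial c (\<lambda>y. h y $ a $ b) (\<phi> x)"
      have 1: "D i j l = (\<Sum>e\<in>UNIV. \<Sum>a\<in>UNIV. \<Sum>b\<in>UNIV. J x $ e $ l * J x $ a $ i * J x $ b $ j * ?p a b e)"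
        unfolding D_def by (subst sum.swap, rule sum.cong[OF refl], subst sum.swap) (simp add: mult_ac)
      have 2: "D j i l = (\<Sum>e\<in>UNIV. \<Sum>a\<in>UNIV. \<Sum>b\<in>UNIV. J x $ e $ l * J x $ a $ i * J x $ b $ j * ?p b a e)"
        unfolding D_def by (subst sum.swap) (simp add: mult_ac)
      have 3: "D l i j = (\<Sum>e\<in>UNIV. \<Sum>a\<in>UNIV. \<Sum>b\<in>UNIV. J x $ e $ l * J x $ a $ i * J x $ b $ j * ?p e a b)"
        unfolding D_def by (subst (2) sum.swap, subst sum.swap, simp add: mult_ac)
      show ?thesis unfolding 1 2 3 christoffel_lower[OF h \<phi>_in[OF x]]
        by (simp add: sum.distrib sum_subtractf sum_divide_distrib algebra_simps add_divide_distrib diff_divide_distrib)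
    qed
    also have "S i j l + \<dots> = (\<Sum>e\<in>UNIV. \<Sum>c\<in>UNIV. J x $ e $ l * ?h $ e $ c * T $ c $ j)"
    proof -
      have a: "S i j l = (\<Sum>e\<in>UNIV. \<Sum>c\<in>UNIV. J x $ e $ l * ?h $ e $ c * partial i (\<lambda>y. J y $ c $ j) x)"
        unfolding S_def by (subst sum.swap) (simp add: hsym mult_ac)
      have b: "(\<Sum>a\<in>UNIV. \<Sum>b\<in>UNIV. J x $ e $ l * J x $ a $ i * J x $ b $ j * (\<Sum>c\<in>UNIV. ?h $ e $ c * ?G c a b))
        = (\<Sum>c\<in>UNIV. J x $ e $ l * ?h $ e $ c * (\<Sum>a\<in>UNIV. \<Sum>b\<in>UNIV. ?G c a b * J x $ a $ i * J x $ b $ j))" for e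
        unfolding sum_distrib_left
        by (subst (3) sum.swap, subst (2) sum.swap, subst (1) sum.swap) (simp add: mult_ac, rule sum.swap)
      show ?thesis unfolding a b T by (simp add: distrib_left sum.distrib)
    qed
    also have "\<dots> = (transpose (J x) ** ?h ** T) $ l $ j"
      by (simp add: matrix_matrix_mult_def transpose_def sum_distrib_right) (rule sum.swap)
    finally show ?thesis .
  qed
  then have eq: "transpose (J x) ** ?h ** (J x ** connection_matrix g i x) = transpose (J x) ** ?h ** T"
    by (simp add: vec_eq_iff)
  have inv: "invertible (transpose (J x) ** ?h)"
    using invertible_J[OF x] metric_on_invertible[OF h \<phi>_in[OF x]]
    by (simp add: invertible_mult transpose_invertible)
  show ?thesis using matrix_left_cancel[OF inv eq] by (simp only: T_def)
qed

lemma pulled_connection_smooth: "matrix_Cinf_on U (pulled_connection i)"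
proof -
  have "Cinf_on U (\<lambda>y. connection_matrix h a (\<phi> y) $ p $ q)" for a p q
    using matrix_Cinf_on_connection[OF h, of a] unfolding matrix_Cinf_on_def
    by (intro Cinf_on_compose[OF _ \<phi> sub]) blast
  then show ?thesis using J_smooth open_U
    unfolding matrix_Cinf_on_def pulled_connection_def by (auto intro!: Cinf_on_sum Cinf_on_mult)
qed

text \<open>The curvature of a pulled-back connection is the pullback of the curvature: the terms
  with derivatives of \<open>J\<close> are symmetric in \<open>i\<close> and \<open>j\<close> and
  drop out, the rest is the chain rule.\<close>

lemma pulled_curvature:
  assumes x: "x \<in> U"
  shows "matrix_partial i (pulled_connection j) x - matrix_partial j (pulled_connection i) x
      + pulled_connection i x ** pulled_connection j x - pulled_connection j x ** pulled_connection i x =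
    (\<Sum>b\<in>UNIV. \<Sum>a\<in>UNIV. (J x $ b $ i * J x $ a $ j) *\<^sub>R curvature h b a (\<phi> x))"
proof -
  let ?C = "\<lambda>a. connection_matrix h a (\<phi> x)"
  have mp: "matrix_partial i (pulled_connection j) x = (\<Sum>a\<in>UNIV. partial i (\<lambda>y. J y $ a $ j) x *\<^sub>R ?C a)
     + (\<Sum>b\<in>UNIV. \<Sum>a\<in>UNIV. (J x $ b $ i * J x $ a $ j) *\<^sub>R matrix_partial b (connection_matrix h a) (\<phi> x))" for i j
  proof -
    have d: "(\<lambda>y. J y $ a $ k) differentiable at x" for a k
      using Cinf_on_differentiable[OF _ x] J_smooth unfolding matrix_Cinf_on_def by blast
    have C: "Cinf_on V (\<lambda>y. connection_matrix h a y $ p $ q)" for a p q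
      using matrix_Cinf_on_connection[OF h] unfolding matrix_Cinf_on_def by blast
    have dC: "(\<lambda>y. connection_matrix h a (\<phi> y) $ p $ q) differentiable at x" for a p q
      using Cinf_on_differentiable[OF Cinf_on_compose[OF C \<phi> sub] x] .
    have pC: "partial i (\<lambda>y. connection_matrix h a (\<phi> y) $ p $ q) x =
      (\<Sum>b\<in>UNIV. matrix_partial b (connection_matrix h a) (\<phi> x) $ p $ q * J x $ b $ i)" for a p q
      using partial_chain(1)[of "\<lambda>y. connection_matrix h a y $ p $ q" \<phi> x i] Cinf_on_differentiable[OF C \<phi>_in[OF x]]
        Cinf_on_differentiable[OF \<phi> x] by (simp add: J_entry matrix_partial_def)
    have "matrix_partial i (pulled_connection j) x $ p $ q =
      (\<Sum>a\<in>UNIV. partial i (\<lambda>y. J y $ a $ j) x * ?C a $ p $ q + J x $ a $ j *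
        (\<Sum>b\<in>UNIV. matrix_partial b (connection_matrix h a) (\<phi> x) $ p $ q * J x $ b $ i))" for p q
      unfolding matrix_partial_def[of i "pulled_connection j"] pulled_connection_def
      by (simp add: partial_sum partial_mult d dC pC differentiable_mult)
    moreover have "(\<Sum>b\<in>UNIV. \<Sum>a\<in>UNIV. J x $ b $ i * J x $ a $ j * matrix_partial b (connection_matrix h a) (\<phi> x) $ p $ q)
      = (\<Sum>a\<in>UNIV. J x $ a $ j * (\<Sum>b\<in>UNIV. matrix_partial b (connection_matrix h a) (\<phi> x) $ p $ q * J x $ b $ i))" for p q
      by (subst sum.swap) (simp add: sum_distrib_left mult_ac)
    ultimately show ?thesis
      unfolding vec_eq_iff by (simp add: sum.distrib)
  qed
  have pp: "pulled_connection i x ** pulled_connection j x =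
    (\<Sum>b\<in>UNIV. \<Sum>a\<in>UNIV. (J x $ b $ i * J x $ a $ j) *\<^sub>R (?C b ** ?C a))" for i j
  proof -
    have "(\<Sum>k\<in>UNIV. (\<Sum>b\<in>UNIV. J x $ b $ i * ?C b $ p $ k) * (\<Sum>a\<in>UNIV. J x $ a $ j * ?C a $ k $ q))
      = (\<Sum>b\<in>UNIV. \<Sum>a\<in>UNIV. (J x $ b $ i * J x $ a $ j) * (\<Sum>k\<in>UNIV. ?C b $ p $ k * ?C a $ k $ q))" for p q
      unfolding sum_product
      unfolding sum_distrib_left
      by (subst sum.swap, rule sum.cong[OF refl], subst sum.swap) (simp add: mult_ac)
    then show ?thesis
      by (simp add: pulled_connection_def vec_eq_iff matrix_matrix_mult_def)
  qed
  have sw: "(\<Sum>b\<in>UNIV. \<Sum>a\<in>UNIV. (J x $ b $ j * J x $ a $ i) *\<^sub>R F b a)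
    = (\<Sum>b\<in>UNIV. \<Sum>a\<in>UNIV. (J x $ b $ i * J x $ a $ j) *\<^sub>R F a b)" for F :: "'n \<Rightarrow> 'n \<Rightarrow> real^'n^'n"
    by (subst sum.swap) (simp add: mult.commute)
  show ?thesis unfolding mp[of i j] mp[of j i] pp[of i j] pp[of j i] curvature_def
      sw[of "\<lambda>b a. matrix_partial b (connection_matrix h a) (\<phi> x)"] sw[of "\<lambda>b a. ?C b ** ?C a"]
    using J_sym[OF x, of i _ j]
    by (simp add: sum.distrib sum_subtractf scaleR_add_right scaleR_diff_right)
qed

theorem curvature_natural:
  assumes x: "x \<in> U"
  shows "J x ** curvature g i j x =
    (\<Sum>b\<in>UNIV. \<Sum>a\<in>UNIV. (J x $ b $ i * J x $ a $ j) *\<^sub>R curvature h b a (\<phi> x)) ** J x"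
  unfolding pulled_curvature[OF x, symmetric] curvature_def[of g]
  by (rule curvature_gauge[OF J_smooth matrix_Cinf_on_connection[OF g] pulled_connection_smooth open_U x])
     (rule gauge)

theorem ricci_natural:
  assumes x: "x \<in> U"
  shows "ricci g x = transpose (J x) ** ricci h (\<phi> x) ** J x"
proof -
  let ?I = "matrix_inv (J x)" and ?R = "\<lambda>b a. curvature h b a (\<phi> x)"
  have IJ: "(\<Sum>i\<in>UNIV. ?I $ i $ c * J x $ b $ i) = (if b = c then 1 else 0)" for b c
    using arg_cong[OF matrix_inv_right[OF invertible_J[OF x]], of "\<lambda>M. M $ b $ c"]
    by (simp add: matrix_matrix_mult_def mat_def mult.commute)
  have delta: "(\<Sum>b\<in>UNIV. \<Sum>a\<in>UNIV. (if b = c then 1 else 0) * F b a) = (\<Sum>a\<in>UNIV. F c a)"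
    for c and F :: "'n \<Rightarrow> 'n \<Rightarrow> real"
  proof -
    have "(\<Sum>a\<in>UNIV. (if b = c then 1 else 0) * F b a) = (if b = c then \<Sum>a\<in>UNIV. F c a else 0)" for b by simp
    then show ?thesis by simp
  qed
  have "ricci g x $ j $ k = (transpose (J x) ** ricci h (\<phi> x) ** J x) $ j $ k" for j k
  proof -
    \<comment> \<open>Solving \<open>curvature_natural\<close> for the curvature of \<open>g\<close>
      leaves one factor of the inverse Jacobian, and the trace over \<open>i\<close> contracts it
      with \<open>J\<close> to a Kronecker delta.\<close>
    have R: "curvature g i j x $ i $ k = (\<Sum>c\<in>UNIV. \<Sum>d\<in>UNIV. \<Sum>b\<in>UNIV. \<Sum>a\<in>UNIV.
      (?I $ i $ c * J x $ b $ i) * (J x $ a $ j * ?R b a $ c $ d * J x $ d $ k))" for i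
    proof -
      have "curvature g i j x = ?I ** (J x ** curvature g i j x)"
        by (simp add: matrix_mul_assoc matrix_inv_left[OF invertible_J[OF x]])
      then show ?thesis unfolding curvature_natural[OF x]
        by (simp add: matrix_matrix_mult_def sum_distrib_left sum_distrib_right mult_ac)
    qed
    have "ricci g x $ j $ k = (\<Sum>c\<in>UNIV. \<Sum>d\<in>UNIV. \<Sum>b\<in>UNIV. \<Sum>a\<in>UNIV.
      (\<Sum>i\<in>UNIV. ?I $ i $ c * J x $ b $ i) * (J x $ a $ j * ?R b a $ c $ d * J x $ d $ k))"
      unfolding ricci_eq_curvature R sum_distrib_right
      by (subst sum.swap, rule sum.cong[OF refl], subst sum.swap, rule sum.cong[OF refl],
          subst sum.swap, rule sum.cong[OF refl], subst sum.swap, rule refl)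
    also have "\<dots> = (\<Sum>c\<in>UNIV. \<Sum>d\<in>UNIV. \<Sum>a\<in>UNIV. J x $ a $ j * ?R c a $ c $ d * J x $ d $ k)"
      unfolding IJ delta by simp
    also have "\<dots> = (\<Sum>d\<in>UNIV. \<Sum>a\<in>UNIV. \<Sum>c\<in>UNIV. J x $ a $ j * ?R c a $ c $ d * J x $ d $ k)"
      by (subst sum.swap, rule sum.cong[OF refl], subst sum.swap, rule refl)
    also have "\<dots> = (transpose (J x) ** ricci h (\<phi> x) ** J x) $ j $ k"
      by (simp add: matrix_matrix_mult_def transpose_def ricci_eq_curvature sum_distrib_left sum_distrib_right)
    finally show ?thesis .
  qed
  then show ?thesis by (simp add: vec_eq_iff)
qed

theorem einstein_natural:
  assumes x: "x \<in> U" and "ricci h (\<phi> x) = c *\<^sub>R h (\<phi> x)"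
  shows "ricci g x = c *\<^sub>R g x"
  unfolding ricci_natural[OF x] assms(2) pullback[OF x]
  by (simp add: matrix_matrix_mult_def vec_eq_iff sum_distrib_left sum_distrib_right mult_ac)

theorem scalar_curvature_natural:
  assumes x: "x \<in> U"
  shows "scalar_curvature g x = scalar_curvature h (\<phi> x)"
proof -
  have tr: "scalar_curvature k y = trace (matrix_inv (k y) ** transpose (ricci k y))" for k :: "real^'n \<Rightarrow> real^'n^'n" and y
    by (simp add: scalar_curvature_def trace_def matrix_matrix_mult_def transpose_def)
  let ?I = "matrix_inv (J x)" and ?h = "h (\<phi> x)"
  have JI: "J x ** ?I = mat 1" "?I ** J x = mat 1"
    using invertible_J[OF x] by (simp_all add: matrix_inv_right matrix_inv_left)
  have JT: "transpose (J x) ** transpose ?I = mat 1" "transpose ?I ** transpose (J x) = mat 1"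
    using arg_cong[OF JI(1), of transpose] arg_cong[OF JI(2), of transpose]
    by (simp_all add: matrix_transpose_mul)
  have H: "?h ** matrix_inv ?h = mat 1"
    using metric_on_invertible[OF h \<phi>_in[OF x]] by (rule matrix_inv_right)
  have "g x ** (?I ** matrix_inv ?h ** transpose ?I) = transpose (J x) ** (?h ** ((J x ** ?I) ** matrix_inv ?h)) ** transpose ?I"
    unfolding pullback[OF x] by (simp only: matrix_mul_assoc)
  then have "matrix_inv (g x) = ?I ** matrix_inv ?h ** transpose ?I"
    by (intro matrix_inv_unique) (simp add: JI H JT)
  then have "scalar_curvature g x = trace (?I ** matrix_inv ?h ** transpose ?I ** (transpose (J x) ** transpose (ricci h (\<phi> x)) ** J x))"
    unfolding tr ricci_natural[OF x] by (simp add: matrix_transpose_mul matrix_mul_assoc)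
  also have "\<dots> = trace ((?I ** (matrix_inv ?h ** ((transpose ?I ** transpose (J x)) ** transpose (ricci h (\<phi> x))))) ** J x)"
    by (simp only: matrix_mul_assoc)
  also have "\<dots> = trace (J x ** ?I ** (matrix_inv ?h ** transpose (ricci h (\<phi> x))))"
    by (subst trace_mul_sym) (simp add: JT matrix_mul_assoc)
  finally show ?thesis by (simp add: JI tr)
qed

end

section \<open>Kaehler metrics have J-invariant curvature\<close>

text \<open>Here \<open>b X Y Z\<close> stands for the inner product of \<open>Y\<close> with the
  derivative of \<open>J\<close> along \<open>X\<close> applied to \<open>Z\<close>. Integrability
  makes \<open>c\<close> symmetric in its outer arguments, and it is skew in the last two, so it
  vanishes. Closedness at \<open>(J Z, X, Y)\<close> and at \<open>(Z, X, J Y)\<close> then adds up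
  to twice the claim.\<close>

lemma almost_kaehler_torsion_algebra:
  fixes b :: "'a \<Rightarrow> 'a \<Rightarrow> 'a \<Rightarrow> real" and J :: "'a \<Rightarrow> 'a"
  assumes skew: "\<And>X Y Z. b X Y Z = - b X Z Y"
    and J: "\<And>X Y Z. b X (J Y) Z = b X Y (J Z)"
    and integrable: "\<And>X Y Z. b (J X) Z Y + b X (J Z) Y = b (J Y) Z X + b Y (J Z) X"
    and closed: "\<And>X Y Z. b X Y Z + b Y Z X + b Z X Y = 0"
  shows "b X Y (J Z) = 0"
proof -
  define c where "c X Z Y = b (J X) Z Y + b X (J Z) Y" for X Z Y
  have c_sym: "c X Z Y = c Y Z X" for X Y Z using integrable[of X Z Y] by (simp add: c_def)
  have c_skew: "c X Z Y = - c X Y Z" for X Y Z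
    using skew[of "J X" Z Y] skew[of X "J Z" Y] J[of X Y Z] by (simp add: c_def)
  have "c X Z Y = 0" for X Y Z
    using c_sym[of X Z Y] c_skew[of Y Z X] c_sym[of Y X Z] c_skew[of Z X Y] c_sym[of Z Y X] c_skew[of X Y Z]
    by linarith
  then have first: "b (J X) Z Y = - b X (J Z) Y" for X Y Z unfolding c_def by (smt (verit))
  show ?thesis
    using closed[of "J Z" X Y] closed[of Z X "J Y"] first[of Z X Y] first[of Y Z X]
      J[of Z X Y] J[of X Y Z] J[of Y Z X] by linarith
qed

lemma matrix_entries_inner: "(\<And>u v. u \<bullet> (A *v v) = u \<bullet> (B *v v)) \<Longrightarrow> A = (B :: real^'n::finite^'m::finite)"
proof -
  assume *: "\<And>u v. u \<bullet> (A *v v) = u \<bullet> (B *v v)"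
  have "A *v v = B *v v" for v using * by (metis vector_eq_rdot inner_commute)
  then show ?thesis by (simp add: matrix_eq)
qed

lemma sum_rotate:
  "(\<Sum>a\<in>A. \<Sum>b\<in>B. \<Sum>c\<in>C. F a b c) = (\<Sum>c\<in>C. \<Sum>a\<in>A. \<Sum>b\<in>B. F a b c)"
proof -
  have "(\<Sum>a\<in>A. \<Sum>b\<in>B. \<Sum>c\<in>C. F a b c) = (\<Sum>a\<in>A. \<Sum>c\<in>C. \<Sum>b\<in>B. F a b c)"
    by (intro sum.cong refl sum.swap)
  also have "\<dots> = (\<Sum>c\<in>C. \<Sum>a\<in>A. \<Sum>b\<in>B. F a b c)" by (rule sum.swap)
  finally show ?thesis .
qed

lemma matrix_sum_scaleR_left: "(\<Sum>a\<in>S. c a *\<^sub>R M a) ** K = (\<Sum>a\<in>S. c a *\<^sub>R (M a ** K))"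
  and matrix_sum_scaleR_right: "L ** (\<Sum>a\<in>S. c a *\<^sub>R M a) = (\<Sum>a\<in>S. c a *\<^sub>R (L ** M a))"
  for M :: "'s \<Rightarrow> real^'n::finite^'m::finite" and K :: "real^'k::finite^'n" and L :: "real^'m^'k"
  by (simp_all add: vec_eq_iff matrix_matrix_mult_def sum_distrib_left sum_distrib_right mult_ac)
     (auto intro: sum.swap)

lemma matrix_vector_mult_minus_left: "(- A) *v v = - (A *v v)"
  and matrix_vector_mult_minus_right: "A *v (- v) = - (A *v v)" for A :: "real^'n::finite^'m::finite"
  by (simp_all add: matrix_vector_mult_def vec_eq_iff sum_negf)

locale kaehler_chart =
  fixes U :: "(real^'n::finite) set" and g J :: "real^'n \<Rightarrow> real^'n^'n"
  assumes g: "metric_on U g" and J: "matrix_Cinf_on U J"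
    and J_sq: "\<And>x. x \<in> U \<Longrightarrow> J x ** J x = - mat 1"
    and nijenhuis: "\<And>x k a b. x \<in> U \<Longrightarrow> nijenhuis J k a b x = 0"
    and compatible: "\<And>x. x \<in> U \<Longrightarrow> transpose (J x) ** g x ** J x = g x"
    and closed: "\<And>x. x \<in> U \<Longrightarrow> closed_2form (\<lambda>y. transpose (J y) ** g y) x"
begin

definition nabla_J :: "'n \<Rightarrow> real^'n \<Rightarrow> real^'n^'n" where
  "nabla_J a x = matrix_partial a J x + connection_matrix g a x ** J x - J x ** connection_matrix g a x"

lemma g_smooth: "matrix_Cinf_on U g"
  using g metric_on_Cinf_on unfolding matrix_Cinf_on_def by blast

lemma transpose_J_g:
  assumes "x \<in> U"
  shows "transpose (J x) ** g x = - (g x ** J x)"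
proof -
  have "transpose (J x) ** g x ** J x ** J x = g x ** J x" by (simp add: compatible[OF assms])
  then show ?thesis using J_sq[OF assms]
    by (simp add: matrix_minus_right minus_equation_iff flip: matrix_mul_assoc)
qed

lemma g_transpose: "x \<in> U \<Longrightarrow> transpose (g x) = g x"
  using g by (simp add: metric_on_def)

text \<open>Derivative of \<open>J ** J = - mat 1\<close>; the connection terms form a commutator
  with \<open>J\<close>, and such a commutator anticommutes with \<open>J\<close> in any
  case.\<close>

lemma nabla_J_anticommute:
  assumes x: "x \<in> U"
  shows "nabla_J a x ** J x = - (J x ** nabla_J a x)"
proof -
  have "matrix_partial a (\<lambda>y. J y ** J y) x = matrix_partial a (\<lambda>y. - mat 1) x"
    using matrix_partial_cong[OF metric_on_open[OF g] x J_sq] .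
  also have "\<dots> = 0" by (simp add: matrix_partial_def vec_eq_iff)
  finally have "matrix_partial a J x ** J x = - (J x ** matrix_partial a J x)"
    by (simp add: matrix_partial_mult[OF J J x] eq_neg_iff_add_eq_0)
  moreover have "J x ** (J x ** M) = - M" "M ** J x ** J x = - M" for M :: "real^'n^'n"
    by (simp_all add: matrix_mul_assoc J_sq[OF x] matrix_minus_left)
       (simp add: J_sq[OF x] matrix_minus_right flip: matrix_mul_assoc)
  ultimately show ?thesis unfolding nabla_J_def matrix_add_ldistrib matrix_add_rdistrib matrix_sub_ldistrib matrix_sub_rdistrib
    by (simp add: matrix_mul_assoc[symmetric, of "J x" "connection_matrix g a x" "J x"])
qed

lemma partial_gJ:
  assumes x: "x \<in> U"
  shows "matrix_partial a (\<lambda>y. g y ** J y) x =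
    transpose (connection_matrix g a x) ** (g x ** J x) + (g x ** J x) ** connection_matrix g a x + g x ** nabla_J a x"
proof -
  have "matrix_partial a g x = transpose (connection_matrix g a x) ** g x + g x ** connection_matrix g a x"
    using metric_compatible[OF g x, of a] metric_on_sym[OF g x]
    by (simp add: matrix_partial_def matrix_matrix_mult_def transpose_def connection_matrix_def vec_eq_iff mult.commute)
  then show ?thesis unfolding nabla_J_def
    by (simp add: matrix_partial_mult[OF g_smooth J x] matrix_ring_simps algebra_simps)
qed

lemma gJ_skew: "x \<in> U \<Longrightarrow> (g x ** J x) $ b $ c = - (g x ** J x) $ c $ b"
proof -
  assume x: "x \<in> U"
  have "transpose (g x ** J x) = - (g x ** J x)"
    using transpose_J_g[OF x] g_transpose[OF x] by (simp add: matrix_transpose_mul)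
  from arg_cong[OF this, of "\<lambda>M. M $ c $ b"] show ?thesis by (simp add: transpose_def)
qed

definition B :: "'n \<Rightarrow> real^'n \<Rightarrow> real^'n^'n" where
  "B a x = g x ** nabla_J a x"

text \<open>As the metric is parallel, \<open>B\<close> is the covariant derivative of the two-form
  with matrix \<open>g ** J\<close>.\<close>

lemma B_eq: "x \<in> U \<Longrightarrow> B a x $ b $ c = partial a (\<lambda>y. (g y ** J y) $ b $ c) x
   - (\<Sum>d\<in>UNIV. christoffel g d a b x * (g x ** J x) $ d $ c) - (\<Sum>d\<in>UNIV. (g x ** J x) $ b $ d * christoffel g d a c x)"
proof -
  assume x: "x \<in> U"
  have "(transpose (connection_matrix g a x) ** F) $ b $ c = (\<Sum>d\<in>UNIV. christoffel g d a b x * F $ d $ c)"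
    "(F ** connection_matrix g a x) $ b $ c = (\<Sum>d\<in>UNIV. F $ b $ d * christoffel g d a c x)" for F :: "real^'n^'n"
    by (simp_all add: matrix_matrix_mult_def transpose_def connection_matrix_def)
  then show ?thesis using arg_cong[OF partial_gJ[OF x, of a], of "\<lambda>M. M $ b $ c"]
    by (simp add: B_def matrix_partial_def)
qed

lemma partial_gJ_skew:
  assumes x: "x \<in> U"
  shows "partial a (\<lambda>y. (g y ** J y) $ b $ c) x = - partial a (\<lambda>y. (g y ** J y) $ c $ b) x"
proof -
  have "partial a (\<lambda>y. (g y ** J y) $ b $ c) x = partial a (\<lambda>y. - (g y ** J y) $ c $ b) x"
    by (rule partial_cong[OF metric_on_open[OF g] x]) (rule gJ_skew)
  also have "\<dots> = - partial a (\<lambda>y. (g y ** J y) $ c $ b) x"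
    using matrix_Cinf_on_mult[OF g_smooth J] x
    by (intro partial_minus Cinf_on_differentiable) (auto simp: matrix_Cinf_on_def)
  finally show ?thesis .
qed

lemma B_skew:
  assumes "x \<in> U"
  shows "B a x $ b $ c = - B a x $ c $ b"
  unfolding B_eq[OF assms] partial_gJ_skew[OF assms, of a b c]
  using gJ_skew[OF assms, of b] gJ_skew[OF assms, of _ c] by (simp add: sum_negf mult.commute)

text \<open>The cyclic sum of covariant derivatives is the exterior derivative: the Christoffel
  terms cancel by the symmetry of their lower indices.\<close>

lemma B_closed:
  assumes x: "x \<in> U"
  shows "B a x $ b $ c + B b x $ c $ a + B c x $ a $ b = 0"
proof -
  have "partial a (\<lambda>y. (transpose (J y) ** g y) $ b $ c) x = - partial a (\<lambda>y. (g y ** J y) $ b $ c) x" for a b c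
  proof -
    have "partial a (\<lambda>y. (transpose (J y) ** g y) $ b $ c) x = partial a (\<lambda>y. - (g y ** J y) $ b $ c) x"
      by (rule partial_cong[OF metric_on_open[OF g] x]) (simp add: transpose_J_g)
    also have "\<dots> = - partial a (\<lambda>y. (g y ** J y) $ b $ c) x"
      using matrix_Cinf_on_mult[OF g_smooth J] x
      by (intro partial_minus Cinf_on_differentiable) (auto simp: matrix_Cinf_on_def)
    finally show ?thesis .
  qed
  note eq = this
  have cl: "partial a (\<lambda>y. (g y ** J y) $ b $ c) x + partial b (\<lambda>y. (g y ** J y) $ c $ a) x
    + partial c (\<lambda>y. (g y ** J y) $ a $ b) x = 0"
    using closed[OF x, unfolded closed_2form_def, rule_format, of a b c] unfolding eq by linarith
  have s: "(\<Sum>d\<in>UNIV. (g x ** J x) $ p $ d * christoffel g d q r x) = - (\<Sum>d\<in>UNIV. christoffel g d r q x * (g x ** J x) $ d $ p)" for p q r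
    by (subst gJ_skew[OF x]) (simp add: sum_negf mult.commute christoffel_sym[OF g x, of _ q r])
  show ?thesis unfolding B_eq[OF x] s using cl christoffel_sym[OF g x] by simp
qed

text \<open>The Nijenhuis tensor with partial derivatives replaced by covariant ones. The correction
  terms pair off because the connection has no torsion.\<close>

lemma nabla_J_integrable:
  assumes x: "x \<in> U"
  shows "(\<Sum>l\<in>UNIV. J x $ l $ i * nabla_J l x $ k $ j - J x $ l $ j * nabla_J l x $ k $ i
     - J x $ k $ l * (nabla_J i x $ l $ j - nabla_J j x $ l $ i)) = 0"
proof -
  let ?G = "\<lambda>k i j. christoffel g k i j x" and ?J = "\<lambda>k l. J x $ k $ l"
  have n: "nabla_J a x $ k $ j = partial a (\<lambda>y. J y $ k $ j) x + (\<Sum>m\<in>UNIV. ?G k a m * ?J m j) - (\<Sum>m\<in>UNIV. ?J k m * ?G m a j)" for a k j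
    by (simp add: nabla_J_def matrix_partial_def connection_matrix_def matrix_matrix_mult_def)
  have "(\<Sum>l\<in>UNIV. J x $ l $ i * nabla_J l x $ k $ j - J x $ l $ j * nabla_J l x $ k $ i
     - J x $ k $ l * (nabla_J i x $ l $ j - nabla_J j x $ l $ i)) = nijenhuis J k i j x
    + ((\<Sum>l\<in>UNIV. \<Sum>m\<in>UNIV. ?J l i * ?G k l m * ?J m j) - (\<Sum>l\<in>UNIV. \<Sum>m\<in>UNIV. ?J l i * ?J k m * ?G m l j))
    - ((\<Sum>l\<in>UNIV. \<Sum>m\<in>UNIV. ?J l j * ?G k l m * ?J m i) - (\<Sum>l\<in>UNIV. \<Sum>m\<in>UNIV. ?J l j * ?J k m * ?G m l i))
    - ((\<Sum>l\<in>UNIV. \<Sum>m\<in>UNIV. ?J k l * ?G l i m * ?J m j) - (\<Sum>l\<in>UNIV. \<Sum>m\<in>UNIV. ?J k l * ?J l m * ?G m i j))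
    + ((\<Sum>l\<in>UNIV. \<Sum>m\<in>UNIV. ?J k l * ?G l j m * ?J m i) - (\<Sum>l\<in>UNIV. \<Sum>m\<in>UNIV. ?J k l * ?J l m * ?G m j i))"
    unfolding n nijenhuis_def
    by (simp add: sum.distrib sum_subtractf sum_distrib_left algebra_simps)
  moreover have "(\<Sum>l\<in>UNIV. \<Sum>m\<in>UNIV. ?J l i * ?G k l m * ?J m j) = (\<Sum>l\<in>UNIV. \<Sum>m\<in>UNIV. ?J l j * ?G k l m * ?J m i)"
    by (subst sum.swap) (simp add: christoffel_sym[OF g x, of k] mult_ac)
  moreover have "(\<Sum>l\<in>UNIV. \<Sum>m\<in>UNIV. ?J l i * ?J k m * ?G m l j) = (\<Sum>l\<in>UNIV. \<Sum>m\<in>UNIV. ?J k l * ?G l j m * ?J m i)" for i j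
    by (subst sum.swap) (simp add: christoffel_sym[OF g x, of _ _ j] mult_ac)
  moreover have "?G m i j = ?G m j i" for m by (rule christoffel_sym[OF g x])
  ultimately show ?thesis using nijenhuis[OF x] by simp
qed

text \<open>Integrability, closedness and compatibility feed
  \<open>almost_kaehler_torsion_algebra\<close>, which is free of indices; hence the passage from
  coordinate directions to arbitrary vectors through \<open>A\<close> and \<open>b\<close>.\<close>

lemma nabla_J_zero:
  assumes x: "x \<in> U"
  shows "nabla_J a x = 0"
proof -
  define A where "A X = (\<Sum>a\<in>UNIV. X $ a *\<^sub>R nabla_J a x)" for X :: "real^'n"
  define b where "b X Y Z = Y \<bullet> (g x *v (A X *v Z))" for X Y Z
  let ?J = "\<lambda>X. J x *v X"
  have b_sum: "b X Y Z = (\<Sum>a\<in>UNIV. \<Sum>p\<in>UNIV. \<Sum>q\<in>UNIV. X $ a * Y $ p * Z $ q * B a x $ p $ q)" for X Y Z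
  proof -
    have "g x ** A X = (\<Sum>a\<in>UNIV. X $ a *\<^sub>R B a x)"
      unfolding A_def B_def by (rule matrix_sum_scaleR_right)
    then have "b X Y Z = Y \<bullet> ((\<Sum>a\<in>UNIV. X $ a *\<^sub>R B a x) *v Z)" by (simp add: b_def matrix_vector_mul_assoc)
    also have "\<dots> = (\<Sum>p\<in>UNIV. \<Sum>q\<in>UNIV. \<Sum>a\<in>UNIV. X $ a * Y $ p * Z $ q * B a x $ p $ q)"
      by (simp add: inner_vec_def matrix_vector_mult_def sum_distrib_left sum_distrib_right mult_ac)
    also have "\<dots> = (\<Sum>p\<in>UNIV. \<Sum>a\<in>UNIV. \<Sum>q\<in>UNIV. X $ a * Y $ p * Z $ q * B a x $ p $ q)"
      by (intro sum.cong refl sum.swap)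
    also have "\<dots> = (\<Sum>a\<in>UNIV. \<Sum>p\<in>UNIV. \<Sum>q\<in>UNIV. X $ a * Y $ p * Z $ q * B a x $ p $ q)"
      by (rule sum.swap)
    finally show ?thesis .
  qed
  have inner_J: "Y \<bullet> (g x *v (J x *v Z)) = - ((J x *v Y) \<bullet> (g x *v Z))" for Y Z
  proof -
    have "(J x *v Y) \<bullet> (g x *v Z) = Y \<bullet> ((transpose (J x) ** g x) *v Z)"
      using dot_lmul_matrix[of Y "transpose (J x)" "g x *v Z"] by (simp add: matrix_vector_mul_assoc)
    also have "\<dots> = - (Y \<bullet> ((g x ** J x) *v Z))"
      by (simp add: transpose_J_g[OF x]  inner_minus_right matrix_vector_mult_minus_left)
    finally show ?thesis by (simp add: matrix_vector_mul_assoc)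
  qed
  have A_J: "A X *v (J x *v Z) = - (J x *v (A X *v Z))" for X Z
  proof -
    have "A X ** J x = - (J x ** A X)"
      unfolding A_def matrix_sum_scaleR_right matrix_sum_scaleR_left
      using nabla_J_anticommute[OF x] by (simp add: sum_negf)
    then show ?thesis by (simp add: matrix_vector_mul_assoc matrix_vector_mult_minus_left)
  qed
  have N: "A (J x *v X) *v Y - A (J x *v Y) *v X = J x *v (A X *v Y - A Y *v X)" for X Y
  proof -
    have AJ: "(A (J x *v X) *v Y) $ k = (\<Sum>i\<in>UNIV. \<Sum>j\<in>UNIV. \<Sum>l\<in>UNIV. X $ i * Y $ j * (J x $ l $ i * nabla_J l x $ k $ j))" for X Y k
    proof -
      have "(A (J x *v X) *v Y) $ k = (\<Sum>j\<in>UNIV. \<Sum>l\<in>UNIV. \<Sum>i\<in>UNIV. X $ i * Y $ j * (J x $ l $ i * nabla_J l x $ k $ j))"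
        unfolding A_def by (simp add: matrix_vector_mult_def sum_distrib_left sum_distrib_right mult_ac)
      also have "\<dots> = (\<Sum>i\<in>UNIV. \<Sum>j\<in>UNIV. \<Sum>l\<in>UNIV. X $ i * Y $ j * (J x $ l $ i * nabla_J l x $ k $ j))"
        by (rule sum_rotate)
      finally show ?thesis .
    qed
    have JA: "(J x *v (A X *v Y)) $ k = (\<Sum>i\<in>UNIV. \<Sum>j\<in>UNIV. \<Sum>l\<in>UNIV. X $ i * Y $ j * (J x $ k $ l * nabla_J i x $ l $ j))" for X Y k
    proof -
      have "(J x *v (A X *v Y)) $ k = (\<Sum>l\<in>UNIV. \<Sum>j\<in>UNIV. \<Sum>i\<in>UNIV. X $ i * Y $ j * (J x $ k $ l * nabla_J i x $ l $ j))"
        unfolding A_def by (simp add: matrix_vector_mult_def sum_distrib_left sum_distrib_right mult_ac)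
      also have "\<dots> = (\<Sum>i\<in>UNIV. \<Sum>l\<in>UNIV. \<Sum>j\<in>UNIV. X $ i * Y $ j * (J x $ k $ l * nabla_J i x $ l $ j))"
        by (rule sum_rotate)
      also have "\<dots> = (\<Sum>i\<in>UNIV. \<Sum>j\<in>UNIV. \<Sum>l\<in>UNIV. X $ i * Y $ j * (J x $ k $ l * nabla_J i x $ l $ j))"
        by (intro sum.cong refl sum.swap)
      finally show ?thesis .
    qed
    have "(A (J x *v X) *v Y) $ k - (A (J x *v Y) *v X) $ k - ((J x *v (A X *v Y)) $ k - (J x *v (A Y *v X)) $ k) = 0" for k
    proof -
      have 1: "(A (J x *v Y) *v X) $ k = (\<Sum>i\<in>UNIV. \<Sum>j\<in>UNIV. \<Sum>l\<in>UNIV. X $ i * Y $ j * (J x $ l $ j * nabla_J l x $ k $ i))"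
        unfolding AJ by (subst sum.swap) (simp add: mult_ac)
      have 2: "(J x *v (A Y *v X)) $ k = (\<Sum>i\<in>UNIV. \<Sum>j\<in>UNIV. \<Sum>l\<in>UNIV. X $ i * Y $ j * (J x $ k $ l * nabla_J j x $ l $ i))"
        unfolding JA by (subst sum.swap) (simp add: mult_ac)
      have "(A (J x *v X) *v Y) $ k - (A (J x *v Y) *v X) $ k - ((J x *v (A X *v Y)) $ k - (J x *v (A Y *v X)) $ k)
        = (\<Sum>i\<in>UNIV. \<Sum>j\<in>UNIV. X $ i * Y $ j * (\<Sum>l\<in>UNIV. J x $ l $ i * nabla_J l x $ k $ j - J x $ l $ j * nabla_J l x $ k $ i
     - J x $ k $ l * (nabla_J i x $ l $ j - nabla_J j x $ l $ i)))"
        unfolding 1 2 AJ[of X Y] JA[of X Y]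
        by (simp add: sum_distrib_left right_diff_distrib sum_subtractf)
      then show ?thesis by (simp add: nabla_J_integrable[OF x])
    qed
    then show ?thesis by (simp add: vec_eq_iff matrix_vector_mult_diff_distrib)
  qed
  have "b X Y (?J Z) = 0" for X Y Z
  proof (rule almost_kaehler_torsion_algebra[of b ?J])
    show "b X Y Z = - b X Z Y" for X Y Z
      unfolding b_sum by (subst B_skew[OF x], subst (2) sum.swap) (simp add: sum_negf mult_ac)
    show "b X (?J Y) Z = b X Y (?J Z)" for X Y Z
      using inner_J[of Y "A X *v Z"] by (simp add: b_def A_J inner_minus_right matrix_vector_mult_minus_right)
    show "b (?J X) Z Y + b X (?J Z) Y = b (?J Y) Z X + b Y (?J Z) X" for X Y Z
    proof -
      have "Z \<bullet> (g x *v (A (?J X) *v Y)) - Z \<bullet> (g x *v (A (?J Y) *v X)) = Z \<bullet> (g x *v (J x *v (A X *v Y - A Y *v X)))"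
        unfolding N[symmetric] by (simp add: inner_diff_right matrix_vector_mult_diff_distrib)
      then show ?thesis unfolding inner_J b_def
        by (simp add: inner_diff_right matrix_vector_mult_diff_distrib algebra_simps)
    qed
    show "b X Y Z + b Y Z X + b Z X Y = 0" for X Y Z
    proof -
      have 1: "b Y Z X = (\<Sum>a\<in>UNIV. \<Sum>p\<in>UNIV. \<Sum>q\<in>UNIV. X $ a * Y $ p * Z $ q * B p x $ q $ a)"
        unfolding b_sum by (subst sum_rotate) (simp add: mult_ac)
      have 2: "b Z X Y = (\<Sum>a\<in>UNIV. \<Sum>p\<in>UNIV. \<Sum>q\<in>UNIV. X $ a * Y $ p * Z $ q * B q x $ a $ p)"
        unfolding b_sum by (subst sum_rotate[symmetric]) (simp add: mult_ac)
      show ?thesis unfolding 1 2 b_sum[of X Y Z]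
        by (simp add: B_closed[OF x] flip: sum.distrib distrib_left)
    qed
  qed
  \<comment> \<open>\<open>J\<close> is onto, so vanishing on all \<open>J Z\<close> is vanishing on
    all vectors.\<close>
  moreover have "?J (- ?J Z) = Z" for Z
    by (simp add: matrix_vector_mult_minus_right matrix_vector_mult_minus_left matrix_vector_mul_assoc J_sq[OF x])
  ultimately have "b X Y Z = 0" for X Y Z by metis
  then have "g x ** A X = 0" for X
    by (intro matrix_entries_inner) (simp add: b_def flip: matrix_vector_mul_assoc)
  then have "A X = 0" for X
    using matrix_left_cancel[OF metric_on_invertible[OF g x], of "A X" 0] by simp
  moreover have "A (axis a 1) = nabla_J a x"
    unfolding A_def axis_def by (simp add: if_distrib[of "\<lambda>t. t *\<^sub>R _"] cong: if_cong)
  ultimately show ?thesis by metis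
qed

text \<open>A parallel \<open>J\<close> is a gauge transformation of the connection to itself, so
  \<open>curvature_gauge\<close> applies with both connections equal.\<close>

theorem curvature_commutes_J:
  assumes x: "x \<in> U"
  shows "J x ** curvature g i j x = curvature g i j x ** J x"
  unfolding curvature_def
proof (rule curvature_gauge[OF J matrix_Cinf_on_connection[OF g] matrix_Cinf_on_connection[OF g] metric_on_open[OF g] x])
  show "J y ** connection_matrix g a y = matrix_partial a J y + connection_matrix g a y ** J y" if "y \<in> U" for a y
    using nabla_J_zero[OF that, of a] by (simp add: nabla_J_def)
qed

end

section \<open>Second-order jets and curvature at a point\<close>

text \<open>Value, gradient and Hessian as explicit functions of the indices, so that jets of sums,
  products and compositions follow by rules. Smoothness near the point is included because second
  derivatives there depend on first derivatives nearby.\<close>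

definition jet2 :: "(real^'n::finite \<Rightarrow> real) \<Rightarrow> real^'n \<Rightarrow> real \<Rightarrow> ('n \<Rightarrow> real) \<Rightarrow> ('n \<Rightarrow> 'n \<Rightarrow> real) \<Rightarrow> bool" where
  "jet2 f x f0 f1 f2 \<longleftrightarrow> (\<exists>U. x \<in> U \<and> Cinf_on U f) \<and> f x = f0 \<and> (\<forall>i. partial i f x = f1 i) \<and>
     (\<forall>i j. partial i (partial j f) x = f2 i j)"

lemma jet2_const: "jet2 (\<lambda>_. c) x c (\<lambda>_. 0) (\<lambda>_ _. 0)"
proof -
  have "partial j (\<lambda>_. c) = (\<lambda>_. 0)" for j :: 'a by (rule ext) simp
  then show ?thesis unfolding jet2_def using Cinf_on_const[of UNIV c] by auto
qed

lemma jet2_coordinate: "jet2 (\<lambda>y. y $ a) x (x $ a) (\<lambda>i. if i = a then 1 else 0) (\<lambda>_ _. 0)"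
proof -
  have "partial j (\<lambda>y. y $ a) = (\<lambda>_. if j = a then 1 else 0)" for j :: 'a
    by (rule ext) (simp add: partial_coordinate)
  then show ?thesis unfolding jet2_def using Cinf_on_coordinate[of UNIV a] by auto
qed

lemma jet2_commonE:
  assumes "jet2 f x f0 f1 f2" "jet2 g x g0 g1 g2"
  obtains U where "x \<in> U" "Cinf_on U f" "Cinf_on U g"
proof -
  obtain U V where "x \<in> U" "Cinf_on U f" "x \<in> V" "Cinf_on V g" using assms unfolding jet2_def by blast
  then show thesis
    by (intro that[of "U \<inter> V"]) (auto intro: Cinf_on_subset dest: Cinf_on_open)
qed

lemma jet2_add:
  assumes f: "jet2 f x f0 f1 f2" and g: "jet2 g x g0 g1 g2"
  shows "jet2 (\<lambda>y. f y + g y) x (f0 + g0) (\<lambda>i. f1 i + g1 i) (\<lambda>i j. f2 i j + g2 i j)"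
proof -
  obtain U where U: "x \<in> U" "Cinf_on U f" "Cinf_on U g" using jet2_commonE[OF f g] .
  have p: "partial j (\<lambda>y. f y + g y) y = partial j f y + partial j g y" if "y \<in> U" for j y
    using that U by (intro partial_add Cinf_on_differentiable)
  have "partial i (partial j (\<lambda>y. f y + g y)) x = partial i (partial j f) x + partial i (partial j g) x" for i j
    using partial_cong[OF Cinf_on_open[OF U(2)] U(1) p, of "\<lambda>y. y" i]
      partial_add[of "partial j f" x "partial j g" i] Cinf_on_partial[OF U(2)] Cinf_on_partial[OF U(3)]
      Cinf_on_differentiable[OF _ U(1)] by simp
  then show ?thesis using f g p[OF U(1)] Cinf_on_add[OF U(2,3)] U(1) unfolding jet2_def by auto
qed

lemma jet2_mult:
  assumes f: "jet2 f x f0 f1 f2" and g: "jet2 g x g0 g1 g2"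
  shows "jet2 (\<lambda>y. f y * g y) x (f0 * g0) (\<lambda>i. f1 i * g0 + f0 * g1 i)
    (\<lambda>i j. f2 i j * g0 + f1 j * g1 i + f1 i * g1 j + f0 * g2 i j)"
proof -
  obtain U where U: "x \<in> U" "Cinf_on U f" "Cinf_on U g" using jet2_commonE[OF f g] .
  have p: "partial j (\<lambda>y. f y * g y) y = partial j f y * g y + f y * partial j g y" if "y \<in> U" for j y
    using that U by (intro partial_mult Cinf_on_differentiable)
  have "partial i (partial j (\<lambda>y. f y * g y)) x = partial i (\<lambda>y. partial j f y * g y + f y * partial j g y) x" for i j
    by (rule partial_cong[OF Cinf_on_open[OF U(2)] U(1) p])
  also have "\<dots> i j = partial i (partial j f) x * g x + partial j f x * partial i g x
      + (partial i f x * partial j g x + f x * partial i (partial j g) x)" for i j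
    using Cinf_on_partial[OF U(2)] Cinf_on_partial[OF U(3)] Cinf_on_differentiable[OF _ U(1)] U
    by (simp add: partial_add partial_mult differentiable_mult)
  finally have "partial i (partial j (\<lambda>y. f y * g y)) x = partial i (partial j f) x * g x + partial j f x * partial i g x
      + (partial i f x * partial j g x + f x * partial i (partial j g) x)" for i j .
  then show ?thesis using f g p[OF U(1)] Cinf_on_mult[OF U(2,3)] U(1) unfolding jet2_def by auto
qed

text \<open>\<open>h\<close> is a function of one variable known through its derivatives near
  \<open>f0\<close>. Smoothness of the composite enters as a hypothesis of its own; for functions of
  \<open>momentum\<close> the bootstrap supplies it.\<close>

lemma jet2_compose:
  assumes f: "jet2 f x f0 f1 f2" and c: "Cinf_on U (\<lambda>y. h (f y))" "x \<in> U"
    and I: "open I" "f0 \<in> I" and h': "\<And>r. r \<in> I \<Longrightarrow> (h has_real_derivative h' r) (at r)"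
    and h'': "(h' has_real_derivative h'') (at f0)"
  shows "jet2 (\<lambda>y. h (f y)) x (h f0) (\<lambda>i. h' f0 * f1 i) (\<lambda>i j. h'' * f1 i * f1 j + h' f0 * f2 i j)"
proof -
  obtain V where V: "x \<in> V" "Cinf_on V f" using f unfolding jet2_def by blast
  have f0: "f x = f0" using f by (simp add: jet2_def)
  define W where "W = {y \<in> V. f y \<in> I}"
  have W: "open W"
    using continuous_open_preimage[OF Cinf_on_continuous[OF V(2)] Cinf_on_open[OF V(2)] I(1)]
    by (simp add: W_def vimage_def Int_def)
  have xW: "x \<in> W" using V I f0 by (simp add: W_def)
  have p: "partial j (\<lambda>y. h (f y)) y = h' (f y) * partial j f y" if "y \<in> W" for j y
    using that V h' by (intro partial_chain1 Cinf_on_differentiable[of V]) (auto simp: W_def)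
  have d: "f differentiable at x" "partial j f differentiable at x" for j
    using V Cinf_on_partial Cinf_on_differentiable by blast+
  have d': "(\<lambda>y. h' (f y)) differentiable at x"
  proof -
    obtain D where "(f has_derivative D) (at x)" using d(1) differentiable_def by blast
    then show ?thesis using has_derivative_compose[of f D x UNIV h' "\<lambda>t. h'' * t"] h'' f0
      unfolding differentiable_def has_field_derivative_def by auto
  qed
  have "partial i (partial j (\<lambda>y. h (f y))) x = partial i (\<lambda>y. h' (f y) * partial j f y) x" for i j
    by (rule partial_cong[OF W xW p])
  also have "\<dots> i j = h'' * partial i f x * partial j f x + h' f0 * partial i (partial j f) x" for i j
    using partial_chain1[OF d(1), of h' h'' i] h'' f0 by (simp add: partial_mult[OF d' d(2)])
  finally have "partial i (partial j (\<lambda>y. h (f y))) x = h'' * partial i f x * partial j f x + h' f0 * partial i (partial j f) x" for i j .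
  then show ?thesis using f p[OF xW] c f0 unfolding jet2_def by auto
qed

lemma jet2_cong:
  "jet2 f x f0 f1 f2 \<Longrightarrow> f0 = g0 \<Longrightarrow> (\<And>i. f1 i = g1 i) \<Longrightarrow> (\<And>i j. f2 i j = g2 i j) \<Longrightarrow> jet2 f x g0 g1 g2"
  by (simp add: jet2_def)

lemma jet2_uminus: "jet2 f x f0 f1 f2 \<Longrightarrow> jet2 (\<lambda>y. - f y) x (- f0) (\<lambda>i. - f1 i) (\<lambda>i j. - f2 i j)"
  using jet2_mult[OF jet2_const[of "-1" x]] by (fastforce elim!: jet2_cong)

lemma jet2_diff:
  "jet2 f x f0 f1 f2 \<Longrightarrow> jet2 g x g0 g1 g2 \<Longrightarrow>
   jet2 (\<lambda>y. f y - g y) x (f0 - g0) (\<lambda>i. f1 i - g1 i) (\<lambda>i j. f2 i j - g2 i j)"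
  using jet2_add[OF _ jet2_uminus, of f x f0 f1 f2 g g0 g1 g2] by simp

text \<open>For a metric that is diagonal at the point, raising an index is a division by
  \<open>d\<close>, and the curvature there is an explicit expression in the first and second
  derivatives \<open>g1\<close> and \<open>g2\<close>.\<close>

locale diagonal_jet =
  fixes U :: "(real^'n::finite) set" and g :: "real^'n \<Rightarrow> real^'n^'n" and x :: "real^'n"
    and d :: "'n \<Rightarrow> real" and g1 :: "'n \<Rightarrow> 'n \<Rightarrow> 'n \<Rightarrow> real" and g2 :: "'n \<Rightarrow> 'n \<Rightarrow> 'n \<Rightarrow> 'n \<Rightarrow> real"
  assumes g: "metric_on U g" and x: "x \<in> U"
    and d_pos: "\<And>a. d a > 0"
    and jet: "\<And>a b. jet2 (\<lambda>y. g y $ a $ b) x (if a = b then d a else 0) (g1 a b) (g2 a b)"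
begin

text \<open>Christoffel symbols of the first kind, with the upper index \<open>k\<close>
  lowered.\<close>

definition \<Gamma>l :: "'n \<Rightarrow> 'n \<Rightarrow> 'n \<Rightarrow> real" where
  "\<Gamma>l k i j = (g1 j k i + g1 i k j - g1 i j k) / 2"

text \<open>The derivative in direction \<open>a\<close> of a Christoffel symbol, found by
  differentiating \<open>christoffel_lower\<close> and solving; no derivative of the inverse metric
  occurs.\<close>

definition d\<Gamma> :: "'n \<Rightarrow> 'n \<Rightarrow> 'n \<Rightarrow> 'n \<Rightarrow> real" where
  "d\<Gamma> a k i j = ((g2 j k a i + g2 i k a j - g2 i j a k) / 2 - (\<Sum>r\<in>UNIV. g1 k r a * (\<Gamma>l r i j / d r))) / d k"

lemma g_at: "g x $ a $ b = (if a = b then d a else 0)"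
  and partial_at: "partial c (\<lambda>y. g y $ a $ b) x = g1 a b c"
  and partial2_at: "partial c (partial e (\<lambda>y. g y $ a $ b)) x = g2 a b c e"
  using jet[of a b] by (simp_all add: jet2_def)

lemma sum_g_at: "(\<Sum>k\<in>UNIV. g x $ l $ k * F k) = d l * F l"
proof -
  have "(\<Sum>k\<in>UNIV. g x $ l $ k * F k) = (\<Sum>k\<in>UNIV. if k = l then d l * F l else 0)"
    by (rule sum.cong) (auto simp: g_at)
  then show ?thesis by simp
qed

lemma christoffel_at: "christoffel g k i j x = \<Gamma>l k i j / d k"
  using christoffel_lower[OF g x, of k i j] d_pos[of k] unfolding sum_g_at partial_at
  by (simp add: \<Gamma>l_def field_simps)

lemma partial_christoffel_at: "partial a (christoffel g k i j) x = d\<Gamma> a k i j"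
proof -
  have dg: "(\<lambda>y. g y $ a $ b) differentiable at x" "partial c (\<lambda>y. g y $ a $ b) differentiable at x"
      "christoffel g k i j differentiable at x" for a b c k i j
    using metric_on_Cinf_on[OF g] Cinf_on_christoffel[OF g] Cinf_on_partial Cinf_on_differentiable x by blast+
  have "partial a (\<lambda>y. \<Sum>r\<in>UNIV. g y $ k $ r * christoffel g r i j y) x
    = partial a (\<lambda>y. (partial i (\<lambda>y. g y $ j $ k) y + partial j (\<lambda>y. g y $ i $ k) y - partial k (\<lambda>y. g y $ i $ j) y) * (1 / 2)) x"
    by (rule partial_cong[OF metric_on_open[OF g] x]) (simp add: christoffel_lower[OF g])
  also have "\<dots> = (g2 j k a i + g2 i k a j - g2 i j a k) / 2"
    by (subst partial_mult) (simp_all add: dg differentiable_add differentiable_diff partial_add partial_diff partial2_at)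
  also have "partial a (\<lambda>y. \<Sum>r\<in>UNIV. g y $ k $ r * christoffel g r i j y) x =
     (\<Sum>r\<in>UNIV. g1 k r a * (\<Gamma>l r i j / d r)) + d k * partial a (christoffel g k i j) x"
    by (simp add: partial_sum partial_mult dg differentiable_mult partial_at christoffel_at sum.distrib sum_g_at)
  finally show ?thesis using d_pos[of k] by (simp add: d\<Gamma>_def field_simps)
qed

lemma curvature_at: "curvature g i j x $ k $ l = d\<Gamma> i k j l - d\<Gamma> j k i l
    + (\<Sum>r\<in>UNIV. \<Gamma>l k i r / d k * (\<Gamma>l r j l / d r) - \<Gamma>l k j r / d k * (\<Gamma>l r i l / d r))"
  by (simp add: curvature_def matrix_partial_def connection_matrix_def matrix_matrix_mult_def
      christoffel_at partial_christoffel_at sum_subtractf)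

end

section \<open>The U(2)-invariant metrics on the line bundle\<close>

definition base_norm :: "real^4 \<Rightarrow> real" where
  "base_norm x = 1 + (x$1)\<^sup>2 + (x$2)\<^sup>2"

definition fibre_norm :: "nat \<Rightarrow> real^4 \<Rightarrow> real" where
  "fibre_norm n x = base_norm x ^ n * ((x$3)\<^sup>2 + (x$4)\<^sup>2)"

text \<open>With \<open>h = fibre_norm n\<close> and \<open>E = base_norm\<close>, this is the matrix of
  \<open>A(h) |dz|\<^sup>2 / E\<^sup>2 + b(h) E\<^sup>n |dw + n w z\<^sup>* dz / E|\<^sup>2\<close>.\<close>

definition calabi_z :: "nat \<Rightarrow> (real \<Rightarrow> real) \<Rightarrow> (real \<Rightarrow> real) \<Rightarrow> real^4 \<Rightarrow> real" where
  "calabi_z n A b x = (A (fibre_norm n x) + (real n)\<^sup>2 * (((x$1)\<^sup>2 + (x$2)\<^sup>2) * fibre_norm n x) * b (fibre_norm n x))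
     * inverse ((base_norm x)\<^sup>2)"

definition calabi_w :: "nat \<Rightarrow> (real \<Rightarrow> real) \<Rightarrow> real^4 \<Rightarrow> real" where
  "calabi_w n b x = base_norm x ^ n * b (fibre_norm n x)"

definition calabi_re :: "nat \<Rightarrow> (real \<Rightarrow> real) \<Rightarrow> real^4 \<Rightarrow> real" where
  "calabi_re n b x = real n * base_norm x ^ (n - 1) * b (fibre_norm n x) * (x$3 * x$1 + x$4 * x$2)"

definition calabi_im :: "nat \<Rightarrow> (real \<Rightarrow> real) \<Rightarrow> real^4 \<Rightarrow> real" where
  "calabi_im n b x = real n * base_norm x ^ (n - 1) * b (fibre_norm n x) * (x$4 * x$1 - x$3 * x$2)"

definition calabi :: "nat \<Rightarrow> (real \<Rightarrow> real) \<Rightarrow> (real \<Rightarrow> real) \<Rightarrow> real^4 \<Rightarrow> real^4^4" where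
  "calabi n A b x = (\<chi> i j.
     if i = j then (if i = 1 \<or> i = 2 then calabi_z n A b x else calabi_w n b x)
     else if {i, j} = {1, 3} \<or> {i, j} = {2, 4} then calabi_re n b x
     else if {i, j} = {1, 4} then calabi_im n b x
     else if {i, j} = {2, 3} then - calabi_im n b x
     else 0)"

lemma calabi_entries:
  "calabi n A b x $ 1 $ 1 = calabi_z n A b x" "calabi n A b x $ 1 $ 2 = 0"
  "calabi n A b x $ 1 $ 3 = calabi_re n b x" "calabi n A b x $ 1 $ 4 = calabi_im n b x"
  "calabi n A b x $ 2 $ 1 = 0" "calabi n A b x $ 2 $ 2 = calabi_z n A b x"
  "calabi n A b x $ 2 $ 3 = - calabi_im n b x" "calabi n A b x $ 2 $ 4 = calabi_re n b x"
  "calabi n A b x $ 3 $ 1 = calabi_re n b x" "calabi n A b x $ 3 $ 2 = - calabi_im n b x"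
  "calabi n A b x $ 3 $ 3 = calabi_w n b x" "calabi n A b x $ 3 $ 4 = 0"
  "calabi n A b x $ 4 $ 1 = calabi_im n b x" "calabi n A b x $ 4 $ 2 = calabi_re n b x"
  "calabi n A b x $ 4 $ 3 = 0" "calabi n A b x $ 4 $ 4 = calabi_w n b x"
  by (simp_all add: calabi_def doubleton_eq_iff)

definition z_of :: "real^4 \<Rightarrow> complex" where "z_of x = Complex (x$1) (x$2)"
definition w_of :: "real^4 \<Rightarrow> complex" where "w_of x = Complex (x$3) (x$4)"

lemma base_norm_complex: "base_norm x = 1 + (cmod (z_of x))\<^sup>2"
  by (simp add: base_norm_def z_of_def cmod_power2)

lemma fibre_norm_complex: "fibre_norm n x = base_norm x ^ n * (cmod (w_of x))\<^sup>2"
  by (simp add: fibre_norm_def w_of_def cmod_power2)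

lemma base_norm_pos: "base_norm x > 0" 
  by (simp add: base_norm_def add_pos_nonneg)

lemma fibre_norm_nonneg: "fibre_norm n x \<ge> 0"
  using base_norm_pos[of x] by (simp add: fibre_norm_def)

text \<open>The connection form of the Chern connection of the Hermitian norm
  \<open>fibre_norm\<close>, evaluated on \<open>u\<close>: it is \<open>w\<close> times the
  (1,0)-part of the differential of \<open>log h\<close>.\<close>

definition vertical :: "nat \<Rightarrow> real^4 \<Rightarrow> real^4 \<Rightarrow> complex" where
  "vertical n x u = w_of u + of_nat n * w_of x * cnj (z_of x) * z_of u / of_real (base_norm x)"

text \<open>The two terms are a multiple of the Fubini-Study metric and of the squared vertical
  part; positivity and U(2)-invariance are read off from this form.\<close>

lemma calabi_inner:
  assumes "n \<ge> 1"
  shows "u \<bullet> (calabi n A b x *v v) = A (fibre_norm n x) / (base_norm x)\<^sup>2 * Re (z_of u * cnj (z_of v))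
    + base_norm x ^ n * b (fibre_norm n x) * Re (vertical n x u * cnj (vertical n x v))"
proof -
  define E where "E = base_norm x"
  define B where "B = b (fibre_norm n x)"
  define e where "e = E ^ (n - 1)"
  have E: "E > 0" using base_norm_pos[of x] by (simp add: E_def)
  have En: "E ^ n = E * e" using assms by (cases n) (auto simp: e_def)
  have h: "fibre_norm n x = E * e * ((x$3)\<^sup>2 + (x$4)\<^sup>2)" using En by (simp add: fibre_norm_def E_def)
  have v: "vertical n x u = Complex (u$3 + n * (x$3 * x$1 + x$4 * x$2) / E * u$1 - n * (x$4 * x$1 - x$3 * x$2) / E * u$2)
     (u$4 + n * (x$3 * x$1 + x$4 * x$2) / E * u$2 + n * (x$4 * x$1 - x$3 * x$2) / E * u$1)" for u
    using E by (simp add: vertical_def z_of_def w_of_def complex_eq_iff E_def[symmetric] Re_divide Im_divide power2_eq_square field_simps)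
  \<comment> \<open>\<open>c\<close> and \<open>s\<close> are the real and imaginary parts of
    \<open>n w cnj(z) / E\<close>, the coefficient of \<open>dz\<close> in the vertical
    form.\<close>
  define c where "c = (real n * (x$3 * x$1 + x$4 * x$2)) / E"
  define s where "s = (real n * (x$4 * x$1 - x$3 * x$2)) / E"
  have re: "calabi_re n b x = E * e * B * c" and im: "calabi_im n b x = E * e * B * s"
    and w: "calabi_w n b x = E * e * B"
    using E by (simp_all add: calabi_re_def calabi_im_def calabi_w_def E_def[symmetric] B_def[symmetric] e_def[symmetric, simplified] En c_def s_def)
  have cs: "c\<^sup>2 + s\<^sup>2 = (real n)\<^sup>2 * (((x$1)\<^sup>2 + (x$2)\<^sup>2) * ((x$3)\<^sup>2 + (x$4)\<^sup>2)) / E\<^sup>2"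
    unfolding c_def s_def power_divide add_divide_distrib[symmetric] by (simp add: power2_eq_square algebra_simps)
  have z: "calabi_z n A b x = A (fibre_norm n x) / E\<^sup>2 + E * e * B * (c\<^sup>2 + s\<^sup>2)"
    unfolding cs calabi_z_def B_def[symmetric] E_def[symmetric] using h by (simp add: algebra_simps divide_inverse)
  show ?thesis
    unfolding v En[unfolded E_def] E_def[symmetric] B_def[symmetric]
    by (simp add: inner_vec_def matrix_vector_mult_def sum_4 calabi_entries z re im w z_of_def
        c_def[symmetric] s_def[symmetric] En)
       (simp add: power2_eq_square algebra_simps add_divide_distrib)
qed

lemma calabi_sym: "transpose (calabi n A b x) = calabi n A b x"
  by (simp add: transpose_def vec_eq_iff forall_4 calabi_entries)

lemma calabi_pos:
  assumes "n \<ge> 1" "A (fibre_norm n x) > 0" "b (fibre_norm n x) > 0" "u \<noteq> 0"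
  shows "u \<bullet> (calabi n A b x *v u) > 0"
proof -
  have c: "Re (c * cnj c) = (cmod c)\<^sup>2" for c unfolding cmod_power2 by (simp add: power2_eq_square)
  have "z_of u \<noteq> 0 \<or> (z_of u = 0 \<and> vertical n x u \<noteq> 0)"
    using assms(4) by (auto simp: vertical_def z_of_def w_of_def vec_eq_iff forall_4 complex_eq_iff)
  then show ?thesis unfolding calabi_inner[OF assms(1)] c using assms(2,3) base_norm_pos[of x]
    by (elim disjE) (auto intro!: add_pos_nonneg)
qed

lemma Cinf_on_base_norm: "open U \<Longrightarrow> Cinf_on U base_norm"
  unfolding base_norm_def[abs_def] by (intro Cinf_on_intros)

lemma Cinf_on_fibre_norm: "open U \<Longrightarrow> Cinf_on U (fibre_norm n)"
  unfolding fibre_norm_def[abs_def] by (intro Cinf_on_intros Cinf_on_base_norm)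

lemma metric_on_calabi:
  assumes n: "n \<ge> 1" and A: "Cinf_on U (\<lambda>x. A (fibre_norm n x))" and b: "Cinf_on U (\<lambda>x. b (fibre_norm n x))"
    and pos: "\<And>x. x \<in> U \<Longrightarrow> A (fibre_norm n x) > 0 \<and> b (fibre_norm n x) > 0"
  shows "metric_on U (calabi n A b)"
proof -
  have U: "open U" using A Cinf_on_open by blast
  note si = Cinf_on_intros Cinf_on_inverse A b U Cinf_on_base_norm Cinf_on_fibre_norm
  have E0: "(base_norm x)\<^sup>2 \<noteq> 0" for x using base_norm_pos[of x] by simp
  have s: "Cinf_on U (calabi_z n A b)" "Cinf_on U (calabi_w n b)" "Cinf_on U (calabi_re n b)" "Cinf_on U (calabi_im n b)"
    unfolding calabi_z_def[abs_def] calabi_w_def[abs_def] calabi_re_def[abs_def] calabi_im_def[abs_def]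
    by (intro si E0)+
  have "Cinf_on U (\<lambda>x. calabi n A b x $ i $ j)" for i j
  proof -
    have "\<forall>i j. Cinf_on U (\<lambda>x. calabi n A b x $ i $ j)"
      unfolding forall_4 calabi_entries using s U by (auto intro: Cinf_on_minus Cinf_on_const)
    then show ?thesis by blast
  qed
  then show ?thesis using U calabi_sym calabi_pos[OF n] pos by (simp add: metric_on_def)
qed

section \<open>Second-order jets of the metrics at base points\<close>

definition base_point :: "real \<Rightarrow> real^4" where "base_point t = vector [0, 0, t, 0]"

lemma base_point_entries: "base_point t $ 1 = 0" "base_point t $ 2 = 0" "base_point t $ 3 = t" "base_point t $ 4 = 0"
  by (simp_all add: base_point_def vector_4)

lemma fibre_norm_base_point: "fibre_norm n (base_point t) = t\<^sup>2"
  by (simp add: base_norm_def fibre_norm_def base_point_entries)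

lemma jet2_base_norm_power:
  "jet2 (\<lambda>y. base_norm y ^ k) (base_point t) 1 (\<lambda>_. 0)
     (\<lambda>i j. if i = j \<and> (i = 1 \<or> i = 2) then 2 * real k else 0)"
proof (induction k)
  case 0
  show ?case unfolding power_0 by (rule jet2_cong[OF jet2_const]) auto
next
  case (Suc k)
  have E: "jet2 base_norm (base_point t) 1 (\<lambda>_. 0) (\<lambda>i j. if i = j \<and> (i = 1 \<or> i = 2) then 2 else 0)"
    unfolding base_norm_def[abs_def] power2_eq_square
    by (rule jet2_cong[OF jet2_add[OF jet2_add[OF jet2_const jet2_mult[OF jet2_coordinate jet2_coordinate]]
          jet2_mult[OF jet2_coordinate jet2_coordinate]]]) (auto simp: base_point_entries)
  show ?case unfolding power_Suc by (rule jet2_cong[OF jet2_mult[OF E Suc]]) auto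
qed

lemma jet2_fibre_norm:
  "jet2 (fibre_norm n) (base_point t) (t\<^sup>2) (\<lambda>i. if i = 3 then 2 * t else 0)
     (\<lambda>i j. if i = j then (if i = 1 \<or> i = 2 then 2 * real n * t\<^sup>2 else 2) else 0)"
  unfolding fibre_norm_def[abs_def] power2_eq_square
proof (rule jet2_cong[OF jet2_mult[OF jet2_base_norm_power jet2_add[OF jet2_mult[OF jet2_coordinate jet2_coordinate]
          jet2_mult[OF jet2_coordinate jet2_coordinate]]]], goal_cases)
  case (3 i j)
  then show ?case using exhaust_4[of i] exhaust_4[of j] by (auto simp: base_point_entries)
qed (auto simp: base_point_entries)

text \<open>\<open>A1\<close> and \<open>b1\<close> are derivatives on an open set of fibre norms,
  while \<open>A2\<close> and \<open>b2\<close> are only numbers, the second derivatives at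
  \<open>t^2\<close>: a 2-jet asks for no more.\<close>

locale calabi_base_point =
  fixes n :: nat and A b :: "real \<Rightarrow> real" and U :: "(real^4) set" and I :: "real set" and t :: real
    and A1 b1 :: "real \<Rightarrow> real" and A2 b2 :: real
  assumes n: "n \<ge> 1"
    and A_smooth: "Cinf_on U (\<lambda>x. A (fibre_norm n x))" and b_smooth: "Cinf_on U (\<lambda>x. b (fibre_norm n x))"
    and pos: "\<And>x. x \<in> U \<Longrightarrow> A (fibre_norm n x) > 0 \<and> b (fibre_norm n x) > 0"
    and t: "base_point t \<in> U" and I: "open I" "t\<^sup>2 \<in> I"
    and A1: "\<And>r. r \<in> I \<Longrightarrow> (A has_real_derivative A1 r) (at r)"
    and b1: "\<And>r. r \<in> I \<Longrightarrow> (b has_real_derivative b1 r) (at r)"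
    and A2: "(A1 has_real_derivative A2) (at (t\<^sup>2))" and b2: "(b1 has_real_derivative b2) (at (t\<^sup>2))"
begin

abbreviation "X \<equiv> t\<^sup>2"

lemma jet2_A: "jet2 (\<lambda>x. A (fibre_norm n x)) (base_point t) (A X) (\<lambda>i. if i = 3 then 2 * t * A1 X else 0)
    (\<lambda>i j. if i = j then (if i = 1 \<or> i = 2 then 2 * real n * X * A1 X
      else if i = 3 then 4 * X * A2 + 2 * A1 X else 2 * A1 X) else 0)"
proof (rule jet2_cong[OF jet2_compose[OF jet2_fibre_norm A_smooth t I A1 A2]], goal_cases)
  case (4 i j)
  then show ?case using exhaust_4[of i] exhaust_4[of j] by (auto simp: power2_eq_square)
qed auto

lemma jet2_b: "jet2 (\<lambda>x. b (fibre_norm n x)) (base_point t) (b X) (\<lambda>i. if i = 3 then 2 * t * b1 X else 0)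
    (\<lambda>i j. if i = j then (if i = 1 \<or> i = 2 then 2 * real n * X * b1 X
      else if i = 3 then 4 * X * b2 + 2 * b1 X else 2 * b1 X) else 0)"
proof (rule jet2_cong[OF jet2_compose[OF jet2_fibre_norm b_smooth t I b1 b2]], goal_cases)
  case (4 i j)
  then show ?case using exhaust_4[of i] exhaust_4[of j] by (auto simp: power2_eq_square)
qed auto

lemma jet2_calabi_w: "jet2 (calabi_w n b) (base_point t) (b X) (\<lambda>i. if i = 3 then 2 * t * b1 X else 0)
    (\<lambda>i j. if i = j then (if i = 1 \<or> i = 2 then 2 * real n * b X + 2 * real n * X * b1 X
      else if i = 3 then 4 * X * b2 + 2 * b1 X else 2 * b1 X) else 0)"
  unfolding calabi_w_def[abs_def]
proof (rule jet2_cong[OF jet2_mult[OF jet2_base_norm_power jet2_b]], goal_cases)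
  case (3 i j)
  then show ?case using exhaust_4[of i] exhaust_4[of j] by auto
qed auto

lemma jet2_calabi_z: "jet2 (calabi_z n A b) (base_point t) (A X) (\<lambda>i. if i = 3 then 2 * t * A1 X else 0)
    (\<lambda>i j. if i = j then (if i = 1 \<or> i = 2 then 2 * real n * X * A1 X - 4 * A X + 2 * (real n)\<^sup>2 * X * b X
      else if i = 3 then 4 * X * A2 + 2 * A1 X else 2 * A1 X) else 0)"
proof -
  have E: "jet2 (\<lambda>y. inverse ((base_norm y)\<^sup>2)) (base_point t) 1 (\<lambda>_. 0)
     (\<lambda>i j. if i = j \<and> (i = 1 \<or> i = 2) then - 4 else 0)"
  proof (rule jet2_cong[OF jet2_compose[OF jet2_base_norm_power[of 2], where U = UNIV and h = inverse and I = "{0<..}" and h' = "\<lambda>r. - (inverse r * inverse r)" and h'' = 2]], goal_cases)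
    case 1 show ?case using base_norm_pos by (intro Cinf_on_inverse Cinf_on_power Cinf_on_base_norm) (auto simp: less_le)
  next
    case (5 r) then show ?case using DERIV_inverse[of r UNIV] by (simp add: power2_eq_square)
  next
    case 6 show ?case by (auto intro!: derivative_eq_intros)
  qed auto
  have *: "jet2 (\<lambda>x. (real n)\<^sup>2 * ((x$1 * x$1 + x$2 * x$2) * fibre_norm n x) * b (fibre_norm n x)) (base_point t) 0 (\<lambda>_. 0)
    (\<lambda>i j. if i = j \<and> (i = 1 \<or> i = 2) then 2 * (real n)\<^sup>2 * X * b X else 0)"
  proof (rule jet2_cong[OF jet2_mult[OF jet2_mult[OF jet2_const jet2_mult[OF jet2_add[OF jet2_mult[OF jet2_coordinate jet2_coordinate]
          jet2_mult[OF jet2_coordinate jet2_coordinate]] jet2_fibre_norm]] jet2_b]], goal_cases)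
    case (3 i j)
    then show ?case using exhaust_4[of i] exhaust_4[of j] by (auto simp: base_point_entries)
  qed (auto simp: base_point_entries)
  have **: "calabi_z n A b = (\<lambda>x. (A (fibre_norm n x) + (real n)\<^sup>2 * ((x$1 * x$1 + x$2 * x$2) * fibre_norm n x) * b (fibre_norm n x))
     * inverse ((base_norm x)\<^sup>2))" by (simp add: calabi_z_def[abs_def] power2_eq_square)
  show ?thesis unfolding **
  proof (rule jet2_cong[OF jet2_mult[OF jet2_add[OF jet2_A *] E]], goal_cases)
    case (3 i j)
    then show ?case using exhaust_4[of i] exhaust_4[of j] by auto
  qed auto
qed

lemma jet2_calabi_re: "jet2 (calabi_re n b) (base_point t) 0 (\<lambda>i. if i = 1 then real n * b X * t else 0)
    (\<lambda>i j. if {i, j} = {1, 3} then real n * (b X + 2 * X * b1 X) else if {i, j} = {2, 4} then real n * b X else 0)"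
  unfolding calabi_re_def[abs_def]
proof (rule jet2_cong[OF jet2_mult[OF jet2_mult[OF jet2_mult[OF jet2_const jet2_base_norm_power] jet2_b]
      jet2_add[OF jet2_mult[OF jet2_coordinate jet2_coordinate] jet2_mult[OF jet2_coordinate jet2_coordinate]]]], goal_cases)
  case (2 i)
  then show ?case using exhaust_4[of i] by (auto simp: base_point_entries)
next
  case (3 i j)
  then show ?case using exhaust_4[of i] exhaust_4[of j]
    by (elim disjE) (simp_all add: base_point_entries doubleton_eq_iff power2_eq_square algebra_simps)
qed (auto simp: base_point_entries)

lemma jet2_calabi_im: "jet2 (calabi_im n b) (base_point t) 0 (\<lambda>i. if i = 2 then - (real n * b X * t) else 0)
    (\<lambda>i j. if {i, j} = {1, 4} then real n * b X else if {i, j} = {2, 3} then - (real n * (b X + 2 * X * b1 X)) else 0)"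
  unfolding calabi_im_def[abs_def]
proof (rule jet2_cong[OF jet2_mult[OF jet2_mult[OF jet2_mult[OF jet2_const jet2_base_norm_power] jet2_b]
      jet2_diff[OF jet2_mult[OF jet2_coordinate jet2_coordinate] jet2_mult[OF jet2_coordinate jet2_coordinate]]]], goal_cases)
  case (2 i)
  then show ?case using exhaust_4[of i] by (auto simp: base_point_entries)
next
  case (3 i j)
  then show ?case using exhaust_4[of i] exhaust_4[of j]
    by (elim disjE) (simp_all add: base_point_entries doubleton_eq_iff power2_eq_square algebra_simps)
qed (auto simp: base_point_entries)

definition g1 :: "4 \<Rightarrow> 4 \<Rightarrow> 4 \<Rightarrow> real" where
  "g1 a c i = (if a = c then (if i = 3 then 2 * t * (if a = 1 \<or> a = 2 then A1 X else b1 X) else 0)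
    else if i = 1 \<and> ({a, c} = {1, 3} \<or> {a, c} = {2, 4}) then real n * b X * t
    else if i = 2 \<and> {a, c} = {1, 4} then - (real n * b X * t)
    else if i = 2 \<and> {a, c} = {2, 3} then real n * b X * t else 0)"

definition g2 :: "4 \<Rightarrow> 4 \<Rightarrow> 4 \<Rightarrow> 4 \<Rightarrow> real" where
  "g2 a c i j = (if a = c then
      (if i = j then
        (if a = 1 \<or> a = 2 then
          (if i = 1 \<or> i = 2 then 2 * real n * X * A1 X - 4 * A X + 2 * (real n)\<^sup>2 * X * b X
           else if i = 3 then 4 * X * A2 + 2 * A1 X else 2 * A1 X)
        else
          (if i = 1 \<or> i = 2 then 2 * real n * b X + 2 * real n * X * b1 X
           else if i = 3 then 4 * X * b2 + 2 * b1 X else 2 * b1 X))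
       else 0)
    else if {a, c} = {1, 3} \<or> {a, c} = {2, 4} then
      (if {i, j} = {1, 3} then real n * (b X + 2 * X * b1 X) else if {i, j} = {2, 4} then real n * b X else 0)
    else if {a, c} = {1, 4} then
      (if {i, j} = {1, 4} then real n * b X else if {i, j} = {2, 3} then - (real n * (b X + 2 * X * b1 X)) else 0)
    else if {a, c} = {2, 3} then
      (if {i, j} = {1, 4} then - (real n * b X) else if {i, j} = {2, 3} then real n * (b X + 2 * X * b1 X) else 0)
    else 0)"

lemma metric: "metric_on U (calabi n A b)"
  by (rule metric_on_calabi[OF n A_smooth b_smooth pos])

lemma calabi_jet:
  "jet2 (\<lambda>y. calabi n A b y $ a $ c) (base_point t)
     (if a = c then if a = 1 \<or> a = 2 then A X else b X else 0) (g1 a c) (g2 a c)"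
proof -
  note zero = jet2_const[of 0 "base_point t"]
  show ?thesis
    using exhaust_4[of a] exhaust_4[of c]
    apply (elim disjE; simp add: calabi_entries)
    apply (rule jet2_cong[OF jet2_calabi_z] jet2_cong[OF jet2_calabi_w] jet2_cong[OF jet2_calabi_re]
          jet2_cong[OF jet2_calabi_im] jet2_cong[OF jet2_uminus[OF jet2_calabi_im]] jet2_cong[OF zero];
        simp add: g1_def g2_def doubleton_eq_iff)+
    done
qed

sublocale diagonal_jet U "calabi n A b" "base_point t" "\<lambda>a. if a = 1 \<or> a = 2 then A X else b X" g1 g2
proof
  show "metric_on U (calabi n A b)" by (rule metric)
  show "base_point t \<in> U" by (rule t)
  show "(if a = 1 \<or> a = 2 then A X else b X) > 0" for a :: 4
    using pos[OF t] by (simp add: fibre_norm_base_point)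
  show "jet2 (\<lambda>y. calabi n A b y $ a $ c) (base_point t)
     (if a = c then if a = 1 \<or> a = 2 then A X else b X else 0) (g1 a c) (g2 a c)" for a c
    by (rule calabi_jet)
qed

lemma positive: "A X > 0" "b X > 0"
  using pos[OF t] by (simp_all add: fibre_norm_base_point)

lemma g1_entries:
  "g1 1 1 i = (if i = 3 then 2 * t * A1 X else 0)" "g1 2 2 i = (if i = 3 then 2 * t * A1 X else 0)"
  "g1 3 3 i = (if i = 3 then 2 * t * b1 X else 0)" "g1 4 4 i = (if i = 3 then 2 * t * b1 X else 0)"
  "g1 1 2 i = 0" "g1 2 1 i = 0" "g1 3 4 i = 0" "g1 4 3 i = 0"
  "g1 1 3 i = (if i = 1 then real n * b X * t else 0)" "g1 3 1 i = (if i = 1 then real n * b X * t else 0)"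
  "g1 2 4 i = (if i = 1 then real n * b X * t else 0)" "g1 4 2 i = (if i = 1 then real n * b X * t else 0)"
  "g1 1 4 i = (if i = 2 then - (real n * b X * t) else 0)" "g1 4 1 i = (if i = 2 then - (real n * b X * t) else 0)"
  "g1 2 3 i = (if i = 2 then real n * b X * t else 0)" "g1 3 2 i = (if i = 2 then real n * b X * t else 0)"
  by (simp_all add: g1_def doubleton_eq_iff)

text \<open>Every value is a multiple of \<open>t\<close>, so all of them vanish on the zero
  section.\<close>

lemma \<Gamma>l_values:
  "\<Gamma>l 1 1 1 = 0" "\<Gamma>l 1 1 2 = 0" "\<Gamma>l 1 1 3 = t * A1 X" "\<Gamma>l 1 1 4 = 0"
  "\<Gamma>l 1 2 1 = 0" "\<Gamma>l 1 2 2 = 0" "\<Gamma>l 1 2 3 = 0" "\<Gamma>l 1 2 4 = - (real n * b X * t)"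
  "\<Gamma>l 1 3 1 = t * A1 X" "\<Gamma>l 1 3 2 = 0" "\<Gamma>l 1 3 3 = 0" "\<Gamma>l 1 3 4 = 0"
  "\<Gamma>l 1 4 1 = 0" "\<Gamma>l 1 4 2 = - (real n * b X * t)" "\<Gamma>l 1 4 3 = 0" "\<Gamma>l 1 4 4 = 0"
  "\<Gamma>l 2 1 1 = 0" "\<Gamma>l 2 1 2 = 0" "\<Gamma>l 2 1 3 = 0" "\<Gamma>l 2 1 4 = real n * b X * t"
  "\<Gamma>l 2 2 1 = 0" "\<Gamma>l 2 2 2 = 0" "\<Gamma>l 2 2 3 = t * A1 X" "\<Gamma>l 2 2 4 = 0"
  "\<Gamma>l 2 3 1 = 0" "\<Gamma>l 2 3 2 = t * A1 X" "\<Gamma>l 2 3 3 = 0" "\<Gamma>l 2 3 4 = 0"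
  "\<Gamma>l 2 4 1 = real n * b X * t" "\<Gamma>l 2 4 2 = 0" "\<Gamma>l 2 4 3 = 0" "\<Gamma>l 2 4 4 = 0"
  "\<Gamma>l 3 1 1 = real n * b X * t + - (t * A1 X)" "\<Gamma>l 3 1 2 = 0" "\<Gamma>l 3 1 3 = 0" "\<Gamma>l 3 1 4 = 0"
  "\<Gamma>l 3 2 1 = 0" "\<Gamma>l 3 2 2 = real n * b X * t + - (t * A1 X)" "\<Gamma>l 3 2 3 = 0" "\<Gamma>l 3 2 4 = 0"
  "\<Gamma>l 3 3 1 = 0" "\<Gamma>l 3 3 2 = 0" "\<Gamma>l 3 3 3 = t * b1 X" "\<Gamma>l 3 3 4 = 0"
  "\<Gamma>l 3 4 1 = 0" "\<Gamma>l 3 4 2 = 0" "\<Gamma>l 3 4 3 = 0" "\<Gamma>l 3 4 4 = - (t * b1 X)"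
  "\<Gamma>l 4 1 1 = 0" "\<Gamma>l 4 1 2 = 0" "\<Gamma>l 4 1 3 = 0" "\<Gamma>l 4 1 4 = 0"
  "\<Gamma>l 4 2 1 = 0" "\<Gamma>l 4 2 2 = 0" "\<Gamma>l 4 2 3 = 0" "\<Gamma>l 4 2 4 = 0"
  "\<Gamma>l 4 3 1 = 0" "\<Gamma>l 4 3 2 = 0" "\<Gamma>l 4 3 3 = 0" "\<Gamma>l 4 3 4 = t * b1 X"
  "\<Gamma>l 4 4 1 = 0" "\<Gamma>l 4 4 2 = 0" "\<Gamma>l 4 4 3 = t * b1 X" "\<Gamma>l 4 4 4 = 0"
  by (simp_all add: \<Gamma>l_def g1_entries)

lemmas ricci_simps = ricci_eq_curvature curvature_at d\<Gamma>_def sum_4 \<Gamma>l_values g1_entries g2_def doubleton_eq_iff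

lemma ricci_off_diagonal: "j \<noteq> k \<Longrightarrow> ricci (calabi n A b) (base_point t) $ j $ k = 0"
  using exhaust_4[of j] exhaust_4[of k] positive
  by (elim disjE) (simp_all add: ricci_simps)

lemma ricci_11: "ricci (calabi n A b) (base_point t) $ 1 $ 1 = 4 - 2 * (real n)\<^sup>2 * X * b X / A X - 2 * A1 X / b X - 2 * X * A2 / b X"
  using positive by (simp add: ricci_simps) (simp add: field_simps power2_eq_square)

lemma ricci_22: "ricci (calabi n A b) (base_point t) $ 2 $ 2 = 4 - 2 * (real n)\<^sup>2 * X * b X / A X - 2 * A1 X / b X - 2 * X * A2 / b X"
  using positive by (simp add: ricci_simps) (simp add: field_simps power2_eq_square)

lemma ricci_33: "ricci (calabi n A b) (base_point t) $ 3 $ 3 = - 2 * b1 X / b X - 2 * X * b2 / b X + 2 * X * (b1 X)\<^sup>2 / (b X)\<^sup>2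
   - 2 * A1 X / A X - 4 * X * A2 / A X + 2 * X * (A1 X)\<^sup>2 / (A X)\<^sup>2 + 2 * X * A1 X * b1 X / (A X * b X)"
  using positive by (simp add: ricci_simps) (simp add: field_simps power2_eq_square)

lemma ricci_44: "ricci (calabi n A b) (base_point t) $ 4 $ 4 = - 2 * b1 X / b X - 2 * X * b2 / b X + 2 * X * (b1 X)\<^sup>2 / (b X)\<^sup>2
   - 2 * A1 X / A X - 2 * X * A1 X * b1 X / (A X * b X) + 2 * (real n)\<^sup>2 * X * (b X)\<^sup>2 / (A X)\<^sup>2"
  using positive by (simp add: ricci_simps) (simp add: field_simps power2_eq_square)

end

section \<open>The action of U(2)\<close>

definition complex_Cinf_on :: "(real^'n::finite) set \<Rightarrow> (real^'n \<Rightarrow> complex) \<Rightarrow> bool" where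
  "complex_Cinf_on U f \<longleftrightarrow> Cinf_on U (\<lambda>x. Re (f x)) \<and> Cinf_on U (\<lambda>x. Im (f x))"

lemma complex_Cinf_on_const: "open U \<Longrightarrow> complex_Cinf_on U (\<lambda>_. c)"
  by (simp add: complex_Cinf_on_def Cinf_on_const)

lemma complex_Cinf_on_add:
  "complex_Cinf_on U f \<Longrightarrow> complex_Cinf_on U g \<Longrightarrow> complex_Cinf_on U (\<lambda>x. f x + g x)"
  by (simp add: complex_Cinf_on_def Cinf_on_add)

lemma complex_Cinf_on_mult:
  "complex_Cinf_on U f \<Longrightarrow> complex_Cinf_on U g \<Longrightarrow> complex_Cinf_on U (\<lambda>x. f x * g x)"
  by (simp add: complex_Cinf_on_def Cinf_on_add Cinf_on_diff Cinf_on_mult)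

lemma complex_Cinf_on_power: "complex_Cinf_on U f \<Longrightarrow> complex_Cinf_on U (\<lambda>x. f x ^ k)"
  by (induction k) (auto intro: complex_Cinf_on_mult complex_Cinf_on_const Cinf_on_open simp: complex_Cinf_on_def[of U f])

lemma complex_Cinf_on_divide:
  assumes "complex_Cinf_on U f" "complex_Cinf_on U g" "\<And>x. x \<in> U \<Longrightarrow> g x \<noteq> 0"
  shows "complex_Cinf_on U (\<lambda>x. f x / g x)"
proof -
  have "(Re (g x))\<^sup>2 + (Im (g x))\<^sup>2 \<noteq> 0" if "x \<in> U" for x
    using assms(3)[OF that] by (auto simp: complex_eq_iff)
  then show ?thesis using assms(1,2)
    unfolding complex_Cinf_on_def Re_divide Im_divide
    by (auto intro!: Cinf_on_divide Cinf_on_add Cinf_on_diff Cinf_on_mult Cinf_on_power)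
qed

lemma complex_Cinf_on_z_of: "open U \<Longrightarrow> complex_Cinf_on U z_of"
  and complex_Cinf_on_w_of: "open U \<Longrightarrow> complex_Cinf_on U w_of"
  by (simp_all add: complex_Cinf_on_def z_of_def w_of_def Cinf_on_coordinate)

lemma z_of_complex2: "z_of (complex2_to_real4 (z, w)) = z"
  and w_of_complex2: "w_of (complex2_to_real4 (z, w)) = w"
  and complex2_z_of_w_of: "complex2_to_real4 (z_of x, w_of x) = x"
  by (simp_all add: z_of_def w_of_def complex2_to_real4_def vector_4 vec_eq_iff forall_4)

lemma Cinf_on_complex2:
  assumes "complex_Cinf_on U f" "complex_Cinf_on U g"
  shows "Cinf_on U (\<lambda>x. complex2_to_real4 (f x, g x) $ a)"
proof -
  have "\<forall>a. Cinf_on U (\<lambda>x. complex2_to_real4 (f x, g x) $ a)"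
    using assms by (simp add: forall_4 complex2_to_real4_def vector_4 complex_Cinf_on_def)
  then show ?thesis by blast
qed

lemma has_derivative_z_of [derivative_intros]: "(f has_derivative D) F \<Longrightarrow> ((\<lambda>x. z_of (f x)) has_derivative (\<lambda>u. z_of (D u))) F"
  and has_derivative_w_of [derivative_intros]: "(f has_derivative D) F \<Longrightarrow> ((\<lambda>x. w_of (f x)) has_derivative (\<lambda>u. w_of (D u))) F"
proof -
  have "linear z_of" "linear w_of"
    by (auto intro!: linearI simp: z_of_def w_of_def complex_eq_iff)
  then have "bounded_linear z_of" "bounded_linear w_of" by (simp_all add: linear_conv_bounded_linear)
  then show "(f has_derivative D) F \<Longrightarrow> ((\<lambda>x. z_of (f x)) has_derivative (\<lambda>u. z_of (D u))) F"
    "(f has_derivative D) F \<Longrightarrow> ((\<lambda>x. w_of (f x)) has_derivative (\<lambda>u. w_of (D u))) F"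
    by (auto intro: bounded_linear.has_derivative)
qed

lemma has_derivative_complex2:
  assumes "(f has_derivative D) (at x)" "(g has_derivative D') (at x)"
  shows "((\<lambda>y. complex2_to_real4 (f y, g y)) has_derivative (\<lambda>u. complex2_to_real4 (D u, D' u))) (at x)"
proof -
  have "linear complex2_to_real4"
    by (auto intro!: linearI simp: complex2_to_real4_def vec_eq_iff forall_4 vector_4)
  then have l: "bounded_linear complex2_to_real4" by (simp add: linear_conv_bounded_linear)
  show ?thesis using bounded_linear.has_derivative[OF l has_derivative_Pair[OF assms]] .
qed

lemma jacobian_matrix_works:
  fixes \<phi> :: "real^'n::finite \<Rightarrow> real^'m::finite"
  assumes "(\<phi> has_derivative D) (at x)"
  shows "jacobian_matrix \<phi> x *v u = D u"
proof -
  have "((\<lambda>y. \<phi> y $ a) has_derivative (\<lambda>h. D h $ a)) (at x)" for a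
    using assms by (auto intro!: bounded_linear.has_derivative[OF bounded_linear_vec_nth])
  then have "jacobian_matrix \<phi> x = matrix D"
    by (simp add: jacobian_matrix_def matrix_def vec_eq_iff partial_eq[of "\<lambda>y. \<phi> y $ a" "\<lambda>h. D h $ a" for a])
  then show ?thesis using has_derivative_linear[OF assms] by (simp add: matrix_works)
qed

text \<open>In homogeneous coordinates with \<open>z = v1 / v0\<close> the unitary map multiplies
  \<open>v0\<close> by this factor. As \<open>w\<close> is \<open>v0\<close> on the tautological
  bundle, of which O(-n) is the n-th power, \<open>moebius\<close> multiplies \<open>w\<close> by
  the n-th power of the factor.\<close>

definition moebius_den :: "complex \<Rightarrow> complex \<Rightarrow> complex \<Rightarrow> real^4 \<Rightarrow> complex" where
  "moebius_den a b \<delta> x = \<delta> * (cnj a - cnj b * z_of x)"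

definition moebius :: "nat \<Rightarrow> complex \<Rightarrow> complex \<Rightarrow> complex \<Rightarrow> real^4 \<Rightarrow> real^4" where
  "moebius n a b \<delta> x = complex2_to_real4
     ((a * z_of x + b) / moebius_den a b \<delta> x, moebius_den a b \<delta> x ^ n * w_of x)"

text \<open>The matrix with rows \<open>(a, b)\<close> and \<open>\<delta> (- b\<^sup>*, a\<^sup>*)\<close> is the general unitary matrix.\<close>

locale unitary =
  fixes n :: nat and a b \<delta> :: complex
  assumes n: "n \<ge> 1" and norm_ab: "(cmod a)\<^sup>2 + (cmod b)\<^sup>2 = 1" and norm_\<delta>: "cmod \<delta> = 1"
begin

abbreviation "den \<equiv> moebius_den a b \<delta>"
abbreviation "\<phi> \<equiv> moebius n a b \<delta>"

lemma unitary_complex: "a * cnj a + b * cnj b = 1" "\<delta> * cnj \<delta> = 1"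
proof -
  have "complex_of_real ((cmod a)\<^sup>2 + (cmod b)\<^sup>2) = a * cnj a + b * cnj b" "complex_of_real ((cmod \<delta>)\<^sup>2) = \<delta> * cnj \<delta>"
    by (simp_all only: of_real_add complex_norm_square)
  then show "a * cnj a + b * cnj b = 1" "\<delta> * cnj \<delta> = 1" by (simp_all add: norm_ab norm_\<delta>)
qed

lemma z_of_\<phi>: "z_of (\<phi> x) = (a * z_of x + b) / den x"
  and w_of_\<phi>: "w_of (\<phi> x) = den x ^ n * w_of x"
  by (simp_all add: moebius_def z_of_complex2 w_of_complex2)

text \<open>A unitary map preserves \<open>|v0|^2 + |v1|^2\<close>. For \<open>v0 = 1\<close>,
  \<open>v1 = z\<close> this reads \<open>|den|^2 + |a z + b|^2 = 1 + |z|^2\<close>.\<close>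

lemma base_norm_\<phi>:
  assumes "den x \<noteq> 0"
  shows "base_norm (\<phi> x) * (cmod (den x))\<^sup>2 = base_norm x"
proof -
  have "complex_of_real (base_norm (\<phi> x) * (cmod (den x))\<^sup>2) = den x * cnj (den x) + (a * z_of x + b) * cnj (a * z_of x + b)"
  proof -
    have "base_norm (\<phi> x) * (cmod (den x))\<^sup>2 = (cmod (den x))\<^sup>2 + (cmod (a * z_of x + b))\<^sup>2"
      unfolding base_norm_complex z_of_\<phi> using assms by (simp add: norm_divide power_divide field_simps)
    then show ?thesis by (simp only: of_real_add complex_norm_square)
  qed
  also have "\<dots> = (\<delta> * cnj \<delta>) * ((cnj a - cnj b * z_of x) * (a - b * cnj (z_of x))) + (a * z_of x + b) * (cnj a * cnj (z_of x) + cnj b)"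
    by (simp add: moebius_den_def)
  also have "\<dots> = (a * cnj a + b * cnj b) * (1 + z_of x * cnj (z_of x))"
    unfolding unitary_complex(2) by (simp add: algebra_simps)
  also have "\<dots> = complex_of_real (base_norm x)"
    unfolding unitary_complex base_norm_complex by (simp add: complex_norm_square del: of_real_power)
  finally show ?thesis by (simp only: of_real_eq_iff)
qed

lemma fibre_norm_\<phi>:
  assumes "den x \<noteq> 0"
  shows "fibre_norm n (\<phi> x) = fibre_norm n x"
proof -
  have "fibre_norm n (\<phi> x) = (base_norm (\<phi> x) * (cmod (den x))\<^sup>2) ^ n * (cmod (w_of x))\<^sup>2"
    by (simp add: fibre_norm_complex w_of_\<phi> norm_mult norm_power power_mult_distrib power_mult[symmetric] mult.commute)
  then show ?thesis by (simp add: base_norm_\<phi>[OF assms] fibre_norm_complex)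
qed

lemma derivative_\<phi>:
  assumes "den x \<noteq> 0"
  shows "z_of (jacobian_matrix \<phi> x *v u) = \<delta> * z_of u / (den x)\<^sup>2"
    and "w_of (jacobian_matrix \<phi> x *v u) = den x ^ n * w_of u - of_nat n * \<delta> * cnj b * den x ^ (n - 1) * w_of x * z_of u"
proof -
  have d: "((\<lambda>y. den y) has_derivative (\<lambda>u. - (\<delta> * cnj b * z_of u))) (at x)"
    unfolding moebius_den_def by (auto intro!: derivative_eq_intros)
  have 1: "((\<lambda>y. (a * z_of y + b) / den y) has_derivative
      (\<lambda>u. \<delta> * z_of u / (den x)\<^sup>2)) (at x)"
  proof (rule has_derivative_eq_rhs)
    show "((\<lambda>y. (a * z_of y + b) / den y) has_derivative
      (\<lambda>u. ((a * z_of u) * den x - (a * z_of x + b) * (- (\<delta> * cnj b * z_of u))) / (den x * den x))) (at x)"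
      by (rule has_derivative_divide'[OF _ d assms]) (auto intro!: derivative_eq_intros)
    \<comment> \<open>The numerator of the quotient rule is \<open>z_of u\<close> times the
      determinant of the unitary matrix, which is \<open>\<delta>\<close>.\<close>
    have "(a * z_of u) * den x - (a * z_of x + b) * (- (\<delta> * cnj b * z_of u)) = (a * cnj a + b * cnj b) * \<delta> * z_of u" for u
      by (simp add: moebius_den_def algebra_simps)
    then show "(\<lambda>u. ((a * z_of u) * den x - (a * z_of x + b) * (- (\<delta> * cnj b * z_of u))) / (den x * den x)) = (\<lambda>u. \<delta> * z_of u / (den x)\<^sup>2)"
      by (simp add: unitary_complex power2_eq_square)
  qed
  have 2: "((\<lambda>y. den y ^ n * w_of y) has_derivative
      (\<lambda>u. den x ^ n * w_of u - of_nat n * \<delta> * cnj b * den x ^ (n - 1) * w_of x * z_of u)) (at x)"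
    by (rule has_derivative_eq_rhs, rule has_derivative_mult[OF has_derivative_power[OF d]])
       (auto intro!: derivative_eq_intros simp: algebra_simps)
  from has_derivative_complex2[OF 1 2] have "(\<phi> has_derivative (\<lambda>u. complex2_to_real4 (\<delta> * z_of u / (den x)\<^sup>2,
     den x ^ n * w_of u - of_nat n * \<delta> * cnj b * den x ^ (n - 1) * w_of x * z_of u))) (at x)"
    by (simp add: moebius_def[abs_def])
  from jacobian_matrix_works[OF this] show "z_of (jacobian_matrix \<phi> x *v u) = \<delta> * z_of u / (den x)\<^sup>2"
    "w_of (jacobian_matrix \<phi> x *v u) = den x ^ n * w_of u - of_nat n * \<delta> * cnj b * den x ^ (n - 1) * w_of x * z_of u"
    by (simp_all add: z_of_complex2 w_of_complex2)
qed

text \<open>The Chern connection depends only on the holomorphic structure and the invariant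
  Hermitian norm, so the vertical part of a vector transforms as \<open>w\<close> does. Explicitly,
  the term from differentiating the power of the denominator compensates the change of
  \<open>cnj(z) / E\<close>.\<close>

lemma vertical_\<phi>:
  assumes den: "den x \<noteq> 0"
  shows "vertical n (\<phi> x) (jacobian_matrix \<phi> x *v u) = den x ^ n * vertical n x u"
proof -
  define E where "E = complex_of_real (base_norm x)"
  define D where "D = den x"
  have E: "E \<noteq> 0" using base_norm_pos[of x] by (simp add: E_def)
  have E': "complex_of_real (base_norm (\<phi> x)) = E / (D * cnj D)"
    using base_norm_\<phi>[OF den] den by (simp add: E_def D_def complex_norm_square[symmetric] field_simps flip: of_real_power of_real_mult)
  obtain k where k: "n = Suc k" using n by (cases n) auto
  have D: "D \<noteq> 0" using den by (simp add: D_def)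
  have key: "cnj (a * z_of x + b) * \<delta> = cnj (z_of x) * D + \<delta> * cnj b * E"
  proof -
    have "E = 1 + z_of x * cnj (z_of x)"
      by (simp add: E_def base_norm_complex complex_norm_square del: of_real_power)
    then show ?thesis by (simp add: D_def moebius_den_def algebra_simps)
  qed
  have "vertical n (\<phi> x) (jacobian_matrix \<phi> x *v u) =
    D ^ n * w_of u - of_nat n * \<delta> * cnj b * D ^ k * w_of x * z_of u
      + of_nat n * (D ^ n * w_of x) * (cnj (a * z_of x + b) / cnj D) * (\<delta> * z_of u / D\<^sup>2) / (E / (D * cnj D))"
    unfolding vertical_def derivative_\<phi>[OF den] z_of_\<phi> w_of_\<phi> E' by (simp add: D_def k)
  also have "of_nat n * (D ^ n * w_of x) * (cnj (a * z_of x + b) / cnj D) * (\<delta> * z_of u / D\<^sup>2) / (E / (D * cnj D))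
     = of_nat n * D ^ k * w_of x * (cnj (a * z_of x + b) * \<delta>) * z_of u / E"
    using D E by (simp add: k power2_eq_square field_simps)
  also have "\<dots> = of_nat n * D ^ n * w_of x * cnj (z_of x) * z_of u / E + of_nat n * \<delta> * cnj b * D ^ k * w_of x * z_of u"
    unfolding key using E by (simp add: k field_simps)
  finally show ?thesis by (simp add: vertical_def D_def E_def algebra_simps)
qed

text \<open>In \<open>calabi_inner\<close> the base term picks up \<open>|den|^(-4)\<close> from the
  derivative and \<open>|den|^4\<close> from \<open>base_norm\<close>, the vertical term
  \<open>|den|^(2 n)\<close> and its inverse.\<close>

lemma pullback_calabi:
  assumes den: "den x \<noteq> 0"
  shows "calabi n A b' x = transpose (jacobian_matrix \<phi> x) ** calabi n A b' (\<phi> x) ** jacobian_matrix \<phi> x"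
proof (rule matrix_entries_inner)
  fix u v
  let ?J = "jacobian_matrix \<phi> x"
  define D where "D = cmod (den x)"
  have Re: "Re (of_real r * c) = r * Re c" for r c by simp
  have D: "D > 0" using den by (simp add: D_def)
  have E: "base_norm x = base_norm (\<phi> x) * D\<^sup>2" using base_norm_\<phi>[OF den] by (simp add: D_def)
  have h: "fibre_norm n (\<phi> x) = fibre_norm n x" by (rule fibre_norm_\<phi>[OF den])
  have "u \<bullet> ((transpose ?J ** calabi n A b' (\<phi> x) ** ?J) *v v) = (?J *v u) \<bullet> (calabi n A b' (\<phi> x) *v (?J *v v))"
  proof -
    have *: "(transpose ?J ** calabi n A b' (\<phi> x) ** ?J) *v v = transpose ?J *v (calabi n A b' (\<phi> x) *v (?J *v v))"
      by (simp add: matrix_vector_mul_assoc matrix_mul_assoc)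
    show ?thesis unfolding * using dot_lmul_matrix[of u "transpose ?J" "calabi n A b' (\<phi> x) *v (?J *v v)"] by simp
  qed
  also have "\<dots> = A (fibre_norm n x) / (base_norm (\<phi> x))\<^sup>2 * Re (z_of (?J *v u) * cnj (z_of (?J *v v)))
    + base_norm (\<phi> x) ^ n * b' (fibre_norm n x) * Re (vertical n (\<phi> x) (?J *v u) * cnj (vertical n (\<phi> x) (?J *v v)))"
    unfolding calabi_inner[OF n] h ..
  also have "z_of (?J *v u) * cnj (z_of (?J *v v)) = (\<delta> * cnj \<delta>) / ((den x * cnj (den x)) ^ 2) * (z_of u * cnj (z_of v))"
    by (simp add: derivative_\<phi>[OF den] power_mult_distrib field_simps)
  also have "\<dots> = of_real (1 / D ^ 4) * (z_of u * cnj (z_of v))"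
    by (simp add: norm_\<delta> D_def complex_norm_square[symmetric] flip: power_mult)
  also have "vertical n (\<phi> x) (?J *v u) * cnj (vertical n (\<phi> x) (?J *v v)) =
     (den x * cnj (den x)) ^ n * (vertical n x u * cnj (vertical n x v))"
    by (simp add: vertical_\<phi>[OF den] power_mult_distrib)
  also have "\<dots> = of_real ((D\<^sup>2) ^ n) * (vertical n x u * cnj (vertical n x v))"
    by (simp add: D_def complex_norm_square[symmetric])
  also have "A (fibre_norm n x) / (base_norm (\<phi> x))\<^sup>2 * Re (of_real (1 / D ^ 4) * (z_of u * cnj (z_of v)))
     = A (fibre_norm n x) / (base_norm x)\<^sup>2 * Re (z_of u * cnj (z_of v))"
    unfolding E using D by (simp only: Re) (simp add: field_simps power2_eq_square power4_eq_xxxx)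
  also have "base_norm (\<phi> x) ^ n * b' (fibre_norm n x) * Re (of_real ((D\<^sup>2) ^ n) * (vertical n x u * cnj (vertical n x v)))
     = base_norm x ^ n * b' (fibre_norm n x) * Re (vertical n x u * cnj (vertical n x v))"
    unfolding E power_mult_distrib by (simp only: Re) (simp add: mult_ac)
  also have "A (fibre_norm n x) / (base_norm x)\<^sup>2 * Re (z_of u * cnj (z_of v)) + \<dots> = u \<bullet> (calabi n A b' x *v v)"
    unfolding calabi_inner[OF n] ..
  finally show "u \<bullet> (calabi n A b' x *v v) = u \<bullet> ((transpose ?J ** calabi n A b' (\<phi> x) ** ?J) *v v)" ..
qed

lemma Cinf_on_\<phi>:
  assumes "open U" "\<And>x. x \<in> U \<Longrightarrow> den x \<noteq> 0"
  shows "Cinf_on U (\<lambda>y. \<phi> y $ i)"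
proof -
  have "complex_Cinf_on U den"
  proof -
    have "complex_Cinf_on U (\<lambda>x. \<delta> * (cnj a + (- cnj b) * z_of x))"
      by (intro complex_Cinf_on_add complex_Cinf_on_mult complex_Cinf_on_const complex_Cinf_on_z_of assms)
    then show ?thesis by (simp add: moebius_den_def[abs_def])
  qed
  then show ?thesis unfolding moebius_def using assms
    by (intro Cinf_on_complex2 complex_Cinf_on_divide complex_Cinf_on_add complex_Cinf_on_mult complex_Cinf_on_power
        complex_Cinf_on_const complex_Cinf_on_z_of complex_Cinf_on_w_of) auto
qed

lemma open_den: "open {x. den x \<noteq> 0}"
proof -
  have "continuous_on UNIV den"
    unfolding moebius_den_def z_of_def Complex_eq by (intro continuous_intros)
  then show ?thesis by (simp add: open_Collect_neq continuous_on_const)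
qed

text \<open>The fibre where \<open>den\<close> vanishes is moved over \<open>z = infinity\<close>,
  outside the chart, and is therefore removed from the source.\<close>

lemma local_isometry_\<phi>:
  assumes V: "metric_on {x. fibre_norm n x \<in> I} (calabi n A b')"
  shows "local_isometry ({x. fibre_norm n x \<in> I} \<inter> {x. den x \<noteq> 0}) {x. fibre_norm n x \<in> I} (calabi n A b') (calabi n A b') \<phi>"
proof
  let ?U = "{x. fibre_norm n x \<in> I} \<inter> {x. den x \<noteq> 0}"
  have U: "open ?U" using open_den metric_on_open[OF V] by blast
  show "metric_on ?U (calabi n A b')" by (rule metric_on_subset[OF V _ U]) auto
  show "metric_on {x. fibre_norm n x \<in> I} (calabi n A b')" by (rule V)
  show "Cinf_on ?U (\<lambda>y. \<phi> y $ i)" for i by (rule Cinf_on_\<phi>[OF U]) auto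
qed (auto simp: fibre_norm_\<phi> pullback_calabi)

end

lemma moebius_to_base_point:
  assumes n: "n \<ge> 1"
  obtains a b \<delta> t where "unitary n a b \<delta>" "moebius_den a b \<delta> x \<noteq> 0" "moebius n a b \<delta> x = base_point t" "t\<^sup>2 = fibre_norm n x"
proof -
  define r where "r = sqrt (base_norm x)"
  have r: "r > 0" "r\<^sup>2 = base_norm x" using base_norm_pos[of x] by (simp_all add: r_def)
  \<comment> \<open>\<open>a\<close> and \<open>b\<close> send \<open>z\<close> to \<open>0\<close>;
    \<open>\<delta>\<close> is an \<open>n\<close>-th root of the inverse phase of \<open>w\<close>,
    as \<open>w\<close> gets multiplied by \<open>\<delta> ^ n\<close> times a positive
    number.\<close>
  define a where "a = complex_of_real (1 / r)"
  define b where "b = - z_of x / of_real r"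
  define \<delta> where "\<delta> = cis (- Arg (w_of x) / real n)"
  have u: "unitary n a b \<delta>"
  proof
    have "(cmod a)\<^sup>2 + (cmod b)\<^sup>2 = (1 + (cmod (z_of x))\<^sup>2) / r\<^sup>2"
      using r(1) by (simp add: a_def b_def norm_divide power_divide add_divide_distrib)
    then show "(cmod a)\<^sup>2 + (cmod b)\<^sup>2 = 1" using r base_norm_pos[of x] by (simp add: base_norm_complex)
  qed (use n in \<open>simp_all add: \<delta>_def\<close>)
  have den: "moebius_den a b \<delta> x = \<delta> * of_real r"
  proof -
    have "cnj a - cnj b * z_of x = of_real ((1 + (cmod (z_of x))\<^sup>2) / r)"
      using r(1) by (simp add: a_def b_def complex_norm_square field_simps del: of_real_power)
    moreover have "(1 + (cmod (z_of x))\<^sup>2) / r = r"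
      using r(1) unfolding base_norm_complex[symmetric] r(2)[symmetric] by (simp add: power2_eq_square)
    ultimately show ?thesis by (simp add: moebius_den_def)
  qed
  have "\<delta> ^ n * w_of x = of_real (cmod (w_of x))"
  proof -
    have "\<delta> ^ n = cis (- Arg (w_of x))" unfolding \<delta>_def Complex.DeMoivre using n by simp
    moreover have "w_of x = of_real (cmod (w_of x)) * cis (Arg (w_of x))"
      using rcis_cmod_Arg[of "w_of x"] by (simp add: rcis_def)
    ultimately have "\<delta> ^ n * w_of x = cis (- Arg (w_of x)) * (of_real (cmod (w_of x)) * cis (Arg (w_of x)))"
      by (rule arg_cong2[where f = "(*)"])
    also have "\<dots> = of_real (cmod (w_of x))" by (simp only: mult.left_commute cis_mult) simp
    finally show ?thesis .
  qed
  then have w: "moebius_den a b \<delta> x ^ n * w_of x = of_real (r ^ n * cmod (w_of x))"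
    by (simp add: den power_mult_distrib mult_ac)
  have z: "a * z_of x + b = 0" by (simp add: a_def b_def field_simps)
  show thesis
  proof (rule that[OF u])
    show "moebius_den a b \<delta> x \<noteq> 0" unfolding den using r by (simp add: \<delta>_def)
    show "moebius n a b \<delta> x = base_point (r ^ n * cmod (w_of x))"
      unfolding moebius_def w z by (simp add: complex2_to_real4_def base_point_def del: of_real_mult of_real_power)
    show "(r ^ n * cmod (w_of x))\<^sup>2 = fibre_norm n x"
      unfolding fibre_norm_complex r(2)[symmetric] by (simp add: power_mult_distrib power_mult[symmetric] mult.commute)
  qed
qed

section \<open>Reduction of the curvature equations to base points\<close>

lemma calabi_einsteinI:
  assumes n: "n \<ge> 1" and V: "metric_on {x. fibre_norm n x \<in> I} (calabi n A b)"
    and base: "\<And>t. t\<^sup>2 \<in> I \<Longrightarrow> ricci (calabi n A b) (base_point t) = c *\<^sub>R calabi n A b (base_point t)"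
    and x: "fibre_norm n x \<in> I"
  shows "ricci (calabi n A b) x = c *\<^sub>R calabi n A b x"
proof -
  obtain p q \<delta> t where u: "unitary n p q \<delta>" and *: "moebius_den p q \<delta> x \<noteq> 0" "moebius n p q \<delta> x = base_point t" "t\<^sup>2 = fibre_norm n x"
    using moebius_to_base_point[OF n] .
  interpret local_isometry "{x. fibre_norm n x \<in> I} \<inter> {x. moebius_den p q \<delta> x \<noteq> 0}" "{x. fibre_norm n x \<in> I}"
    "calabi n A b" "calabi n A b" "moebius n p q \<delta>"
    by (rule unitary.local_isometry_\<phi>[OF u V])
  show ?thesis
  proof (rule einstein_natural)
    show "x \<in> {x. fibre_norm n x \<in> I} \<inter> {x. moebius_den p q \<delta> x \<noteq> 0}" using * x by simp
    show "ricci (calabi n A b) (moebius n p q \<delta> x) = c *\<^sub>R calabi n A b (moebius n p q \<delta> x)"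
      unfolding *(2) using *(3) x by (intro base) simp
  qed
qed

lemma calabi_scalar_curvatureI:
  assumes n: "n \<ge> 1" and V: "metric_on {x. fibre_norm n x \<in> I} (calabi n A b)"
    and base: "\<And>t. t\<^sup>2 \<in> I \<Longrightarrow> scalar_curvature (calabi n A b) (base_point t) = c"
    and x: "fibre_norm n x \<in> I"
  shows "scalar_curvature (calabi n A b) x = c"
proof -
  obtain p q \<delta> t where u: "unitary n p q \<delta>" and *: "moebius_den p q \<delta> x \<noteq> 0" "moebius n p q \<delta> x = base_point t" "t\<^sup>2 = fibre_norm n x"
    using moebius_to_base_point[OF n] .
  interpret local_isometry "{x. fibre_norm n x \<in> I} \<inter> {x. moebius_den p q \<delta> x \<noteq> 0}" "{x. fibre_norm n x \<in> I}"
    "calabi n A b" "calabi n A b" "moebius n p q \<delta>"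
    by (rule unitary.local_isometry_\<phi>[OF u V])
  have "x \<in> {x. fibre_norm n x \<in> I} \<inter> {x. moebius_den p q \<delta> x \<noteq> 0}" using * x by simp
  from scalar_curvature_natural[OF this] show ?thesis unfolding *(2) using base[of t] *(3) x by simp
qed

context calabi_base_point
begin

lemma calabi_base_point: "calabi n A b (base_point t) $ i $ j =
    (if i = j then if i = 1 \<or> i = 2 then A X else b X else 0)"
  by (rule g_at)

lemma einstein_at_base_point:
  assumes "4 - 2 * (real n)\<^sup>2 * X * b X / A X - 2 * A1 X / b X - 2 * X * A2 / b X = c * A X"
    and "- 2 * b1 X / b X - 2 * X * b2 / b X + 2 * X * (b1 X)\<^sup>2 / (b X)\<^sup>2
   - 2 * A1 X / A X - 4 * X * A2 / A X + 2 * X * (A1 X)\<^sup>2 / (A X)\<^sup>2 + 2 * X * A1 X * b1 X / (A X * b X) = c * b X"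
    and "- 2 * b1 X / b X - 2 * X * b2 / b X + 2 * X * (b1 X)\<^sup>2 / (b X)\<^sup>2
   - 2 * A1 X / A X - 2 * X * A1 X * b1 X / (A X * b X) + 2 * (real n)\<^sup>2 * X * (b X)\<^sup>2 / (A X)\<^sup>2 = c * b X"
  shows "ricci (calabi n A b) (base_point t) = c *\<^sub>R calabi n A b (base_point t)"
proof -
  have "ricci (calabi n A b) (base_point t) $ 1 $ 1 = c * A X" "ricci (calabi n A b) (base_point t) $ 2 $ 2 = c * A X"
    "ricci (calabi n A b) (base_point t) $ 3 $ 3 = c * b X" "ricci (calabi n A b) (base_point t) $ 4 $ 4 = c * b X"
    unfolding ricci_11 ricci_22 ricci_33 ricci_44 by (fact assms)+
  then show ?thesis by (simp add: vec_eq_iff forall_4 calabi_base_point ricci_off_diagonal)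
qed

lemma scalar_curvature_base_point: "scalar_curvature (calabi n A b) (base_point t) =
   (ricci (calabi n A b) (base_point t) $ 1 $ 1 + ricci (calabi n A b) (base_point t) $ 2 $ 2) / A X +
   (ricci (calabi n A b) (base_point t) $ 3 $ 3 + ricci (calabi n A b) (base_point t) $ 4 $ 4) / b X"
proof -
  let ?B = "(\<chi> i j. if i = j then if i = 1 \<or> i = 2 then 1 / A X else 1 / b X else 0) :: real^4^4"
  have "calabi n A b (base_point t) ** ?B = mat 1"
    using positive by (simp add: vec_eq_iff forall_4 matrix_matrix_mult_def sum_4 calabi_base_point mat_def)
  then have "matrix_inv (calabi n A b (base_point t)) = ?B" by (rule matrix_inv_unique)
  then show ?thesis
    by (simp add: scalar_curvature_def sum_4 ricci_off_diagonal add_divide_distrib)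
qed

text \<open>At \<open>t = 0\<close> the Christoffel symbols vanish, so only second derivatives of
  the metric contribute. These four endomorphisms belong to pairs of one base and one fibre
  direction.\<close>

lemma curvature_zero_section:
  assumes "t = 0"
  shows "curvature (calabi n A b) 1 3 (base_point t) = (\<chi> k l. if (k, l) = (1, 3) then - A1 X / A X
      else if (k, l) = (2, 4) then - n * b X / A X else if (k, l) = (3, 1) then A1 X / b X else if (k, l) = (4, 2) then n else 0)"
    and "curvature (calabi n A b) 2 4 (base_point t) = (\<chi> k l. if (k, l) = (1, 3) then - n * b X / A X
      else if (k, l) = (2, 4) then - A1 X / A X else if (k, l) = (3, 1) then n else if (k, l) = (4, 2) then A1 X / b X else 0)"
    and "curvature (calabi n A b) 1 4 (base_point t) = (\<chi> k l. if (k, l) = (1, 4) then - A1 X / A X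
      else if (k, l) = (2, 3) then n * b X / A X else if (k, l) = (3, 2) then - n else if (k, l) = (4, 1) then A1 X / b X else 0)"
    and "curvature (calabi n A b) 2 3 (base_point t) = (\<chi> k l. if (k, l) = (1, 4) then n * b X / A X
      else if (k, l) = (2, 3) then - A1 X / A X else if (k, l) = (3, 2) then A1 X / b X else if (k, l) = (4, 1) then - n else 0)"
  using positive
  by (simp_all add: vec_eq_iff forall_4 curvature_at d\<Gamma>_def sum_4 \<Gamma>l_values g1_entries g2_def doubleton_eq_iff)
     (simp_all add: assms field_simps)

text \<open>For \<open>A' = n b\<close> the metric is Kaehler. Otherwise linear combinations of the curvature endomorphisms
  at a point of the zero section have rank two, and any commuting \<open>J\<close> must preserve their kernels, which
  meet in lines.\<close>

lemma no_complex_structure_commutes: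
  assumes "t = 0" and ne: "(A1 X)\<^sup>2 \<noteq> (n * b X)\<^sup>2"
    and J: "J ** J = - mat 1" and comm: "\<And>i j. J ** curvature (calabi n A b) i j (base_point t) = curvature (calabi n A b) i j (base_point t) ** J"
  shows False
proof -
  \<comment> \<open>The coefficients are chosen so that two of the four entries of each combination
    cancel: \<open>N3\<close> has its image in the plane of axes 1 and 3, \<open>N4\<close> in that
    of axes 1 and 4.\<close>
  define N3 where "N3 = A1 X *\<^sub>R curvature (calabi n A b) 1 3 (base_point t) - (n * b X) *\<^sub>R curvature (calabi n A b) 2 4 (base_point t)"
  define N4 where "N4 = A1 X *\<^sub>R curvature (calabi n A b) 1 4 (base_point t) + (n * b X) *\<^sub>R curvature (calabi n A b) 2 3 (base_point t)"
  define c where "c = ((A1 X)\<^sup>2 - (n * b X)\<^sup>2) / A X"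
  have c: "c \<noteq> 0" using ne positive by (simp add: c_def)
  have scale: "J ** (r *\<^sub>R M) = r *\<^sub>R (J ** M)" "(r *\<^sub>R M) ** J = r *\<^sub>R (M ** J)" for r and M :: "real^4^4"
    by (simp_all add: matrix_matrix_mult_def vec_eq_iff sum_distrib_left mult_ac)
  have "J ** N3 = N3 ** J" "J ** N4 = N4 ** J"
    unfolding N3_def N4_def by (simp_all add: matrix_ring_simps scale comm)
  then have e: "(J ** N3) $ k $ 3 = (N3 ** J) $ k $ 3" "(J ** N4) $ k $ 4 = (N4 ** J) $ k $ 4" for k by simp_all
  have N3: "N3 $ 1 $ 3 = - c" "N3 $ 2 $ k = 0" "N3 $ 4 $ k = 0" "N3 $ 3 $ 3 = 0"
    and N4: "N4 $ 1 $ 4 = - c" "N4 $ 2 $ k = 0" "N4 $ 3 $ k = 0" "N4 $ 4 $ 4 = 0" for k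
    using exhaust_4[of k] positive
    by (auto simp: N3_def N4_def curvature_zero_section[OF assms(1)] c_def field_simps power2_eq_square)
  \<comment> \<open>\<open>J\<close> preserves both images, so axis 1, which spans their
    intersection, is a real eigenvector of \<open>J\<close>; its eigenvalue would have square
    \<open>-1\<close>.\<close>
  have "J $ 2 $ 1 = 0" using e(1)[of 2] N3 c by (simp add: matrix_matrix_mult_def sum_4)
  moreover have "J $ 4 $ 1 = 0" using e(1)[of 4] N3 c by (simp add: matrix_matrix_mult_def sum_4)
  moreover have "J $ 3 $ 1 = 0" using e(2)[of 3] N4 c by (simp add: matrix_matrix_mult_def sum_4)
  ultimately have "J $ 1 $ 1 * J $ 1 $ 1 = - 1"
    using arg_cong[OF J, of "\<lambda>M. M $ 1 $ 1"] by (simp add: matrix_matrix_mult_def sum_4 mat_def)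
  then show False by (metis not_square_less_zero neg_less_0_iff_less zero_less_one)
qed

end

section \<open>The momentum profile\<close>

text \<open>The moment map \<open>s\<close> of the fibre rotation, as a function of the fibre norm \<open>h\<close>, is given
  implicitly by \<open>(s - 1) ((s + n - 1) / n)\<^bsup>n-1\<^esup> = h\<close>. The scalar-flat metric is \<open>A = n s\<close>, \<open>b = s'\<close>.\<close>

locale momentum_profile =
  fixes n :: nat
  assumes n: "n \<ge> 3"
begin

definition fibre_of :: "real \<Rightarrow> real" where
  "fibre_of s = (s - 1) * ((s + real n - 1) / n) ^ (n - 1)"

text \<open>The derivative of \<open>momentum\<close> as a function of \<open>s\<close> itself, the
  reciprocal of that of \<open>fibre_of\<close>. The equation \<open>s' = slope s\<close> is
  autonomous, so all higher derivatives are expressions in \<open>s\<close> too.\<close>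

definition slope :: "real \<Rightarrow> real" where
  "slope s = (n / (s + real n - 1)) ^ (n - 2) / s"

text \<open>The critical point \<open>s = 0\<close> of \<open>fibre_of\<close> bounds the domain of
  the inverse. \<open>J\<close> contains a neighbourhood of \<open>h = 0\<close>, so that
  derivatives on the zero section are two-sided.\<close>

definition J :: "real set" where "J = {fibre_of 0<..}"

definition momentum :: "real \<Rightarrow> real" where
  "momentum r = (THE s. s > 0 \<and> fibre_of s = r)"

lemma fibre_of_deriv: "(fibre_of has_real_derivative ((s + real n - 1) / n) ^ (n - 2) * s) (at s)"
proof -
  obtain k where k: "n = Suc (Suc k)" using n by (metis Suc_diff_Suc le_add_diff_inverse numeral_3_eq_3 plus_nat.simps(2))
  have "(fibre_of has_real_derivative ((s + real n - 1) / n) ^ (n - 1) + (s - 1) * (real (n - 1) * ((s + real n - 1) / n) ^ (n - 2) * (1 / n))) (at s)"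
    unfolding fibre_of_def[abs_def] by (rule derivative_eq_intros refl | simp add: k)+
  moreover have "((s + real n - 1) / n) ^ (n - 1) + (s - 1) * (real (n - 1) * ((s + real n - 1) / n) ^ (n - 2) * (1 / n))
     = ((s + real n - 1) / n) ^ (n - 2) * s"
  proof -
    define r where "r = (s + real n - 1) / n"
    have "r + (s - 1) * (real (n - 1) * (1 / n)) = s"
    proof -
      have "real (n - 1) = real n - 1" "real n > 0" using n by auto
      then show ?thesis by (simp add: r_def field_simps)
    qed
    moreover have "r ^ (n - 1) + (s - 1) * (real (n - 1) * r ^ (n - 2) * (1 / n)) = r ^ (n - 2) * (r + (s - 1) * (real (n - 1) * (1 / n)))"
      by (simp add: k algebra_simps add_divide_distrib diff_divide_distrib)
    ultimately show ?thesis by (simp only: r_def)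
  qed
  ultimately show ?thesis by simp
qed

lemma slope_inverse: "s > 0 \<Longrightarrow> inverse (((s + real n - 1) / n) ^ (n - 2) * s) = slope s"
  by (simp add: slope_def power_divide field_simps)

lemma slope_pos: "s > 0 \<Longrightarrow> slope s > 0"
  using n by (simp add: slope_def)

lemma fibre_of_strict_mono:
  assumes "0 \<le> s" "s < u"
  shows "fibre_of s < fibre_of u"
proof (rule DERIV_pos_imp_increasing_open[OF assms(2)])
  show "continuous_on {s..u} fibre_of"
    using fibre_of_deriv DERIV_isCont continuous_at_imp_continuous_on by blast
  show "\<exists>y. (fibre_of has_real_derivative y) (at x) \<and> 0 < y" if "s < x" for x
    using fibre_of_deriv[of x] that assms n by (intro exI conjI) (auto intro!: mult_pos_pos)
qed

lemma fibre_of_inj: "0 < s \<Longrightarrow> 0 < u \<Longrightarrow> fibre_of s = fibre_of u \<Longrightarrow> s = u"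
  using fibre_of_strict_mono[of s u] fibre_of_strict_mono[of u s] by (cases s u rule: linorder_cases) auto

lemma fibre_of_surj:
  assumes "r \<in> J"
  shows "\<exists>s>0. fibre_of s = r"
proof -
  \<comment> \<open>For \<open>u \<ge> 1\<close> the second factor of \<open>fibre_of u\<close> is
    at least \<open>1\<close>, so \<open>fibre_of u \<ge> u - 1 \<ge> r\<close>.\<close>
  define u where "u = \<bar>r\<bar> + 1"
  have "r \<le> (u - 1) * 1" by (simp add: u_def)
  also have "\<dots> \<le> fibre_of u"
    unfolding fibre_of_def using n by (intro mult_left_mono one_le_power) (auto simp: u_def field_simps)
  finally have "r \<le> fibre_of u" .
  then have "\<exists>s\<ge>0. s \<le> u \<and> fibre_of s = r"
    using assms fibre_of_deriv DERIV_isCont by (intro IVT) (auto simp: J_def u_def)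
  then show ?thesis using assms by (metis J_def greaterThan_iff less_irrefl order_less_le)
qed

lemma momentum: "r \<in> J \<Longrightarrow> momentum r > 0" "r \<in> J \<Longrightarrow> fibre_of (momentum r) = r"
proof -
  assume "r \<in> J"
  then have "\<exists>!s. s > 0 \<and> fibre_of s = r" using fibre_of_surj fibre_of_inj by blast
  from theI'[OF this] show "momentum r > 0" "fibre_of (momentum r) = r" by (simp_all add: momentum_def)
qed

lemma fibre_of_in_J: "s > 0 \<Longrightarrow> fibre_of s \<in> J"
  using fibre_of_strict_mono[of 0 s] by (simp add: J_def)

lemma momentum_fibre_of: "s > 0 \<Longrightarrow> momentum (fibre_of s) = s"
  using momentum[OF fibre_of_in_J] fibre_of_inj by blast

lemma nonneg_in_J: "r \<ge> 0 \<Longrightarrow> r \<in> J"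
  using fibre_of_strict_mono[of 0 1] by (simp add: J_def fibre_of_def[of 1])

lemma momentum_less_iff:
  assumes "r \<in> J" "s > 0"
  shows "momentum r < s \<longleftrightarrow> r < fibre_of s"
  using fibre_of_strict_mono[of "momentum r" s] fibre_of_strict_mono[of s "momentum r"] momentum[OF assms(1)] assms(2)
  by (cases "momentum r" s rule: linorder_cases) auto

lemma momentum_deriv:
  assumes r: "r \<in> J"
  shows "(momentum has_real_derivative slope (momentum r)) (at r)"
proof -
  let ?s = "momentum r"
  have s: "?s > 0" "fibre_of ?s = r" using momentum[OF r] by auto
  have "isCont momentum (fibre_of ?s)"
  proof (rule isCont_inverse_function[where f = fibre_of and x = ?s and d = "?s / 2"])
    show "0 < ?s / 2" using s by simp
    show "momentum (fibre_of z) = z" if "\<bar>z - ?s\<bar> \<le> ?s / 2" for z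
      using that s(1) by (intro momentum_fibre_of) linarith
    show "isCont fibre_of z" for z using fibre_of_deriv DERIV_isCont by blast
  qed
  then have c: "isCont momentum r" by (simp add: s)
  obtain e where e: "e > 0" "ball r e \<subseteq> J" using r by (metis J_def open_contains_ball open_greaterThan)
  show ?thesis unfolding slope_inverse[OF s(1), symmetric]
  proof (rule DERIV_inverse_function[where f = fibre_of and a = "r - e" and b = "r + e", OF fibre_of_deriv _ _ _ _ c])
    show "((?s + real n - 1) / n) ^ (n - 2) * ?s \<noteq> 0" using s(1) n by simp
    show "r - e < r" "r < r + e" using e by simp_all
    show "fibre_of (momentum y) = y" if "r - e < y" "y < r + e" for y
      using that by (intro momentum(2) subsetD[OF e(2)]) (auto simp: dist_real_def)
  qed
qed

text \<open>The momentum profile of the metric: all powers cancel and a rational function of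
  \<open>s\<close> is left. It removes the fibre norm from the curvature formulas.\<close>

lemma fibre_slope:
  assumes "r \<in> J"
  shows "r * slope (momentum r) = (momentum r - 1) * (momentum r + real n - 1) / (n * momentum r)"
proof -
  obtain k where k: "n = Suc (Suc k)" using n by (metis Suc_diff_Suc le_add_diff_inverse numeral_3_eq_3 plus_nat.simps(2))
  have kn: "n - 2 = k" "n - 1 = Suc k" using k by auto
  define R where "R = (momentum r + real n - 1) / n"
  have s: "momentum r > 0" using momentum[OF assms] by simp
  have R: "R > 0" using s n by (simp add: R_def)
  have "slope (momentum r) = 1 / (R ^ k * momentum r)"
    unfolding slope_def R_def kn by (simp add: power_divide)
  moreover have "(momentum r - 1) * (R ^ k * R) = r"
    using momentum(2)[OF assms] unfolding fibre_of_def R_def kn by (simp add: mult.commute)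
  ultimately have "r * slope (momentum r) = (momentum r - 1) * (R ^ k * R) * (1 / (R ^ k * momentum r))" by simp
  also have "\<dots> = (momentum r - 1) * R / momentum r" using R s by (simp add: field_simps)
  finally have "r * slope (momentum r) = (momentum r - 1) * R / momentum r" .
  then show ?thesis by (simp add: R_def)
qed

text \<open>Bootstrap with \<open>s' = slope s\<close>: the partials are rational in the function
  itself, times the smooth partials of \<open>fibre_norm\<close>.\<close>

lemma Cinf_on_momentum: "Cinf_on UNIV (\<lambda>x :: real^4. momentum (fibre_norm n x))"
proof -
  let ?\<sigma> = "\<lambda>x :: real^4. momentum (fibre_norm n x)"
  have h: "Cinf_on UNIV (fibre_norm n)" by (rule Cinf_on_fibre_norm) simp
  have in_J: "fibre_norm n x \<in> J" for x by (rule nonneg_in_J[OF fibre_norm_nonneg])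
  have pos: "?\<sigma> x > 0" for x using momentum(1)[OF in_J] .
  show ?thesis
  proof (rule Cinf_onI_partial)
    fix x :: "real^4"
    obtain D where "(fibre_norm n has_derivative D) (at x)"
      using Cinf_on_differentiable[OF h] differentiable_def by blast
    from has_derivative_compose[OF this momentum_deriv[OF in_J, unfolded has_field_derivative_def]]
    show "?\<sigma> differentiable at x" unfolding differentiable_def by blast
  next
    fix i k assume \<sigma>: "Ck_on k UNIV ?\<sigma>"
    have eq: "partial i ?\<sigma> x = real n ^ (n - 2) * inverse (?\<sigma> x + (real n - 1)) ^ (n - 2) * inverse (?\<sigma> x) * partial i (fibre_norm n) x" for x
      using partial_chain1[OF Cinf_on_differentiable[OF h] momentum_deriv[OF in_J], of x i]
      by (simp add: slope_def divide_inverse power_mult_distrib power_inverse add_diff_eq)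
    have "?\<sigma> x + (real n - 1) \<noteq> 0" for x using pos[of x] n by simp
    moreover have "?\<sigma> x \<noteq> 0" for x using pos[of x] by simp
    ultimately have "Ck_on k UNIV (\<lambda>x. real n ^ (n - 2) * inverse (?\<sigma> x + (real n - 1)) ^ (n - 2) * inverse (?\<sigma> x) * partial i (fibre_norm n) x)"
      using Cinf_on_partial[OF h] \<sigma>
      by (intro Ck_on_mult Ck_on_power Ck_on_inverse Ck_on_add Ck_on_const) (auto simp: Cinf_on_def)
    then show "Ck_on k UNIV (partial i ?\<sigma>)" by (subst Ck_on_cong[OF open_UNIV eq])
  qed simp
qed

text \<open>The logarithmic derivative of \<open>slope\<close>.\<close>

definition curvature_factor :: "real \<Rightarrow> real" where
  "curvature_factor s = - real (n - 2) / (s + real n - 1) - 1 / s"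

lemma slope_deriv:
  assumes "s > 0"
  shows "(slope has_real_derivative slope s * curvature_factor s) (at s)"
proof -
  obtain k where k: "n = Suc (Suc (Suc k))" using n by (metis add_Suc le_Suc_ex numeral_3_eq_3 plus_nat.simps(1))
  define r where "r = s + real n - 1"
  have r: "r > 0" using assms n by (simp add: r_def)
  have "(slope has_real_derivative ((real (n - 2) * (n / r) ^ (n - 2 - 1) * (- (n / (r * r)))) * s - (n / r) ^ (n - 2)) / (s * s)) (at s)"
    unfolding slope_def[abs_def] r_def using assms n
    by (auto intro!: derivative_eq_intros)
  moreover have "((real (n - 2) * (n / r) ^ (n - 2 - 1) * (- (n / (r * r)))) * s - (n / r) ^ (n - 2)) / (s * s) = slope s * curvature_factor s"
  proof -
    have e: "(real n / r) ^ (n - 2) = (real n / r) ^ (n - 2 - 1) * (n / r)"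
      using k by simp
    show ?thesis unfolding slope_def curvature_factor_def r_def[symmetric] e using r assms
      by (simp add: field_simps)
  qed
  ultimately show ?thesis by simp
qed

lemma curvature_factor_deriv:
  assumes "s > 0"
  shows "(curvature_factor has_real_derivative real (n - 2) / (s + real n - 1)\<^sup>2 + 1 / s\<^sup>2) (at s)"
  unfolding curvature_factor_def[abs_def] using assms n
  by (auto intro!: derivative_eq_intros simp: power2_eq_square)

end

text \<open>Metrics \<open>w(s) g\<close> with \<open>g\<close> the scalar-flat metric. One
  computation of the Ricci tensor serves both \<open>w = 1\<close> and
  \<open>w = 1 / (c - s)^2\<close>; \<open>T\<close> is a range of \<open>s\<close> on which
  \<open>w\<close> is positive and smooth.\<close>

locale conformal_momentum = momentum_profile n for n +
  fixes w w1 w2 :: "real \<Rightarrow> real" and T :: "real set"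
  assumes T: "open T" "T \<subseteq> {0<..}"
    and w1: "\<And>s. s \<in> T \<Longrightarrow> (w has_real_derivative w1 s) (at s)"
    and w2: "\<And>s. s \<in> T \<Longrightarrow> (w1 has_real_derivative w2 s) (at s)"
    and w_pos: "\<And>s. s \<in> T \<Longrightarrow> w s > 0"
    and w_smooth: "Cinf_on {x. momentum (fibre_norm n x) \<in> T} (\<lambda>x. w (momentum (fibre_norm n x)))"
begin

definition I :: "real set" where "I = {r \<in> J. momentum r \<in> T}"

definition cA :: "real \<Rightarrow> real" where "cA r = n * (momentum r * w (momentum r))"
definition cb :: "real \<Rightarrow> real" where "cb r = slope (momentum r) * w (momentum r)"
text \<open>This and the next three are first and second derivatives in the fibre norm, written in
  \<open>s\<close>: each differentiation is \<open>slope\<close> times one in \<open>s\<close>, and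
  \<open>slope\<close> reproduces itself times \<open>curvature_factor\<close>.\<close>

definition cA1 :: "real \<Rightarrow> real" where
  "cA1 r = n * (slope (momentum r) * (w (momentum r) + momentum r * w1 (momentum r)))"
definition cb1 :: "real \<Rightarrow> real" where
  "cb1 r = slope (momentum r) * (slope (momentum r) * (curvature_factor (momentum r) * w (momentum r) + w1 (momentum r)))"
definition cA2 :: "real \<Rightarrow> real" where
  "cA2 r = n * (slope (momentum r))\<^sup>2 * (curvature_factor (momentum r) * (w (momentum r) + momentum r * w1 (momentum r))
     + 2 * w1 (momentum r) + momentum r * w2 (momentum r))"
definition cb2 :: "real \<Rightarrow> real" where
  "cb2 r = (slope (momentum r)) ^ 3 * (2 * curvature_factor (momentum r) * (curvature_factor (momentum r) * w (momentum r) + w1 (momentum r))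
     + (real (n - 2) / (momentum r + real n - 1)\<^sup>2 + 1 / (momentum r)\<^sup>2) * w (momentum r)
     + curvature_factor (momentum r) * w1 (momentum r) + w2 (momentum r))"

lemma open_I: "open I"
proof -
  have "continuous_on J momentum"
    using momentum_deriv DERIV_isCont continuous_at_imp_continuous_on by blast
  then have "open (J \<inter> momentum -` T)" by (intro continuous_open_preimage T) (auto simp: J_def)
  then show ?thesis by (simp add: I_def Int_def vimage_def)
qed

lemma in_I_iff: "r \<ge> 0 \<Longrightarrow> r \<in> I \<longleftrightarrow> momentum r \<in> T"
  using nonneg_in_J by (auto simp: I_def)

lemma fibre_norm_in_I: "fibre_norm n x \<in> I \<longleftrightarrow> momentum (fibre_norm n x) \<in> T"
  by (rule in_I_iff[OF fibre_norm_nonneg])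

lemma region: "{x. fibre_norm n x \<in> I} = {x. momentum (fibre_norm n x) \<in> T}"
  by (simp add: fibre_norm_in_I)

lemma open_region: "open {x. fibre_norm n x \<in> I}"
  unfolding region using Cinf_on_open[OF w_smooth] .

lemma cA_smooth: "Cinf_on {x. fibre_norm n x \<in> I} (\<lambda>x. cA (fibre_norm n x))"
  unfolding cA_def using open_region
  by (intro Cinf_on_mult Cinf_on_const Cinf_on_subset[OF Cinf_on_momentum] w_smooth[folded region]) auto

lemma cb_smooth: "Cinf_on {x. fibre_norm n x \<in> I} (\<lambda>x. cb (fibre_norm n x))"
proof -
  have pos: "momentum (fibre_norm n x) > 0" for x
    using momentum(1)[OF nonneg_in_J[OF fibre_norm_nonneg]] .
  have "Cinf_on UNIV (\<lambda>x :: real^4. slope (momentum (fibre_norm n x)))"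
    unfolding slope_def
  proof (intro Cinf_on_divide Cinf_on_power Cinf_on_add Cinf_on_diff Cinf_on_momentum Cinf_on_const)
    fix x show "momentum (fibre_norm n x) + real n - 1 \<noteq> 0" "momentum (fibre_norm n x) \<noteq> 0"
      using pos[of x] n by auto
  qed auto
  then show ?thesis unfolding cb_def using open_region
    by (intro Cinf_on_mult w_smooth[folded region]) (auto intro: Cinf_on_subset)
qed

lemma momentum_I: "r \<in> I \<Longrightarrow> momentum r > 0" "r \<in> I \<Longrightarrow> momentum r \<in> T" "r \<in> I \<Longrightarrow> r \<in> J"
  using T momentum by (auto simp: I_def)

lemma compose_momentum:
  assumes "r \<in> I" "(f has_real_derivative f') (at (momentum r))"
  shows "((\<lambda>r. f (momentum r)) has_real_derivative f' * slope (momentum r)) (at r)"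
  using DERIV_chain2[OF assms(2) momentum_deriv[OF momentum_I(3)[OF assms(1)]]] .

lemma calabi_base_point_I:
  assumes "t\<^sup>2 \<in> I"
  shows "calabi_base_point n cA cb {x. fibre_norm n x \<in> I} I t cA1 cb1 (cA2 (t\<^sup>2)) (cb2 (t\<^sup>2))"
proof
  show "1 \<le> n" using n by simp
  show "base_point t \<in> {x. fibre_norm n x \<in> I}" using assms by (simp add: fibre_norm_base_point)
  show "0 < cA (fibre_norm n x) \<and> 0 < cb (fibre_norm n x)" if "x \<in> {x. fibre_norm n x \<in> I}" for x
    using that momentum_I[of "fibre_norm n x"] w_pos slope_pos n by (simp add: cA_def cb_def)
  show "(cA has_real_derivative cA1 r) (at r)" if r: "r \<in> I" for r
  proof -
    have "((\<lambda>s. n * (s * w s)) has_real_derivative n * (w (momentum r) + momentum r * w1 (momentum r))) (at (momentum r))"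
      using w1[OF momentum_I(2)[OF r]] by (auto intro!: derivative_eq_intros)
    from compose_momentum[OF r this] show ?thesis by (simp add: cA_def[abs_def] cA1_def mult_ac)
  qed
  show "(cb has_real_derivative cb1 r) (at r)" if r: "r \<in> I" for r
  proof -
    have "((\<lambda>s. slope s * w s) has_real_derivative slope (momentum r) * (curvature_factor (momentum r) * w (momentum r) + w1 (momentum r))) (at (momentum r))"
      using w1[OF momentum_I(2)[OF r]] slope_deriv[OF momentum_I(1)[OF r]]
      by (auto intro!: derivative_eq_intros simp: algebra_simps)
    from compose_momentum[OF r this] show ?thesis by (simp add: cb_def[abs_def] cb1_def mult_ac)
  qed
  have s: "momentum (t\<^sup>2) > 0" "momentum (t\<^sup>2) \<in> T" using momentum_I[OF assms] by auto
  show "(cA1 has_real_derivative cA2 (t\<^sup>2)) (at (t\<^sup>2))"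
  proof -
    let ?s = "momentum (t\<^sup>2)"
    have "((\<lambda>s. n * (slope s * (w s + s * w1 s))) has_real_derivative
      n * (slope ?s * (curvature_factor ?s * (w ?s + ?s * w1 ?s) + 2 * w1 ?s + ?s * w2 ?s))) (at ?s)"
      using w1[OF s(2)] w2[OF s(2)] slope_deriv[OF s(1)]
      by (auto intro!: derivative_eq_intros simp: algebra_simps)
    from compose_momentum[OF assms this] show ?thesis by (simp add: cA1_def[abs_def] cA2_def power2_eq_square mult_ac)
  qed
  show "(cb1 has_real_derivative cb2 (t\<^sup>2)) (at (t\<^sup>2))"
  proof -
    let ?s = "momentum (t\<^sup>2)"
    have "((\<lambda>s. slope s * (slope s * (curvature_factor s * w s + w1 s))) has_real_derivative
      (slope ?s)\<^sup>2 * (2 * curvature_factor ?s * (curvature_factor ?s * w ?s + w1 ?s)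
       + (real (n - 2) / (?s + real n - 1)\<^sup>2 + 1 / ?s\<^sup>2) * w ?s + curvature_factor ?s * w1 ?s + w2 ?s)) (at ?s)"
      using w1[OF s(2)] w2[OF s(2)] slope_deriv[OF s(1)] curvature_factor_deriv[OF s(1)]
      by (auto intro!: derivative_eq_intros simp: algebra_simps power2_eq_square)
    from compose_momentum[OF assms this] show ?thesis
      by (simp add: cb1_def[abs_def] cb2_def power2_eq_square power3_eq_cube mult_ac)
  qed
qed (use open_I cA_smooth cb_smooth assms in auto)

lemma metric_on_I: "metric_on {x. fibre_norm n x \<in> I} (calabi n cA cb)"
proof (rule metric_on_calabi)
  show "0 < cA (fibre_norm n x) \<and> 0 < cb (fibre_norm n x)" if "x \<in> {x. fibre_norm n x \<in> I}" for x
    using that momentum_I[of "fibre_norm n x"] w_pos slope_pos n by (simp add: cA_def cb_def)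
qed (use n cA_smooth cb_smooth in auto)

end

text \<open>Here \<open>y = s\<close>, \<open>M = n - 2\<close>, \<open>Z\<close> is the momentum
  profile, \<open>q\<close> is \<open>curvature_factor\<close> with derivative \<open>q'\<close>,
  and \<open>p = 1 / (c - s)\<close>, so that \<open>w = p^2\<close>, \<open>w' / w = 2 p\<close>
  and \<open>w'' / w = 6 p^2\<close>; the third assumption says \<open>s < c\<close>. The Einstein
  constant is \<open>-3 |ds|^2\<close>, measured in \<open>g\<close> at the boundary
  \<open>s = c\<close>, as conformal compactness dictates in dimension four; there
  \<open>|ds|^2 = 4 Z = 2 (M + 2) / M\<close>.\<close>

lemma einstein_identities:
  fixes y M :: real
  assumes "y > 0" "M > 0" "2 * (M + 1) - M * y > 0"
  defines "R \<equiv> y + M + 1"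
  defines "Z \<equiv> (y - 1) * R / ((M + 2) * y)"
    and "q \<equiv> - M / R - 1 / y" and "q' \<equiv> M / R\<^sup>2 + 1 / y\<^sup>2"
    and "p \<equiv> M / (2 * (M + 1) - M * y)"
  shows "4 - 2 * (M + 2) * Z / y - 2 * (M + 2) * (1 + 2 * y * p) - 2 * (M + 2) * Z * (q * (1 + 2 * y * p) + 4 * p + 6 * y * p\<^sup>2)
      = (- 6 * (M + 2) / M) * ((M + 2) * y * p\<^sup>2)"
    and "- 2 * (q + 2 * p) - 2 * Z * (2 * q * (q + 2 * p) + q' + 2 * q * p + 6 * p\<^sup>2) + 2 * Z * (q + 2 * p)\<^sup>2
      - 2 * (1 + 2 * y * p) / y - 4 * Z * (q * (1 + 2 * y * p) + 4 * p + 6 * y * p\<^sup>2) / y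
      + 2 * Z * (1 + 2 * y * p)\<^sup>2 / y\<^sup>2 + 2 * Z * (1 + 2 * y * p) * (q + 2 * p) / y = (- 6 * (M + 2) / M) * p\<^sup>2"
    and "- 2 * (q + 2 * p) - 2 * Z * (2 * q * (q + 2 * p) + q' + 2 * q * p + 6 * p\<^sup>2) + 2 * Z * (q + 2 * p)\<^sup>2
      - 2 * (1 + 2 * y * p) / y - 2 * Z * (1 + 2 * y * p) * (q + 2 * p) / y + 2 * Z / y\<^sup>2 = (- 6 * (M + 2) / M) * p\<^sup>2"
proof -
  define V where "V = 2 * (M + 1) - M * y"
  have nz: "y \<noteq> 0" "M \<noteq> 0" "R \<noteq> 0" "V \<noteq> 0" "M + 2 \<noteq> 0" using assms by (auto simp: V_def R_def)
  show "4 - 2 * (M + 2) * Z / y - 2 * (M + 2) * (1 + 2 * y * p) - 2 * (M + 2) * Z * (q * (1 + 2 * y * p) + 4 * p + 6 * y * p\<^sup>2)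
      = (- 6 * (M + 2) / M) * ((M + 2) * y * p\<^sup>2)"
    unfolding Z_def q_def q'_def p_def V_def[symmetric] using nz
    apply (simp add: divide_simps)
    unfolding R_def V_def by algebra
  \<comment> \<open>With the inverses \<open>a\<close> and \<open>k\<close> as atoms, the left sides
    of the last two equations both reduce to that of \<open>main\<close>, so that denominators are
    cleared only in this short identity.\<close>
  define a where "a = 1 / y"
  define k where "k = 1 / R"
  have a: "a * y = 1" and div_y: "x / y = x * a" "x / y\<^sup>2 = x * a\<^sup>2" for x
    using nz by (simp_all add: a_def power_divide)
  have q: "q = - M * k - a" and q': "q' = M * k\<^sup>2 + a\<^sup>2"
    by (simp_all add: q_def q'_def a_def k_def power_divide)
  have main: "2 * M * k - 8 * p + Z * (- 2 * M * (M + 1) * k\<^sup>2 - 2 * M * a * k + 8 * M * k * p + 4 * a * p - 12 * p\<^sup>2)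
    = (- 6 * (M + 2) / M) * p\<^sup>2"
    unfolding Z_def p_def V_def[symmetric] a_def k_def using nz
    apply (simp add: divide_simps)
    unfolding R_def V_def by algebra
  have "- 2 * (q + 2 * p) - 2 * Z * (2 * q * (q + 2 * p) + q' + 2 * q * p + 6 * p\<^sup>2) + 2 * Z * (q + 2 * p)\<^sup>2
      - 2 * (1 + 2 * y * p) * a - 4 * Z * (q * (1 + 2 * y * p) + 4 * p + 6 * y * p\<^sup>2) * a
      + 2 * Z * (1 + 2 * y * p)\<^sup>2 * a\<^sup>2 + 2 * Z * (1 + 2 * y * p) * (q + 2 * p) * a
    = 2 * M * k - 8 * p + Z * (- 2 * M * (M + 1) * k\<^sup>2 - 2 * M * a * k + 8 * M * k * p + 4 * a * p - 12 * p\<^sup>2)"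
    unfolding q q' using a by algebra
  then show "- 2 * (q + 2 * p) - 2 * Z * (2 * q * (q + 2 * p) + q' + 2 * q * p + 6 * p\<^sup>2) + 2 * Z * (q + 2 * p)\<^sup>2
      - 2 * (1 + 2 * y * p) / y - 4 * Z * (q * (1 + 2 * y * p) + 4 * p + 6 * y * p\<^sup>2) / y
      + 2 * Z * (1 + 2 * y * p)\<^sup>2 / y\<^sup>2 + 2 * Z * (1 + 2 * y * p) * (q + 2 * p) / y = (- 6 * (M + 2) / M) * p\<^sup>2"
    unfolding div_y main .
  have "- 2 * (q + 2 * p) - 2 * Z * (2 * q * (q + 2 * p) + q' + 2 * q * p + 6 * p\<^sup>2) + 2 * Z * (q + 2 * p)\<^sup>2
      - 2 * (1 + 2 * y * p) * a - 2 * Z * (1 + 2 * y * p) * (q + 2 * p) * a + 2 * Z * a\<^sup>2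
    = 2 * M * k - 8 * p + Z * (- 2 * M * (M + 1) * k\<^sup>2 - 2 * M * a * k + 8 * M * k * p + 4 * a * p - 12 * p\<^sup>2)"
    unfolding q q' using a by algebra
  then show "- 2 * (q + 2 * p) - 2 * Z * (2 * q * (q + 2 * p) + q' + 2 * q * p + 6 * p\<^sup>2) + 2 * Z * (q + 2 * p)\<^sup>2
      - 2 * (1 + 2 * y * p) / y - 2 * Z * (1 + 2 * y * p) * (q + 2 * p) / y + 2 * Z / y\<^sup>2 = (- 6 * (M + 2) / M) * p\<^sup>2"
    unfolding div_y main .
qed

text \<open>The same Ricci expressions for \<open>w = 1\<close>, combined to the scalar
  curvature.\<close>

lemma scalar_flat_identity:
  fixes y M :: real
  assumes "y > 0" "M > 0"
  defines "R \<equiv> y + M + 1"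
  defines "Z \<equiv> (y - 1) * R / ((M + 2) * y)"
    and "q \<equiv> - M / R - 1 / y" and "q' \<equiv> M / R\<^sup>2 + 1 / y\<^sup>2"
  shows "2 * (4 - 2 * (M + 2) * Z / y - 2 * (M + 2) - 2 * (M + 2) * Z * q) / ((M + 2) * y)
    + ((- 2 * q - 2 * Z * (2 * q * q + q') + 2 * Z * q\<^sup>2 - 2 / y - 4 * Z * q / y + 2 * Z / y\<^sup>2 + 2 * Z * q / y)
    + (- 2 * q - 2 * Z * (2 * q * q + q') + 2 * Z * q\<^sup>2 - 2 / y - 2 * Z * q / y + 2 * Z / y\<^sup>2)) = 0"
proof -
  have nz: "y \<noteq> 0" "M \<noteq> 0" "R \<noteq> 0" "M + 2 \<noteq> 0" using assms by (auto simp: R_def)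
  show ?thesis
    unfolding Z_def q_def q'_def using nz
    apply (simp add: divide_simps)
    unfolding R_def by algebra
qed

context conformal_momentum
begin

text \<open>The diagonal Ricci entries as functions of \<open>s\<close> alone: \<open>_z\<close> for
  the base, \<open>_u\<close> for the radial and \<open>_v\<close> for the angular fibre direction,
  the last two with a factor \<open>slope\<close> taken out.\<close>

definition normalized_ricci_z :: "real \<Rightarrow> real" where
  "normalized_ricci_z s = (let Z = (s - 1) * (s + real n - 1) / (real n * s); q = curvature_factor s; \<alpha> = w1 s / w s; \<beta> = w2 s / w s in
     4 - 2 * real n * Z / s - 2 * real n * (1 + s * \<alpha>) - 2 * real n * Z * (q * (1 + s * \<alpha>) + 2 * \<alpha> + s * \<beta>))"

definition normalized_ricci_u :: "real \<Rightarrow> real" where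
  "normalized_ricci_u s = (let Z = (s - 1) * (s + real n - 1) / (real n * s); q = curvature_factor s; \<alpha> = w1 s / w s; \<beta> = w2 s / w s;
       q' = real (n - 2) / (s + real n - 1)\<^sup>2 + 1 / s\<^sup>2 in
     - 2 * (q + \<alpha>) - 2 * Z * (2 * q * (q + \<alpha>) + q' + q * \<alpha> + \<beta>) + 2 * Z * (q + \<alpha>)\<^sup>2
      - 2 * (1 + s * \<alpha>) / s - 4 * Z * (q * (1 + s * \<alpha>) + 2 * \<alpha> + s * \<beta>) / s
      + 2 * Z * (1 + s * \<alpha>)\<^sup>2 / s\<^sup>2 + 2 * Z * (1 + s * \<alpha>) * (q + \<alpha>) / s)"

definition normalized_ricci_v :: "real \<Rightarrow> real" where
  "normalized_ricci_v s = (let Z = (s - 1) * (s + real n - 1) / (real n * s); q = curvature_factor s; \<alpha> = w1 s / w s; \<beta> = w2 s / w s;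
       q' = real (n - 2) / (s + real n - 1)\<^sup>2 + 1 / s\<^sup>2 in
     - 2 * (q + \<alpha>) - 2 * Z * (2 * q * (q + \<alpha>) + q' + q * \<alpha> + \<beta>) + 2 * Z * (q + \<alpha>)\<^sup>2
      - 2 * (1 + s * \<alpha>) / s - 2 * Z * (1 + s * \<alpha>) * (q + \<alpha>) / s + 2 * Z / s\<^sup>2)"

text \<open>Up to one overall factor, the fibre norm \<open>X\<close> and \<open>slope\<close> occur
  only in the product \<open>X * slope s\<close>, which \<open>fibre_slope\<close> turns into the
  rational function \<open>Z\<close>.\<close>

lemma ricci_normalized:
  assumes t: "t\<^sup>2 \<in> I"
  defines "X \<equiv> t\<^sup>2" and "s \<equiv> momentum (t\<^sup>2)"
  shows "4 - 2 * (real n)\<^sup>2 * X * cb X / cA X - 2 * cA1 X / cb X - 2 * X * cA2 X / cb X = normalized_ricci_z s" (is ?z)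
    and "- 2 * cb1 X / cb X - 2 * X * cb2 X / cb X + 2 * X * (cb1 X)\<^sup>2 / (cb X)\<^sup>2
   - 2 * cA1 X / cA X - 4 * X * cA2 X / cA X + 2 * X * (cA1 X)\<^sup>2 / (cA X)\<^sup>2 + 2 * X * cA1 X * cb1 X / (cA X * cb X)
     = slope s * normalized_ricci_u s" (is ?u)
    and "- 2 * cb1 X / cb X - 2 * X * cb2 X / cb X + 2 * X * (cb1 X)\<^sup>2 / (cb X)\<^sup>2
   - 2 * cA1 X / cA X - 2 * X * cA1 X * cb1 X / (cA X * cb X) + 2 * (real n)\<^sup>2 * X * (cb X)\<^sup>2 / (cA X)\<^sup>2
     = slope s * normalized_ricci_v s" (is ?v)
proof -
  define D where "D = slope s"
  define Z where "Z = (s - 1) * (s + real n - 1) / (real n * s)"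
  define q where "q = curvature_factor s"
  define q' where "q' = real (n - 2) / (s + real n - 1)\<^sup>2 + 1 / s\<^sup>2"
  define \<alpha> where "\<alpha> = w1 s / w s"
  define \<beta> where "\<beta> = w2 s / w s"
  have s: "s > 0" "s \<in> T" using momentum_I[OF t] by (simp_all add: s_def)
  have w: "w s > 0" using w_pos s by simp
  have D: "D > 0" using slope_pos s by (simp add: D_def)
  have Z: "X * D = Z" using fibre_slope[OF momentum_I(3)[OF t]] by (simp add: D_def Z_def X_def s_def)
  have N: "real n > 0" using n by simp
  have sX: "momentum X = s" by (simp add: X_def s_def)
  \<comment> \<open>\<open>P\<close>, \<open>Q\<close>, \<open>U\<close>, \<open>W\<close> are
    \<open>cA1\<close>, \<open>cb1\<close>, \<open>cA2\<close>, \<open>cb2\<close> with the powers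
    of \<open>slope\<close>, the factor \<open>w\<close> and, for the first and third,
    \<open>n\<close> divided out.\<close>
  define P where "P = 1 + s * \<alpha>"
  define Q where "Q = q + \<alpha>"
  define U where "U = q * P + 2 * \<alpha> + s * \<beta>"
  define W where "W = 2 * q * Q + q' + q * \<alpha> + \<beta>"
  have A: "cA X = real n * (s * w s)" and b: "cb X = D * w s"
    and A1: "cA1 X = real n * D * w s * P"
    and b1: "cb1 X = D * D * w s * Q"
    and A2: "cA2 X = real n * D * D * w s * U"
    using w unfolding P_def Q_def U_def
    by (simp_all add: sX cA_def cb_def cA1_def cb1_def cA2_def D_def[symmetric] q_def[symmetric]
        \<alpha>_def \<beta>_def field_simps power2_eq_square)
  have b2: "cb2 X = D * D * D * w s * W"
    unfolding cb2_def sX D_def[symmetric] q_def[symmetric] q'_def[symmetric] W_def Q_def \<alpha>_def \<beta>_def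
    using w by (simp add: field_simps power3_eq_cube)
  have e1: "2 * (real n)\<^sup>2 * X * cb X / cA X = 2 * real n * Z / s" "2 * cA1 X / cb X = 2 * real n * P" "2 * X * cA2 X / cb X = 2 * real n * Z * U"
    unfolding Z[symmetric] A b A1 A2 using s w D N by (simp_all add: field_simps power2_eq_square)
  show ?z unfolding e1 normalized_ricci_z_def Let_def Z_def[symmetric] q_def[symmetric] \<alpha>_def[symmetric] \<beta>_def[symmetric]
    by (simp add: P_def U_def)
  have e2: "- 2 * cb1 X / cb X = D * (- 2 * Q)" "2 * X * cb2 X / cb X = D * (2 * Z * W)" "2 * X * (cb1 X)\<^sup>2 / (cb X)\<^sup>2 = D * (2 * Z * Q\<^sup>2)"
    "2 * cA1 X / cA X = D * (2 * P / s)" "4 * X * cA2 X / cA X = D * (4 * Z * U / s)" "2 * X * (cA1 X)\<^sup>2 / (cA X)\<^sup>2 = D * (2 * Z * P\<^sup>2 / s\<^sup>2)"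
    "2 * X * cA1 X * cb1 X / (cA X * cb X) = D * (2 * Z * P * Q / s)" "2 * (real n)\<^sup>2 * X * (cb X)\<^sup>2 / (cA X)\<^sup>2 = D * (2 * Z / s\<^sup>2)"
    unfolding Z[symmetric] A b A1 A2 b1 b2 using s w D N by (simp_all add: field_simps power2_eq_square)
  show ?u unfolding e2 normalized_ricci_u_def Let_def Z_def[symmetric] q_def[symmetric] q'_def[symmetric] \<alpha>_def[symmetric] \<beta>_def[symmetric] D_def[symmetric]
    unfolding P_def[symmetric] Q_def[symmetric]
    unfolding U_def[symmetric] W_def[symmetric] by (simp add: algebra_simps)
  show ?v unfolding e2 normalized_ricci_v_def Let_def Z_def[symmetric] q_def[symmetric] q'_def[symmetric] \<alpha>_def[symmetric] \<beta>_def[symmetric] D_def[symmetric]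
    unfolding P_def[symmetric] Q_def[symmetric]
    unfolding U_def[symmetric] W_def[symmetric] by (simp add: algebra_simps)
qed

lemma einsteinI:
  assumes "\<And>s. s \<in> T \<Longrightarrow> normalized_ricci_z s = c * (real n * s * w s)"
    and "\<And>s. s \<in> T \<Longrightarrow> normalized_ricci_u s = c * w s" and "\<And>s. s \<in> T \<Longrightarrow> normalized_ricci_v s = c * w s"
    and x: "fibre_norm n x \<in> I"
  shows "ricci (calabi n cA cb) x = c *\<^sub>R calabi n cA cb x"
proof (rule calabi_einsteinI[OF _ metric_on_I _ x])
  show "n \<ge> 1" using n by simp
  fix t :: real assume tI: "t\<^sup>2 \<in> I"
  interpret calabi_base_point n cA cb "{x. fibre_norm n x \<in> I}" I t cA1 cb1 "cA2 (t\<^sup>2)" "cb2 (t\<^sup>2)"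
    by (rule calabi_base_point_I[OF tI])
  have s: "momentum (t\<^sup>2) \<in> T" using momentum_I[OF tI] by simp
  show "ricci (calabi n cA cb) (base_point t) = c *\<^sub>R calabi n cA cb (base_point t)"
    by (rule einstein_at_base_point; unfold ricci_normalized[OF tI] assms(1-3)[OF s]) (simp_all add: cA_def cb_def)
qed

lemma scalar_flatI:
  assumes "\<And>s. s \<in> T \<Longrightarrow> 2 * normalized_ricci_z s / (real n * s) + (normalized_ricci_u s + normalized_ricci_v s) = 0"
    and x: "fibre_norm n x \<in> I"
  shows "scalar_curvature (calabi n cA cb) x = 0"
proof (rule calabi_scalar_curvatureI[OF _ metric_on_I _ x])
  show "n \<ge> 1" using n by simp
  fix t :: real assume tI: "t\<^sup>2 \<in> I"
  interpret calabi_base_point n cA cb "{x. fibre_norm n x \<in> I}" I t cA1 cb1 "cA2 (t\<^sup>2)" "cb2 (t\<^sup>2)"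
    by (rule calabi_base_point_I[OF tI])
  define s where "s = momentum (t\<^sup>2)"
  have s: "s \<in> T" "s > 0" using momentum_I[OF tI] by (simp_all add: s_def)
  have "scalar_curvature (calabi n cA cb) (base_point t) =
     (2 * normalized_ricci_z s / (real n * s) + (normalized_ricci_u s + normalized_ricci_v s)) / w s"
    unfolding scalar_curvature_base_point ricci_11 ricci_22 ricci_33 ricci_44 ricci_normalized[OF tI] s_def[symmetric]
    using s slope_pos[OF s(2)] w_pos[OF s(1)] n by (simp add: cA_def cb_def s_def[symmetric] field_simps)
  then show "scalar_curvature (calabi n cA cb) (base_point t) = 0" using assms(1)[OF s(1)] by simp
qed

end

section \<open>The scalar-flat metric and the Einstein metric\<close>

lemma DERIV_inverse_power_diff:
  fixes a c s :: real
  assumes "s \<noteq> c"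
  shows "((\<lambda>s. a / (c - s) ^ Suc k) has_real_derivative real (Suc k) * a / (c - s) ^ Suc (Suc k)) (at s)"
proof -
  have "(a * (real (Suc k) * v ^ k)) / (v ^ Suc k * v ^ Suc k) = real (Suc k) * a / v ^ Suc (Suc k)" if "v \<noteq> 0" for v
    using that by (simp add: field_simps)
  then show ?thesis using assms by (auto intro!: derivative_eq_intros simp del: power_Suc)
qed

lemma calabi_scale: "calabi n (\<lambda>r. f r * A r) (\<lambda>r. f r * b r) x = f (fibre_norm n x) *\<^sub>R calabi n A b x"
  by (simp add: vec_eq_iff forall_4 calabi_entries calabi_z_def calabi_w_def calabi_re_def calabi_im_def algebra_simps)

context momentum_profile
begin

text \<open>The conformal boundary of the Einstein metric lies at \<open>s = end_momentum\<close>.\<close>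

definition end_momentum :: real where
  "end_momentum = 2 * (real n - 1) / (real n - 2)"

definition lebrun :: "real^4 \<Rightarrow> real^4^4" where
  "lebrun = calabi n (\<lambda>r. n * momentum r) (\<lambda>r. slope (momentum r))"

definition distance :: "real^4 \<Rightarrow> real" where
  "distance x = end_momentum - momentum (fibre_norm n x)"

definition poincare :: "real^4 \<Rightarrow> real^4^4" where
  "poincare x = (1 / (distance x)\<^sup>2) *\<^sub>R lebrun x"

text \<open>The zero section has \<open>s = 1\<close>, so it lies inside the region
  \<open>s < c\<close>.\<close>

lemma end_momentum_gt: "end_momentum > 2"
  using n by (simp add: end_momentum_def field_simps)

lemma Cinf_on_distance: "Cinf_on UNIV distance"
  unfolding distance_def[abs_def] by (intro Cinf_on_diff Cinf_on_const Cinf_on_momentum) simp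

lemma momentum_fibre_norm_pos: "momentum (fibre_norm n x) > 0"
  using momentum(1)[OF nonneg_in_J[OF fibre_norm_nonneg]] .

interpretation lb: conformal_momentum n "\<lambda>_. 1" "\<lambda>_. 0" "\<lambda>_. 0" "{0<..}"
  by unfold_locales (auto simp: momentum_fibre_norm_pos Cinf_on_const)

lemma lebrun_eq: "lebrun = calabi n lb.cA lb.cb"
  by (simp add: lebrun_def lb.cA_def[abs_def] lb.cb_def[abs_def])

lemma lb_I: "fibre_norm n x \<in> lb.I"
  by (simp add: lb.fibre_norm_in_I momentum_fibre_norm_pos)

lemma metric_on_lebrun: "metric_on UNIV lebrun"
  using lb.metric_on_I lb_I by (simp add: lebrun_eq)

lemma n_M: "real n = real (n - 2) + 2" "real (n - 2) > 0"
  using n by auto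

lemma lebrun_scalar_flat: "scalar_curvature lebrun x = 0"
  unfolding lebrun_eq
proof (rule lb.scalar_flatI[OF _ lb_I])
  fix s :: real assume "s \<in> {0<..}"
  then have "s > 0" by simp
  define M where "M = real (n - 2)"
  have M: "real n = M + 2" "M > 0" "real (n - 2) = M" using n_M by (simp_all add: M_def)
  have R: "s + (M + 2) - 1 = s + M + 1" by simp
  show "2 * lb.normalized_ricci_z s / (real n * s) + (lb.normalized_ricci_u s + lb.normalized_ricci_v s) = 0"
    unfolding lb.normalized_ricci_z_def lb.normalized_ricci_u_def lb.normalized_ricci_v_def Let_def curvature_factor_def M R
    using scalar_flat_identity[OF \<open>s > 0\<close> M(2)] by simp
qed

interpretation pe: conformal_momentum n "\<lambda>s. 1 / (end_momentum - s)\<^sup>2" "\<lambda>s. 2 / (end_momentum - s) ^ 3"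
    "\<lambda>s. 6 / (end_momentum - s) ^ 4" "{0<..<end_momentum}"
proof
  show "((\<lambda>s. 1 / (end_momentum - s)\<^sup>2) has_real_derivative 2 / (end_momentum - s) ^ 3) (at s)"
    if "s \<in> {0<..<end_momentum}" for s
    using that DERIV_inverse_power_diff[of s end_momentum 1 1] by (simp add: numeral_2_eq_2 numeral_3_eq_3)
  show "((\<lambda>s. 2 / (end_momentum - s) ^ 3) has_real_derivative 6 / (end_momentum - s) ^ 4) (at s)"
    if "s \<in> {0<..<end_momentum}" for s
    using that DERIV_inverse_power_diff[of s end_momentum 2 2] by (simp add: eval_nat_numeral)
  have o: "open {x :: real^4. momentum (fibre_norm n x) \<in> {0<..<end_momentum}}"
  proof -
    have "{x :: real^4. momentum (fibre_norm n x) \<in> {0<..<end_momentum}} = (\<lambda>x. momentum (fibre_norm n x)) -` {0<..<end_momentum}"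
      by auto
    then show ?thesis using continuous_open_vimage[OF open_greaterThanLessThan, of "\<lambda>x. momentum (fibre_norm n x)"]
        Cinf_on_continuous[OF Cinf_on_momentum] by (simp add: continuous_on_eq_continuous_at)
  qed
  have d: "Cinf_on {x. momentum (fibre_norm n x) \<in> {0<..<end_momentum}} distance"
    using Cinf_on_subset[OF Cinf_on_distance _ o] by simp
  have "Cinf_on {x. momentum (fibre_norm n x) \<in> {0<..<end_momentum}} (\<lambda>x. 1 / (distance x)\<^sup>2)"
    by (intro Cinf_on_divide Cinf_on_power Cinf_on_const o d) (auto simp: distance_def)
  then show "Cinf_on {x. momentum (fibre_norm n x) \<in> {0<..<end_momentum}} (\<lambda>x. 1 / (end_momentum - momentum (fibre_norm n x))\<^sup>2)"
    by (simp add: distance_def)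
qed (auto simp: n)

lemma poincare_eq: "poincare = calabi n pe.cA pe.cb"
proof
  fix x
  have "pe.cA = (\<lambda>r. (1 / (end_momentum - momentum r)\<^sup>2) * (n * momentum r))"
    "pe.cb = (\<lambda>r. (1 / (end_momentum - momentum r)\<^sup>2) * slope (momentum r))"
    by (simp_all add: pe.cA_def[abs_def] pe.cb_def[abs_def])
  then show "poincare x = calabi n pe.cA pe.cb x" by (simp only: calabi_scale poincare_def lebrun_def distance_def)
qed

lemma pe_I: "fibre_norm n x \<in> pe.I \<longleftrightarrow> momentum (fibre_norm n x) < end_momentum"
  by (simp add: pe.fibre_norm_in_I momentum_fibre_norm_pos)

lemma metric_on_poincare: "metric_on {x. momentum (fibre_norm n x) < end_momentum} poincare"
  using pe.metric_on_I by (simp add: poincare_eq pe_I)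

lemma poincare_einstein_local:
  assumes "momentum (fibre_norm n x) < end_momentum"
  shows "ricci poincare x = (- 6 * real n / real (n - 2)) *\<^sub>R poincare x"
  unfolding poincare_eq
proof (rule pe.einsteinI)
  show "fibre_norm n x \<in> pe.I" using assms by (simp add: pe_I)
  fix s :: real assume "s \<in> {0<..<end_momentum}"
  then have s: "s > 0" "s < end_momentum" by auto
  define M where "M = real (n - 2)"
  have M: "real n = M + 2" "M > 0" "real (n - 2) = M" using n_M by (simp_all add: M_def)
  have R: "s + (M + 2) - 1 = s + M + 1" by simp
  have end_eq: "end_momentum = 2 * (M + 1) / M" by (simp add: end_momentum_def M)
  have V: "2 * (M + 1) - M * s > 0" using s(2) M(2) unfolding end_eq by (simp add: field_simps)
  define p where "p = M / (2 * (M + 1) - M * s)"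
  have v: "1 / (end_momentum - s) = p" and v0: "end_momentum - s \<noteq> 0"
    using V M(2) s(2) by (simp_all add: p_def end_eq field_simps)
  have w: "1 / (end_momentum - s)\<^sup>2 = p\<^sup>2" by (simp add: v[symmetric] power_divide)
  have al: "(2 / (end_momentum - s) ^ 3) / (1 / (end_momentum - s)\<^sup>2) = 2 * p"
    and be: "(6 / (end_momentum - s) ^ 4) / (1 / (end_momentum - s)\<^sup>2) = 6 * p\<^sup>2"
  proof -
    have "(2 / u ^ 3) / (1 / u\<^sup>2) = 2 * (1 / u)" "(6 / u ^ 4) / (1 / u\<^sup>2) = 6 * (1 / u)\<^sup>2" if "u \<noteq> 0" for u :: real
      using that by (simp_all add: power2_eq_square power3_eq_cube power4_eq_xxxx field_simps)
    from this[OF v0] show "(2 / (end_momentum - s) ^ 3) / (1 / (end_momentum - s)\<^sup>2) = 2 * p"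
      "(6 / (end_momentum - s) ^ 4) / (1 / (end_momentum - s)\<^sup>2) = 6 * p\<^sup>2" unfolding v by simp_all
  qed
  note id = einstein_identities[OF s(1) M(2) V, folded p_def]
  note defs = pe.normalized_ricci_z_def pe.normalized_ricci_u_def pe.normalized_ricci_v_def Let_def
  show "pe.normalized_ricci_z s = (- 6 * real n / real (n - 2)) * (real n * s * (1 / (end_momentum - s)\<^sup>2))"
    unfolding defs unfolding al be unfolding w curvature_factor_def M R using id(1) by (simp add: mult_ac)
  show "pe.normalized_ricci_u s = (- 6 * real n / real (n - 2)) * (1 / (end_momentum - s)\<^sup>2)"
    unfolding defs unfolding al be unfolding w curvature_factor_def M R using id(2) by (simp add: mult_ac)
  show "pe.normalized_ricci_v s = (- 6 * real n / real (n - 2)) * (1 / (end_momentum - s)\<^sup>2)"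
    unfolding defs unfolding al be unfolding w curvature_factor_def M R using id(3) by (simp add: mult_ac)
qed

text \<open>On the zero section \<open>s = 1\<close> and \<open>slope 1 = 1\<close>. The scalar-flat
  metric satisfies the Kaehler relation \<open>A' = n b\<close>; the factor \<open>w\<close> adds
  \<open>n w'(1) > 0\<close> to the left side, so the squares of \<open>A'\<close> and
  \<open>n b\<close> differ.\<close>

lemma poincare_not_kaehler_at_zero:
  assumes L: "L ** L = - mat 1" and comm: "\<And>i j. L ** curvature poincare i j (base_point 0) = curvature poincare i j (base_point 0) ** L"
  shows False
proof -
  have m0: "momentum 0 = 1" using momentum_fibre_of[of 1] by (simp add: fibre_of_def)
  have I: "0\<^sup>2 \<in> pe.I" using pe.in_I_iff[of 0] end_momentum_gt by (simp add: m0)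
  interpret calabi_base_point n pe.cA pe.cb "{x. fibre_norm n x \<in> pe.I}" pe.I 0 pe.cA1 pe.cb1 "pe.cA2 (0\<^sup>2)" "pe.cb2 (0\<^sup>2)"
    by (rule pe.calabi_base_point_I[OF I])
  have sl: "slope 1 = 1" using n by (simp add: slope_def)
  have v: "end_momentum - 1 > 0" using end_momentum_gt by simp
  have "pe.cA1 (0\<^sup>2) > n * pe.cb (0\<^sup>2)" "n * pe.cb (0\<^sup>2) > 0"
  proof -
    have "real n * (2 / (end_momentum - 1) ^ 3) > 0" "real n > 0" using n v by simp_all
    then show "pe.cA1 (0\<^sup>2) > n * pe.cb (0\<^sup>2)" "n * pe.cb (0\<^sup>2) > 0"
      using v by (simp_all add: pe.cA1_def pe.cb_def m0 sl distrib_left)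
  qed
  then have ne: "(pe.cA1 (0\<^sup>2))\<^sup>2 \<noteq> (n * pe.cb (0\<^sup>2))\<^sup>2" by (simp add: power2_eq_iff)
  show False using no_complex_structure_commutes[OF refl ne L] comm by (simp add: poincare_eq)
qed

end

section \<open>The Kaehler form\<close>

text \<open>Multiplication of \<open>z\<close> and \<open>w\<close> by the imaginary unit, in real
  coordinates.\<close>

definition standard_J :: "real^4^4" where
  "standard_J = (\<chi> i j. if (i, j) = (2, 1) \<or> (i, j) = (4, 3) then 1 else if (i, j) = (1, 2) \<or> (i, j) = (3, 4) then - 1 else 0)"

lemma standard_J_sq: "standard_J ** standard_J = - mat 1"
  by (simp add: vec_eq_iff forall_4 matrix_matrix_mult_def sum_4 standard_J_def mat_def)

lemma standard_J_calabi: "transpose standard_J ** calabi n A b x =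
  (\<chi> i j. if i = 1 then calabi n A b x $ 2 $ j else if i = 2 then - calabi n A b x $ 1 $ j
     else if i = 3 then calabi n A b x $ 4 $ j else - calabi n A b x $ 3 $ j)"
  by (simp add: vec_eq_iff forall_4 matrix_matrix_mult_def sum_4 standard_J_def transpose_def)

lemma standard_J_compatible: "transpose standard_J ** calabi n A b x ** standard_J = calabi n A b x"
  unfolding standard_J_calabi
  by (simp add: vec_eq_iff forall_4 matrix_matrix_mult_def sum_4 standard_J_def calabi_entries)

lemma fibre_norm_has_derivative:
  "(fibre_norm n has_derivative (\<lambda>u. base_norm x ^ n * (2 * x$3 * u$3 + 2 * x$4 * u$4)
     + n * base_norm x ^ (n - 1) * (2 * x$1 * u$1 + 2 * x$2 * u$2) * ((x$3)\<^sup>2 + (x$4)\<^sup>2))) (at x)"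
proof -
  have coord: "((\<lambda>y. y $ i) has_derivative (\<lambda>u. u $ i)) (at x)" for i :: 4
    by (rule bounded_linear_imp_has_derivative[OF bounded_linear_vec_nth])
  have hE: "(base_norm has_derivative (\<lambda>u. 2 * x$1 * u$1 + 2 * x$2 * u$2)) (at x)"
    unfolding base_norm_def[abs_def] by (auto intro!: derivative_eq_intros coord)
  show ?thesis unfolding fibre_norm_def[abs_def]
    by (rule has_derivative_eq_rhs, rule has_derivative_mult[OF has_derivative_power[OF hE]])
       (auto intro!: derivative_eq_intros coord simp: mult_ac)
qed

text \<open>The fundamental form is \<open>A\<close> times the base form plus \<open>b E^n\<close>
  times the form of the vertical part. The relation \<open>A' = n b\<close> balances the
  differential of \<open>A\<close> against the curvature of the Chern connection, which is
  \<open>n\<close> times the base form up to normalization.\<close>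

lemma calabi_closed:
  fixes A b :: "real \<Rightarrow> real"
  assumes n: "n \<ge> 2"
    and A: "(A has_real_derivative real n * b (fibre_norm n x)) (at (fibre_norm n x))"
    and b: "(b has_real_derivative b') (at (fibre_norm n x))"
  shows "closed_2form (\<lambda>y. transpose standard_J ** calabi n A b y) x"
proof -
  \<comment> \<open>With \<open>e = E ^ m\<close> the powers \<open>E ^ n\<close> and
    \<open>E ^ (n - 1)\<close> become \<open>E^2 e\<close> and \<open>E e\<close>, which keeps
    truncated subtraction out of the exponents.\<close>
  obtain m where m: "n = Suc (Suc m)" using n by (metis Suc_le_D numeral_2_eq_2 Suc_le_mono)
  define E where "E = base_norm x"
  define e where "e = E ^ m"
  define B where "B = b (fibre_norm n x)"
  define r where "r = (x$3)\<^sup>2 + (x$4)\<^sup>2"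
  have E: "E = 1 + (x$1)\<^sup>2 + (x$2)\<^sup>2" by (simp add: E_def base_norm_def)
  have E0: "E > 0" using base_norm_pos[of x] by (simp add: E_def)
  have h: "fibre_norm n x = E\<^sup>2 * e * r" by (simp add: fibre_norm_def E_def[symmetric] e_def m r_def power2_eq_square)
  define dE where "dE u = 2 * x$1 * u$1 + 2 * x$2 * u$2" for u :: "real^4"
  define dh where "dh u = n * (E * e) * dE u * r + E\<^sup>2 * e * (2 * x$3 * u$3 + 2 * x$4 * u$4)" for u :: "real^4"
  have coord: "((\<lambda>y. y $ i) has_derivative (\<lambda>u. u $ i)) (at x)" for i :: 4
    by (rule bounded_linear_imp_has_derivative[OF bounded_linear_vec_nth])
  have hE: "(base_norm has_derivative dE) (at x)"
    unfolding base_norm_def[abs_def] dE_def[abs_def] by (auto intro!: derivative_eq_intros coord)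
  have hpow: "((\<lambda>y. base_norm y ^ k) has_derivative (\<lambda>u. k * E ^ (k - 1) * dE u)) (at x)" for k
    using has_derivative_power[OF hE, of k] by (simp add: E_def mult_ac)
  have hh: "(fibre_norm n has_derivative dh) (at x)"
  proof (rule has_derivative_eq_rhs[OF fibre_norm_has_derivative])
    show "(\<lambda>u. base_norm x ^ n * (2 * x$3 * u$3 + 2 * x$4 * u$4)
      + n * base_norm x ^ (n - 1) * (2 * x$1 * u$1 + 2 * x$2 * u$2) * ((x$3)\<^sup>2 + (x$4)\<^sup>2)) = dh"
      by (rule ext) (simp add: dh_def dE_def E_def[symmetric] e_def m r_def power2_eq_square algebra_simps)
  qed
  have hA: "((\<lambda>y. A (fibre_norm n y)) has_derivative (\<lambda>u. n * B * dh u)) (at x)"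
    and hb: "((\<lambda>y. b (fibre_norm n y)) has_derivative (\<lambda>u. b' * dh u)) (at x)"
    using has_derivative_compose[OF hh, of A] has_derivative_compose[OF hh, of b] A b
    by (simp_all add: has_field_derivative_def B_def)
  define P where "P = x$3 * x$1 + x$4 * x$2"
  define S where "S = x$4 * x$1 - x$3 * x$2"
  have w: "(calabi_w n b has_derivative (\<lambda>u. E\<^sup>2 * e * (b' * dh u) + n * (E * e) * dE u * B)) (at x)"
    unfolding calabi_w_def[abs_def]
    by (rule has_derivative_eq_rhs, rule has_derivative_mult[OF hpow hb])
       (simp add: fun_eq_iff E_def[symmetric] e_def m B_def[unfolded m] power2_eq_square mult_ac)
  have prod: "((\<lambda>y. real n * base_norm y ^ (n - 1) * b (fibre_norm n y)) has_derivative
      (\<lambda>u. n * (E * e) * (b' * dh u) + n * ((n - 1) * e * dE u) * B)) (at x)"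
    by (rule has_derivative_eq_rhs, rule has_derivative_mult[OF has_derivative_mult_right[OF hpow] hb])
       (simp add: fun_eq_iff E_def[symmetric] e_def m B_def[unfolded m] mult_ac)
  have re: "(calabi_re n b has_derivative (\<lambda>u. n * (E * e) * B * (x$3 * u$1 + u$3 * x$1 + (x$4 * u$2 + u$4 * x$2))
      + (n * (E * e) * (b' * dh u) + n * ((n - 1) * e * dE u) * B) * P)) (at x)"
    unfolding calabi_re_def[abs_def]
    by (rule has_derivative_eq_rhs, rule has_derivative_mult[OF prod], (rule has_derivative_add has_derivative_mult coord)+)
       (simp add: fun_eq_iff E_def[symmetric] e_def m B_def[unfolded m] P_def mult_ac)
  have im: "(calabi_im n b has_derivative (\<lambda>u. n * (E * e) * B * (x$4 * u$1 + u$4 * x$1 - (x$3 * u$2 + u$3 * x$2))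
      + (n * (E * e) * (b' * dh u) + n * ((n - 1) * e * dE u) * B) * S)) (at x)"
    unfolding calabi_im_def[abs_def]
    by (rule has_derivative_eq_rhs, rule has_derivative_mult[OF prod], (rule has_derivative_diff has_derivative_mult coord)+)
       (simp add: fun_eq_iff E_def[symmetric] e_def m B_def[unfolded m] S_def mult_ac)
  have base: "((\<lambda>y. ((y$1)\<^sup>2 + (y$2)\<^sup>2) * fibre_norm n y) has_derivative (\<lambda>u. ((x$1)\<^sup>2 + (x$2)\<^sup>2) * dh u + dE u * (E\<^sup>2 * e * r))) (at x)"
    unfolding h[symmetric] by (rule has_derivative_mult[OF _ hh]) (auto intro!: derivative_eq_intros coord simp: dE_def)
  have "(base_norm x)\<^sup>2 \<noteq> 0" using E0 by (simp add: E_def)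
  note hz = has_derivative_mult[OF has_derivative_add[OF hA has_derivative_mult[OF has_derivative_mult_right[OF base, of "(real n)\<^sup>2"] hb]]
      Deriv.has_derivative_inverse[OF this hpow[of 2]], folded calabi_z_def]
  have pz: "partial i (calabi_z n A b) x = (n * B * dh (axis i 1) + (real n)\<^sup>2 * (((x$1)\<^sup>2 + (x$2)\<^sup>2) * (dh (axis i 1) * B + E\<^sup>2 * e * r * (b' * dh (axis i 1))))) / E\<^sup>2"
    if "i = 3 \<or> i = 4" for i
  proof -
    have "dE (axis i 1) = 0" using that by (auto simp: dE_def axis_def)
    then show ?thesis unfolding partial_eq[OF hz] h B_def using E0 by (simp add: E_def[symmetric] field_simps)
  qed
  have ax: "axis i 1 $ j = (if i = j then 1 else (0::real))" for i j :: 4 by (auto simp: axis_def)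
  have n1: "real (n - 1) = real n - 1" using n by simp
  note pw = partial_eq[OF w] and pr = partial_eq[OF re] and pi = partial_eq[OF im]
  have d: "calabi_re n b differentiable at x" "calabi_im n b differentiable at x" "calabi_w n b differentiable at x"
    using re im w differentiable_def by blast+
  have dz: "calabi_z n A b differentiable at x" using hz differentiable_def by blast
  have z3: "partial 3 (calabi_z n A b) x = 2 * x$3 * e * (n * B + (real n)\<^sup>2 * ((x$1)\<^sup>2 + (x$2)\<^sup>2) * (B + E\<^sup>2 * e * r * b'))"
    and z4: "partial 4 (calabi_z n A b) x = 2 * x$4 * e * (n * B + (real n)\<^sup>2 * ((x$1)\<^sup>2 + (x$2)\<^sup>2) * (B + E\<^sup>2 * e * r * b'))"
    using E0 by (simp_all add: pz dh_def dE_def ax field_simps)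
  \<comment> \<open>The components of the exterior derivative at the four index triples; each is a
    polynomial identity once the derivatives are inserted.\<close>
  have eqs: "partial 3 (calabi_z n A b) x - partial 1 (calabi_re n b) x + partial 2 (calabi_im n b) x = 0"
    "partial 4 (calabi_z n A b) x - partial 1 (calabi_im n b) x - partial 2 (calabi_re n b) x = 0"
    "partial 1 (calabi_w n b) x - partial 3 (calabi_re n b) x - partial 4 (calabi_im n b) x = 0"
    "partial 2 (calabi_w n b) x + partial 3 (calabi_im n b) x - partial 4 (calabi_re n b) x = 0"
    unfolding z3 z4 pw pr pi dh_def dE_def ax n1 P_def S_def r_def E by (simp_all, algebra+)
  show ?thesis
    unfolding closed_2form_def forall_4 standard_J_calabi
    using eqs by (simp add: calabi_entries partial_minus d dz)
qed

section \<open>The line bundle\<close>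

lemma jacobian_cong:
  assumes "open U" "x \<in> U" "\<And>y. y \<in> U \<Longrightarrow> f y = g y"
  shows "jacobian f (at x) = jacobian g (at x)"
proof -
  have "(f has_derivative D) (at x) \<longleftrightarrow> (g has_derivative D) (at x)" for D
    using assms has_derivative_transform_within_open[of f D x UNIV U g]
      has_derivative_transform_within_open[of g D x UNIV U f] by auto
  then show ?thesis by (simp add: jacobian_def frechet_derivative_def)
qed

lemma fibre_norm_nonzero_derivative:
  assumes "fibre_norm n x > 0"
  obtains D where "(fibre_norm n has_derivative D) (at x)" "\<exists>u. D u \<noteq> 0"
proof
  show "(fibre_norm n has_derivative (\<lambda>u. base_norm x ^ n * (2 * x$3 * u$3 + 2 * x$4 * u$4)
     + n * base_norm x ^ (n - 1) * (2 * x$1 * u$1 + 2 * x$2 * u$2) * ((x$3)\<^sup>2 + (x$4)\<^sup>2))) (at x)"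
    by (rule fibre_norm_has_derivative)
  \<comment> \<open>Euler's relation: \<open>fibre_norm\<close> is homogeneous of degree two in
    \<open>w\<close>, so its derivative in this direction is twice its value.\<close>
  let ?u = "vector [0, 0, x$3, x$4] :: real^4"
  have "base_norm x ^ n * (2 * x$3 * ?u$3 + 2 * x$4 * ?u$4)
     + n * base_norm x ^ (n - 1) * (2 * x$1 * ?u$1 + 2 * x$2 * ?u$2) * ((x$3)\<^sup>2 + (x$4)\<^sup>2) = 2 * fibre_norm n x"
    by (simp add: vector_4 fibre_norm_def power2_eq_square algebra_simps)
  then show "\<exists>u :: real^4. base_norm x ^ n * (2 * x$3 * u$3 + 2 * x$4 * u$4)
     + n * base_norm x ^ (n - 1) * (2 * x$1 * u$1 + 2 * x$2 * u$2) * ((x$3)\<^sup>2 + (x$4)\<^sup>2) \<noteq> 0"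
    using assms by (intro exI[of _ ?u]) simp
qed

locale negative_bundle = momentum_profile n for n
begin

abbreviation "L \<equiv> line_bundle (- int n)"
abbreviation "\<T> \<equiv> manifold_topology L"
text \<open>With these parameters the denominator is \<open>z\<close> and the map is
  \<open>(1 / z, z^n w)\<close>, the gluing map of degree \<open>-n\<close>.\<close>

abbreviation "flip \<equiv> moebius n 0 1 (- 1)"

section \<open>Points, charts and the transition function\<close>

definition point :: "bool \<Rightarrow> real^4 \<Rightarrow> bundle_point" where
  "point i x = bpoint (- int n) i (z_of x) (w_of x)"

lemma unitary_flip: "unitary n 0 1 (- 1)"
  using n by unfold_locales auto

lemma den_flip: "moebius_den 0 1 (- 1) x = z_of x"
  by (simp add: moebius_den_def)

lemmas flip_simps = unitary.fibre_norm_\<phi>[OF unitary_flip, unfolded den_flip]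
  unitary.pullback_calabi[OF unitary_flip, unfolded den_flip]
  unitary.derivative_\<phi>[OF unitary_flip, unfolded den_flip]

lemma coord_point: "coord L i (point i x) = x"
  by (simp add: point_def coord_line_bundle vec_eq_iff forall_4 vector_4 z_of_def w_of_def)

lemma point_in_dom: "point i x \<in> chart_dom L i"
  unfolding chart_dom_line_bundle point_def by blast

lemma bpoint_eq_point: "bpoint (- int n) i z w = point i (complex2_to_real4 (z, w))"
  by (simp add: point_def z_of_complex2 w_of_complex2)

lemma in_dom_iff: "p \<in> chart_dom L i \<longleftrightarrow> (\<exists>x. p = point i x)"
  unfolding chart_dom_line_bundle using bpoint_eq_point point_def by fastforce

lemma chart_inv: "chart_inv L i x = point i x"
  unfolding chart_inv_def using bij_betw_coord_line_bundle[of "- int n" i] coord_point point_in_dom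
  by (metis bij_betw_def inv_into_f_f)

lemma chart_image: "chart_image L i S = {x. point i x \<in> S}"
proof -
  have "x \<in> chart_image L i S \<longleftrightarrow> point i x \<in> S" for x
  proof
    assume "x \<in> chart_image L i S"
    then obtain p where "p \<in> S" "p \<in> chart_dom L i" "x = coord L i p" by (auto simp: chart_image_def)
    then show "point i x \<in> S" by (auto simp: in_dom_iff coord_point)
  next
    assume "point i x \<in> S"
    then show "x \<in> chart_image L i S" unfolding chart_image_def
      using point_in_dom coord_point by (metis IntI image_eqI)
  qed
  then show ?thesis by blast
qed

lemma point_in_total: "point i x \<in> total_space (- int n)"
  using point_in_dom carrier_line_bundle unfolding carrier_def by blast

lemma total_cases:
  assumes "p \<in> total_space (- int n)"
  obtains i x where "p = point i x"
  using assms unfolding total_space_eq bpoint_eq_point by blast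

lemma point_eq_iff: "point i x = point j y \<longleftrightarrow> (if i = j then x = y else z_of x \<noteq> 0 \<and> y = flip x)"
proof -
  have "point i x = point j y \<longleftrightarrow> ((i, z_of x, w_of x), (j, z_of y, w_of y)) \<in> glue (- int n)"
    unfolding point_def bpoint_def by (rule eq_equiv_class_iff[OF equiv_glue]) auto
  also have "\<dots> \<longleftrightarrow> (if i = j then x = y else z_of x \<noteq> 0 \<and> y = flip x)"
  proof -
    have "y = flip x \<longleftrightarrow> z_of y = 1 / z_of x \<and> w_of y = z_of x ^ n * w_of x"
      unfolding moebius_def den_flip using complex2_z_of_w_of z_of_complex2 w_of_complex2 by (metis add.left_neutral mult_zero_left)
    moreover have "x = y \<longleftrightarrow> z_of x = z_of y \<and> w_of x = w_of y"
      using complex2_z_of_w_of by metis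
    ultimately show ?thesis by (auto simp: glue_def)
  qed
  finally show ?thesis .
qed

lemma point_flip: "z_of x \<noteq> 0 \<Longrightarrow> point (\<not> i) (flip x) = point i x"
  using point_eq_iff[of i x "\<not> i" "flip x"] by simp

text \<open>The truth value of the membership serves as chart index: chart \<open>True\<close> where
  it is defined, chart \<open>False\<close> on the remaining fibre. Invariance of
  \<open>fibre_norm\<close> under \<open>flip\<close> makes the choice immaterial.\<close>

definition bundle_norm :: "bundle_point \<Rightarrow> real" where
  "bundle_norm p = fibre_norm n (coord L (p \<in> chart_dom L True) p)"

lemma bundle_norm_point: "bundle_norm (point i x) = fibre_norm n x"
proof (cases "point i x \<in> chart_dom L True")
  case True
  then obtain y where y: "point i x = point True y" by (auto simp: in_dom_iff)
  then have "fibre_norm n y = fibre_norm n x"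
    using point_eq_iff[of i x True y] flip_simps(1)[of x] by (auto split: if_splits)
  moreover have "bundle_norm (point i x) = fibre_norm n y"
    using True y by (simp add: bundle_norm_def coord_point)
  ultimately show ?thesis by simp
next
  case False
  then have "i = False" using point_in_dom by (cases i) auto
  then show ?thesis using False by (simp add: bundle_norm_def coord_point)
qed

lemma transition_same: "transition L i i = id"
  by (rule ext) (simp add: transition_def chart_inv coord_point)

lemma transition_flip: "z_of x \<noteq> 0 \<Longrightarrow> transition L i (\<not> i) x = flip x"
  using point_flip[of x i] coord_point[of "\<not> i" "flip x"] by (simp add: transition_def chart_inv)

lemma open_z_nonzero: "open {x. z_of x \<noteq> 0}"
  using unitary.open_den[OF unitary_flip] by (simp add: den_flip)

lemma jacobian_transition_flip:
  assumes "z_of x \<noteq> 0"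
  shows "jacobian (transition L i (\<not> i)) (at x) = jacobian_matrix flip x"
proof -
  have "jacobian (transition L i (\<not> i)) (at x) = jacobian flip (at x)"
    by (rule jacobian_cong[OF open_z_nonzero]) (use assms transition_flip in auto)
  also have "\<dots> = jacobian_matrix flip x"
    using unitary.Cinf_on_\<phi>[OF unitary_flip open_z_nonzero] assms
    by (intro jacobian_eq_jacobian_matrix Cinf_on_differentiable[of "{x. z_of x \<noteq> 0}"]) (auto simp: den_flip)
  finally show ?thesis .
qed

lemma jacobian_transition_same: "jacobian (transition L i i) (at x) = mat 1"
proof -
  have "frechet_derivative (id :: real^4 \<Rightarrow> real^4) (at x) = id"
    by (rule frechet_derivative_at[symmetric]) (auto simp: id_def)
  then show ?thesis by (simp add: transition_same jacobian_def matrix_id_mat_1)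
qed

lemma overlap_cases:
  assumes "p \<in> chart_dom L i \<inter> chart_dom L j"
  obtains x where "p = point i x" "i = j" | x where "p = point i x" "p = point j (flip x)" "z_of x \<noteq> 0" "j = (\<not> i)"
proof -
  obtain x y where x: "p = point i x" and y: "p = point j y" using assms by (auto simp: in_dom_iff)
  show thesis
  proof (cases "i = j")
    case True
    then show thesis by (rule that(1)[OF x])
  next
    case False
    then have "z_of x \<noteq> 0" "y = flip x" using point_eq_iff[of i x j y] x y by simp_all
    then show thesis using that(2)[OF x] y False by simp
  qed
qed

lemma smooth_componentsI:
  assumes "matrix_Cinf_on U G" "\<And>i x. point i x \<in> S \<Longrightarrow> x \<in> U"
  shows "smooth_components L S (\<lambda>_. G)"
  unfolding smooth_components_def
proof (intro allI)
  fix i a b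
  have "Cinf_on U (\<lambda>x. G x $ a $ b)" using assms(1) by (simp add: matrix_Cinf_on_def)
  then show "smooth_on (chart_image L i S) (\<lambda>x. G x $ a $ b)"
    by (rule smooth_on_Cinf_on) (use assms(2) in \<open>auto simp: chart_image\<close>)
qed

text \<open>The same matrix function \<open>G\<close> gives the components in both charts, so the
  transformation law amounts to invariance under \<open>flip\<close>.\<close>

lemma riemannian_metricI:
  assumes G: "metric_on U G" and S: "\<And>i x. point i x \<in> S \<Longrightarrow> x \<in> U"
    and pullback: "\<And>x. z_of x \<noteq> 0 \<Longrightarrow> G x = transpose (jacobian_matrix flip x) ** G (flip x) ** jacobian_matrix flip x"
  shows "riemannian_metric L S (\<lambda>_. G)"
  unfolding riemannian_metric_def covariant_tensor_def
proof (intro conjI allI ballI)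
  show "smooth_components L S (\<lambda>_. G)"
    by (rule smooth_componentsI[of U]) (use G S metric_on_Cinf_on in \<open>auto simp: matrix_Cinf_on_def\<close>)
  fix i j p assume "p \<in> S \<inter> chart_dom L i \<inter> chart_dom L j"
  then have "p \<in> chart_dom L i \<inter> chart_dom L j" by simp
  then show "let D = jacobian (transition L i j) (at (coord L i p)) in G (coord L i p) = transpose D ** G (coord L j p) ** D"
  proof (cases rule: overlap_cases)
    case (1 x)
    then show ?thesis by (simp add: jacobian_transition_same Let_def)
  next
    case (2 x)
    then have "coord L i p = x" "coord L j p = flip x" using coord_point by metis+
    then show ?thesis using 2 pullback by (simp add: jacobian_transition_flip Let_def)
  qed
qed (use G S in \<open>auto simp: chart_image metric_on_def\<close>)

section \<open>Topology of the disk bundle\<close>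

lemma openin_iff: "openin \<T> V \<longleftrightarrow> V \<subseteq> total_space (- int n) \<and> (\<forall>i. open {x. point i x \<in> V})"
  using openin_manifold_topology[of L V] bij_betw_coord_line_bundle[of "- int n"]
  by (simp add: bij_betw_def carrier_line_bundle chart_image)

lemma topspace_eq: "topspace \<T> = total_space (- int n)"
proof
  show "topspace \<T> \<subseteq> total_space (- int n)" using openin_iff openin_topspace by blast
  have "openin \<T> (total_space (- int n))" by (simp add: openin_iff point_in_total)
  then show "total_space (- int n) \<subseteq> topspace \<T>" by (rule openin_subset)
qed

lemma continuous_map_point: "continuous_map euclidean \<T> (point i)"
  by (auto simp: continuous_map_def topspace_eq point_in_total openin_iff)

definition end_norm :: real where "end_norm = fibre_of end_momentum"

lemma end_norm_pos: "end_norm > 0"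
  using fibre_of_strict_mono[of 1 end_momentum] end_momentum_gt by (simp add: end_norm_def fibre_of_def[of 1])

lemma momentum_less_end: "momentum (fibre_norm n x) < end_momentum \<longleftrightarrow> fibre_norm n x < end_norm"
  unfolding end_norm_def using end_momentum_gt
  by (intro momentum_less_iff nonneg_in_J fibre_norm_nonneg) simp

lemma momentum_end_norm: "momentum end_norm = end_momentum"
  unfolding end_norm_def using end_momentum_gt by (intro momentum_fibre_of) simp

definition disk :: "bundle_point set" where
  "disk = {p \<in> total_space (- int n). bundle_norm p < end_norm}"

lemma point_in_disk: "point i x \<in> disk \<longleftrightarrow> fibre_norm n x < end_norm"
  by (simp add: disk_def point_in_total bundle_norm_point)

lemma continuous_fibre_norm: "continuous_on UNIV (fibre_norm n)"
  by (rule Cinf_on_continuous[OF Cinf_on_fibre_norm]) simp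

lemma openin_disk: "openin \<T> disk"
  unfolding openin_iff point_in_disk
  using continuous_fibre_norm by (auto simp: disk_def intro: open_Collect_less)

definition closed_disk :: "bundle_point set" where
  "closed_disk = {p \<in> total_space (- int n). bundle_norm p \<le> end_norm}"

lemma closedin_closed_disk: "closedin \<T> closed_disk"
proof -
  have "topspace \<T> - closed_disk = {p \<in> total_space (- int n). end_norm < bundle_norm p}"
    by (auto simp: closed_disk_def topspace_eq)
  moreover have "openin \<T> {p \<in> total_space (- int n). end_norm < bundle_norm p}"
    unfolding openin_iff using continuous_fibre_norm
    by (auto simp: bundle_norm_point point_in_total intro: open_Collect_less)
  ultimately show ?thesis by (auto simp: closedin_def closed_disk_def topspace_eq)
qed

lemma closure_disk: "\<T> closure_of disk \<subseteq> closed_disk"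
  by (rule closure_of_minimal[OF _ closedin_closed_disk]) (auto simp: disk_def closed_disk_def)

lemma frontier_disk:
  assumes "p \<in> \<T> frontier_of disk"
  obtains i x where "p = point i x" "fibre_norm n x = end_norm"
proof -
  have p: "p \<in> closed_disk" "p \<notin> disk"
    using assms closure_disk by (auto simp: frontier_of_def interior_of_openin[OF openin_disk])
  then obtain i x where x: "p = point i x" by (auto simp: closed_disk_def elim: total_cases)
  show thesis using that[OF x] p by (simp add: x closed_disk_def disk_def bundle_norm_point point_in_total)
qed

text \<open>The parts over \<open>|z| \<le> 1\<close> of the two charts cover the bundle. Since
  \<open>|w|^2\<close> is at most \<open>fibre_norm\<close>, each part of the closed disk bundle is
  the image of a compact set.\<close>

lemma compactin_closed_disk: "compactin \<T> closed_disk"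
proof -
  define C where "C = {x :: real^4. (x$1)\<^sup>2 + (x$2)\<^sup>2 \<le> 1 \<and> fibre_norm n x \<le> end_norm}"
  have "closed C" unfolding C_def
    by (intro closed_Collect_conj closed_Collect_le continuous_intros continuous_fibre_norm)
  moreover have "bounded C"
  proof (rule boundedI)
    fix x assume x: "x \<in> C"
    have "(x$3)\<^sup>2 + (x$4)\<^sup>2 \<le> fibre_norm n x"
      using mult_right_mono[of 1 "base_norm x ^ n" "(x$3)\<^sup>2 + (x$4)\<^sup>2"]
      by (simp add: fibre_norm_def base_norm_def one_le_power)
    then have "(norm x)\<^sup>2 \<le> 1 + end_norm"
      using x by (simp add: C_def norm_vec_def L2_set_def sum_4 sum_nonneg)
    then show "norm x \<le> sqrt (1 + end_norm)" by (rule real_le_rsqrt)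
  qed
  ultimately have "compact C" by (simp add: compact_eq_bounded_closed)
  then have "compactin \<T> (point i ` C)" for i
    by (intro image_compactin[OF _ continuous_map_point]) simp
  then have "compactin \<T> (point True ` C \<union> point False ` C)" by (intro compactin_Un)
  moreover have "closed_disk \<subseteq> point True ` C \<union> point False ` C"
  proof
    fix p assume p: "p \<in> closed_disk"
    then obtain i x where x: "p = point i x" by (auto simp: closed_disk_def elim: total_cases)
    have h: "fibre_norm n x \<le> end_norm" using p by (simp add: x closed_disk_def bundle_norm_point)
    have "\<exists>j y. p = point j y \<and> y \<in> C"
    proof (cases "cmod (z_of x) \<le> 1")
      case True
      then have "(cmod (z_of x))\<^sup>2 \<le> 1" by (simp add: abs_square_le_1)
      then have "x \<in> C" using h by (simp add: C_def z_of_def cmod_power2)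
      then show ?thesis using x by blast
    next
      case False
      then have z: "z_of x \<noteq> 0" by auto
      have "z_of (flip x) = 1 / z_of x" by (simp add: moebius_def den_flip z_of_complex2)
      then have "(cmod (z_of (flip x)))\<^sup>2 \<le> 1" using False by (simp add: norm_divide abs_square_le_1 divide_le_eq_1)
      then have "flip x \<in> C" using h flip_simps(1)[OF z] by (simp add: C_def z_of_def cmod_power2)
      then show ?thesis using x point_flip[OF z, of i] by metis
    qed
    then show "p \<in> point True ` C \<union> point False ` C" by (metis (full_types) UnI1 UnI2 image_eqI)
  qed
  ultimately show ?thesis using closed_compactin closedin_closed_disk by blast
qed

lemma smooth_funI:
  assumes "Cinf_on U F" "\<And>i x. point i x \<in> S \<Longrightarrow> x \<in> U" "\<And>i x. f (point i x) = F x"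
  shows "smooth_fun L S f"
  unfolding smooth_fun_def
proof
  fix i
  have eq: "f \<circ> chart_inv L i = F" by (rule ext) (simp add: chart_inv assms(3))
  show "smooth_on (chart_image L i S) (f \<circ> chart_inv L i)"
    unfolding eq chart_image using assms(2) by (intro smooth_on_Cinf_on[OF assms(1)]) auto
qed

text \<open>As \<open>end_norm > 0\<close>, the boundary avoids the zero section, the only place
  where the differential of \<open>fibre_norm\<close> vanishes; the chain rule does the
  rest.\<close>

lemma nonzero_differentialI:
  assumes f: "\<And>i x. f (point i x) = F (fibre_norm n x)"
    and F: "(F has_real_derivative F') (at end_norm)" "F' \<noteq> 0"
    and p: "p = point i x" "fibre_norm n x = end_norm"
  shows "nonzero_differential L S f p"
  unfolding nonzero_differential_def
proof (intro allI impI)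
  fix j assume "p \<in> chart_dom L j"
  then obtain y where y: "p = point j y" by (auto simp: in_dom_iff)
  have hy: "fibre_norm n y = end_norm" using p y bundle_norm_point by metis
  obtain D where D: "(fibre_norm n has_derivative D) (at y)" "\<exists>u. D u \<noteq> 0"
    using fibre_norm_nonzero_derivative[of n y] end_norm_pos hy by metis
  have "((\<lambda>z. F (fibre_norm n z)) has_derivative (\<lambda>u. F' * D u)) (at y)"
    using has_derivative_compose[OF D(1), of F "(*) F'"] F(1) by (simp add: hy has_field_derivative_def)
  moreover have "f \<circ> chart_inv L j = (\<lambda>z. F (fibre_norm n z))" by (rule ext) (simp add: chart_inv f)
  moreover have "(\<lambda>u. F' * D u) \<noteq> (\<lambda>_. 0)" using D(2) F(2) by (metis mult_eq_0_iff)
  ultimately show "\<exists>D. ((f \<circ> chart_inv L j) has_derivative D) (at (coord L j p) within chart_image L j S) \<and> D \<noteq> (\<lambda>_. 0)"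
    unfolding y coord_point by (metis has_derivative_at_withinI)
qed

lemma disk_bundle_disk: "disk_bundle (- int n) disk"
proof -
  \<comment> \<open>Rescaled so that the boundary becomes the unit circle bundle.\<close>
  define H where "H p = bundle_norm p / end_norm" for p
  have "smooth_fun L (total_space (- int n)) H"
  proof (rule smooth_funI[of UNIV "\<lambda>x. fibre_norm n x * (1 / end_norm)"])
    show "Cinf_on UNIV (\<lambda>x. fibre_norm n x * (1 / end_norm))"
      by (intro Cinf_on_mult Cinf_on_fibre_norm Cinf_on_const) auto
  qed (auto simp: H_def bundle_norm_point)
  moreover have "H (bpoint (- int n) i z w) = (cmod w)\<^sup>2 * H (bpoint (- int n) i z 1)" "H (bpoint (- int n) i z 1) > 0" for i z w
    using end_norm_pos base_norm_pos
    by (simp_all add: H_def bpoint_eq_point bundle_norm_point fibre_norm_complex base_norm_complex w_of_complex2 z_of_complex2 add_pos_nonneg)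
  moreover have "disk = {p \<in> total_space (- int n). H p < 1}"
    using end_norm_pos by (simp add: disk_def H_def)
  ultimately show ?thesis unfolding disk_bundle_def hermitian_norm_sq_def by blast
qed

lemma compact_domain_disk: "compact_domain_with_boundary L disk"
  unfolding compact_domain_with_boundary_def
proof (intro conjI ballI)
  show "openin \<T> disk" by (rule openin_disk)
  show "compactin \<T> (\<T> closure_of disk)"
    by (rule closed_compactin[OF compactin_closed_disk closure_disk]) simp
  fix p assume "p \<in> \<T> frontier_of disk"
  then obtain i x where p: "p = point i x" "fibre_norm n x = end_norm" by (rule frontier_disk)
  \<comment> \<open>One boundary function on the whole total space serves every frontier
    point.\<close>
  let ?\<rho> = "\<lambda>p. bundle_norm p - end_norm" and ?W = "total_space (- int n)"
  have "smooth_fun L ?W ?\<rho>"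
  proof (rule smooth_funI[of UNIV "\<lambda>x. fibre_norm n x - end_norm"])
    show "Cinf_on UNIV (\<lambda>x. fibre_norm n x - end_norm)"
      by (intro Cinf_on_diff Cinf_on_fibre_norm Cinf_on_const) auto
  qed (auto simp: bundle_norm_point)
  moreover have "nonzero_differential L ?W ?\<rho> p"
  proof (rule nonzero_differentialI[OF _ _ _ p])
    show "((\<lambda>r. r - end_norm) has_real_derivative 1) (at end_norm)" by (auto intro!: derivative_eq_intros)
  qed (auto simp: bundle_norm_point)
  moreover have "openin \<T> ?W" using openin_topspace[of \<T>] by (simp add: topspace_eq)
  moreover have "?W \<inter> disk = {q \<in> ?W. ?\<rho> q < 0}" by (auto simp: disk_def)
  ultimately show "\<exists>W \<rho>. openin \<T> W \<and> p \<in> W \<and> smooth_fun L W \<rho> \<and> nonzero_differential L W \<rho> p \<and> W \<inter> disk = {q \<in> W. \<rho> q < 0}"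
    using p(1) point_in_total by (intro exI[of _ ?W] exI[of _ ?\<rho>]) simp
qed

section \<open>The metrics on the disk bundle\<close>

lemma distance_flip: "z_of x \<noteq> 0 \<Longrightarrow> distance (flip x) = distance x"
  by (simp add: distance_def flip_simps(1))

lemma lebrun_pullback: "z_of x \<noteq> 0 \<Longrightarrow> lebrun x = transpose (jacobian_matrix flip x) ** lebrun (flip x) ** jacobian_matrix flip x"
  unfolding lebrun_def by (rule flip_simps(2))

lemma poincare_pullback: "z_of x \<noteq> 0 \<Longrightarrow> poincare x = transpose (jacobian_matrix flip x) ** poincare (flip x) ** jacobian_matrix flip x"
  unfolding poincare_def distance_flip
  by (subst lebrun_pullback) (simp_all add: vec_eq_iff matrix_matrix_mult_def sum_distrib_left sum_distrib_right mult_ac)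

text \<open>\<open>S\<close> is arbitrary because this metric is used on the closure of the disk
  bundle as well, where it is the smooth extension of \<open>v^2 k\<close>.\<close>

lemma riemannian_lebrun: "riemannian_metric L S (\<lambda>_. lebrun)"
  by (rule riemannian_metricI[OF metric_on_lebrun _ lebrun_pullback]) auto

lemma riemannian_poincare: "riemannian_metric L disk (\<lambda>_. poincare)"
  by (rule riemannian_metricI[OF metric_on_poincare _ poincare_pullback]) (auto simp: point_in_disk momentum_less_end)

definition boundary_distance :: "bundle_point \<Rightarrow> real" where
  "boundary_distance p = end_momentum - momentum (bundle_norm p)"

lemma boundary_distance_point: "boundary_distance (point i x) = distance x"
  by (simp add: boundary_distance_def distance_def bundle_norm_point)

lemma boundary_distance_pos: "p \<in> disk \<Longrightarrow> boundary_distance p > 0"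
proof -
  assume p: "p \<in> disk"
  then obtain i x where x: "p = point i x" by (auto simp: disk_def elim: total_cases)
  then show ?thesis using p by (simp add: boundary_distance_point distance_def momentum_less_end point_in_disk)
qed

lemma defining_function_disk: "defining_function L disk boundary_distance"
  unfolding defining_function_def
proof (intro conjI ballI)
  show "smooth_fun L (\<T> closure_of disk) boundary_distance"
    by (rule smooth_funI[OF Cinf_on_distance]) (auto simp: boundary_distance_point)
  show "boundary_distance p > 0" if "p \<in> disk" for p using that by (rule boundary_distance_pos)
  fix p assume "p \<in> \<T> frontier_of disk"
  then obtain i x where p: "p = point i x" "fibre_norm n x = end_norm" by (rule frontier_disk)
  show "boundary_distance p = 0" by (simp add: p boundary_distance_point distance_def momentum_end_norm)
  show "nonzero_differential L (\<T> closure_of disk) boundary_distance p"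
  proof (rule nonzero_differentialI[OF _ _ _ p])
    show "((\<lambda>r. end_momentum - momentum r) has_real_derivative - slope (momentum end_norm)) (at end_norm)"
      using momentum_deriv[OF nonneg_in_J] end_norm_pos by (auto intro!: derivative_eq_intros)
    show "- slope (momentum end_norm) \<noteq> 0"
      using slope_pos[of end_momentum] end_momentum_gt by (simp add: momentum_end_norm)
  qed (simp add: boundary_distance_point distance_def)
qed

lemma lebrun_eq_poincare:
  assumes "p \<in> disk" "p \<in> chart_dom L i"
  shows "lebrun (coord L i p) = (boundary_distance p)\<^sup>2 *\<^sub>R poincare (coord L i p)"
proof -
  obtain x where x: "p = point i x" using assms(2) by (auto simp: in_dom_iff)
  have "distance x > 0" using boundary_distance_pos[OF assms(1)] by (simp add: x boundary_distance_point)
  then show ?thesis by (simp add: x coord_point boundary_distance_point poincare_def)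
qed

lemma einstein_poincare: "einstein L disk (\<lambda>_. poincare)"
  unfolding einstein_def using riemannian_poincare poincare_einstein_local
  by (intro conjI exI[of _ "- 6 * real n / real (n - 2)"])
     (simp_all add: chart_image point_in_disk momentum_less_end[symmetric])

text \<open>The compactification is \<open>lebrun\<close> itself: multiplying
  \<open>poincare\<close> by the square of \<open>boundary_distance\<close> gives back a metric that
  is smooth across the boundary.\<close>

lemma poincare_einstein_poincare: "poincare_einstein L disk (\<lambda>_. poincare)"
  unfolding poincare_einstein_def conformally_compact_def
  using compact_domain_disk riemannian_poincare einstein_poincare defining_function_disk riemannian_lebrun lebrun_eq_poincare
  by (intro conjI exI[of _ boundary_distance] exI[of _ "\<lambda>_. lebrun"]) auto

lemma conformal_lebrun: "conformal L disk (\<lambda>_. poincare) (\<lambda>_. lebrun)"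
  unfolding conformal_def
proof (intro exI[of _ "\<lambda>p. (boundary_distance p)\<^sup>2"] conjI)
  show "smooth_fun L disk (\<lambda>p. (boundary_distance p)\<^sup>2)"
    by (rule smooth_funI[OF Cinf_on_power[OF Cinf_on_distance, of 2]]) (auto simp: boundary_distance_point)
qed (use boundary_distance_pos lebrun_eq_poincare in force)+

text \<open>\<open>flip\<close> is holomorphic: its derivative is complex linear in
  \<open>z_of u\<close> and \<open>w_of u\<close>, so it commutes with multiplication by the
  imaginary unit. The Nijenhuis tensor vanishes because the components are constant.\<close>

lemma complex_structure_standard: "complex_structure L disk (\<lambda>_ _. standard_J)"
proof -
  have zJ: "z_of (standard_J *v u) = \<i> * z_of u" and wJ: "w_of (standard_J *v u) = \<i> * w_of u" for u
    by (simp_all add: z_of_def w_of_def complex_eq_iff standard_J_def matrix_vector_mult_def sum_4)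
  have comm: "jacobian_matrix flip x ** standard_J = standard_J ** jacobian_matrix flip x" if "z_of x \<noteq> 0" for x
  proof -
    have "jacobian_matrix flip x *v (standard_J *v u) = standard_J *v (jacobian_matrix flip x *v u)" for u
    proof -
      have "z_of (jacobian_matrix flip x *v (standard_J *v u)) = z_of (standard_J *v (jacobian_matrix flip x *v u))"
        "w_of (jacobian_matrix flip x *v (standard_J *v u)) = w_of (standard_J *v (jacobian_matrix flip x *v u))"
        by (simp_all add: flip_simps(3,4)[OF that] zJ wJ algebra_simps)
      then show ?thesis using complex2_z_of_w_of by metis
    qed
    then show ?thesis by (simp add: matrix_eq matrix_vector_mul_assoc)
  qed
  have "endomorphism_field L disk (\<lambda>_ _. standard_J)"
    unfolding endomorphism_field_def
  proof (intro conjI allI ballI)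
    show "smooth_components L disk (\<lambda>_ _. standard_J)"
      by (rule smooth_componentsI[of UNIV]) (auto simp: matrix_Cinf_on_def Cinf_on_const)
    fix i j p assume "p \<in> disk \<inter> chart_dom L i \<inter> chart_dom L j"
    then have "p \<in> chart_dom L i \<inter> chart_dom L j" by simp
    then show "let D = jacobian (transition L i j) (at (coord L i p)) in D ** standard_J = standard_J ** D"
    proof (cases rule: overlap_cases)
      case (1 x)
      then show ?thesis by (simp add: jacobian_transition_same Let_def)
    next
      case (2 x)
      then have "coord L i p = x" using coord_point by metis
      then show ?thesis using 2 comm by (simp add: jacobian_transition_flip Let_def)
    qed
  qed
  then show ?thesis unfolding complex_structure_def by (simp add: standard_J_sq nijenhuis_def)
qed

text \<open>\<open>A = n s\<close> and \<open>b = s'\<close> satisfy the relation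
  \<open>A' = n b\<close> that \<open>calabi_closed\<close> asks for.\<close>

lemma kaehler_lebrun: "kaehler L disk (\<lambda>_. lebrun)"
proof -
  have "closed_2form (\<lambda>y. transpose standard_J ** lebrun y) x" for x
    unfolding lebrun_def
  proof (rule calabi_closed)
    have J: "fibre_norm n x \<in> J" by (rule nonneg_in_J[OF fibre_norm_nonneg])
    show "((\<lambda>r. real n * momentum r) has_real_derivative real n * slope (momentum (fibre_norm n x))) (at (fibre_norm n x))"
      using momentum_deriv[OF J] by (auto intro!: derivative_eq_intros)
    show "((\<lambda>r. slope (momentum r)) has_real_derivative
      slope (momentum (fibre_norm n x)) * curvature_factor (momentum (fibre_norm n x)) * slope (momentum (fibre_norm n x))) (at (fibre_norm n x))"
      using DERIV_chain2[OF slope_deriv[OF momentum(1)[OF J]] momentum_deriv[OF J]] .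
  qed (use n in simp)
  then show ?thesis
    unfolding kaehler_def using riemannian_lebrun complex_structure_standard
    by (intro conjI exI[of _ "\<lambda>_ _. standard_J"]) (auto simp: lebrun_def standard_J_compatible)
qed

lemma not_kaehler_poincare: "\<not> kaehler L disk (\<lambda>_. poincare)"
proof
  assume "kaehler L disk (\<lambda>_. poincare)"
  then obtain K where K: "complex_structure L disk K" and
    KG: "\<And>i x. x \<in> chart_image L i disk \<Longrightarrow> transpose (K i x) ** poincare x ** K i x = poincare x \<and>
           closed_2form (\<lambda>y. transpose (K i y) ** poincare y) x"
    unfolding kaehler_def by blast
  define V where "V = {x :: real^4. momentum (fibre_norm n x) < end_momentum}"
  have V: "chart_image L i disk = V" for i by (auto simp: V_def chart_image point_in_disk momentum_less_end)
  have g: "metric_on V poincare" unfolding V_def by (rule metric_on_poincare)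
  \<comment> \<open>\<open>K\<close> is an arbitrary complex structure. It is studied in one chart,
    whose origin is a point of the zero section, and the contradiction arises there.\<close>
  interpret kaehler_chart V poincare "K True"
  proof
    show "matrix_Cinf_on V (K True)"
      unfolding matrix_Cinf_on_def
    proof (intro allI)
      fix a b
      have "smooth_on V (\<lambda>x. K True x $ a $ b)"
        using K V unfolding complex_structure_def endomorphism_field_def smooth_components_def by metis
      then show "Cinf_on V (\<lambda>x. K True x $ a $ b)" by (rule smooth_on_open_imp_Cinf_on[OF metric_on_open[OF g]])
    qed
  qed (use g K KG V in \<open>auto simp: complex_structure_def\<close>)
  have "momentum 0 = 1" using momentum_fibre_of[of 1] by (simp add: fibre_of_def)
  then have x: "base_point 0 \<in> V" using end_momentum_gt by (simp add: V_def fibre_norm_base_point)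
  show False using poincare_not_kaehler_at_zero[OF J_sq[OF x] curvature_commutes_J[OF x]] .
qed

lemma scalar_flat_lebrun: "scalar_flat L disk (\<lambda>_. lebrun)"
  by (simp add: scalar_flat_def lebrun_scalar_flat)

end

theorem theorem1p4:
  fixes m :: int
  assumes "m \<ge> 3"
  shows "\<exists>N k. disk_bundle (- m) N \<and>
           poincare_einstein (line_bundle (- m)) N k \<and>
           \<not> kaehler (line_bundle (- m)) N k \<and>
           (\<exists>g. conformal (line_bundle (- m)) N k g \<and>
                kaehler (line_bundle (- m)) N g \<and>
                scalar_flat (line_bundle (- m)) N g)"
proof -
  interpret negative_bundle "nat m" using assms by unfold_locales simp
  have m: "int (nat m) = m" using assms by simp
  show ?thesis
    using disk_bundle_disk poincare_einstein_poincare not_kaehler_poincare conformal_lebrun kaehler_lebrun scalar_flat_lebrun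
    unfolding m by blast
qed

end
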